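(* Let $\varphi$ be the standard normal density and, for a probability measure $F$ on $\mathbb R$ and $\sigma>0$, let $p_{F,\sigma}=\int_{\mathbb R}\sigma^{-1}\varphi((\cdot-y)/\sigma)\,dF(y)$. Let the prior $\Pi^\alpha$ be the law of $p_{F,\sigma}$ where $F\sim D_\alpha$, the Dirichlet process with base measure $\alpha=\alpha(\mathbb R)\bar\alpha$ ($\alpha(\mathbb R)<\infty$, $\bar\alpha$ a probability measure on $\mathbb R$), and, independently, $\sigma\sim G$, where $G$ is a probability distribution with compact support in $(0,\infty)$. Let $X_1,\dots,X_n$ be i.i.d. on $\mathbb R$ with law $P_0$ and density $p_0=p_{F_0,\sigma_0}$, where $\sigma_0>0$ and $F_0$ is a probability measure supported in $[-k_0,k_0]$, $k_0>0$. Suppose that $G$ has a positive continuous density in a neighborhood of $\sigma_0$, and that the base measure $\alpha$ has compact support and a continuous density on an interval containing $[-k_0,k_0]$. Then there exist finite positive constants $M,\eta$ such that $$\Pi^\alpha\Big\{p\in\mathcal P:\|p-p_0\|_\infty\ge M\frac{(\log n)^\eta}{\sqrt n}\,\Big|\,X_1,\dots,X_n\Big\}\to0\quad\text{as }n\to\infty$$ in $P_0^{\mathbb N}$-probability.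
   Context: $\mathcal P$ is the class of probability densities on $\mathbb R$; $\|f\|_\infty=\sup_{x\in\mathbb R}|f(x)|$. The posterior is $\Pi(A|X_1,\dots,X_n)=\int_A\prod_{i=1}^np(X_i)\,d\Pi(p)\big/\int\prod_{i=1}^np(X_i)\,d\Pi(p)$. The Dirichlet process $D_\alpha$ with base measure $\alpha$ is the law of a random probability measure $F$ on $\mathbb R$ such that for each finite measurable partition $A_1,\dots,A_m$ of $\mathbb R$, $(F(A_1),\dots,F(A_m))$ has the Dirichlet distribution with parameters $(\alpha(A_1),\dots,\alpha(A_m))$.
   Formalization: The continuous density of the base measure α on an interval containing [-k₀,k₀] is additionally assumed positive there; without positivity the claim fails, e.g. for α uniform on [10,11], F₀ a point mass at 0, σ₀ = 1. *)

theory Defs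
  imports "HOL-Probability.Probability"
begin

definition prob_densities :: "(real \<Rightarrow> real) set" where
  "prob_densities =
     {p. p \<in> borel_measurable borel \<and> (\<forall>x. 0 \<le> p x) \<and> (\<integral>\<^sup>+x. ennreal (p x) \<partial>lborel) = 1}"

text \<open>Extended-valued, since a density may be unbounded.\<close>

definition sup_norm :: "(real \<Rightarrow> real) \<Rightarrow> ennreal" where
  "sup_norm f = (SUP x. ennreal \<bar>f x\<bar>)"

definition msupport :: "'a::topological_space measure \<Rightarrow> 'a set" where
  "msupport \<mu> = {x. \<forall>U. open U \<and> x \<in> U \<longrightarrow> 0 < emeasure \<mu> U}"

definition has_density_on :: "real measure \<Rightarrow> real set \<Rightarrow> (real \<Rightarrow> real) \<Rightarrow> bool" where
  "has_density_on \<mu> S f \<longleftrightarrow>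
     (\<forall>A\<in>sets borel. A \<subseteq> S \<longrightarrow> emeasure \<mu> A = (\<integral>\<^sup>+x\<in>A. ennreal (f x) \<partial>lborel))"

text \<open>
  The Dirichlet distribution is the law of a normalised vector of independent Gamma variables
  (Ferguson). Shape parameter 0 stands for the point mass at 0, so cells of
  base-measure zero are allowed; at least one parameter should be positive.
\<close>

definition gamma_law :: "real \<Rightarrow> real measure" where
  "gamma_law a = (if a = 0 then return borel 0
     else density lborel
       (\<lambda>x. ennreal (if 0 < x then x powr (a - 1) * exp (- x) / Gamma a else 0)))"

definition dirichlet_distribution :: "nat \<Rightarrow> (nat \<Rightarrow> real) \<Rightarrow> (nat \<Rightarrow> real) measure" where
  "dirichlet_distribution m a =
     distr (\<Pi>\<^sub>M i\<in>{..<m}. gamma_law (a i)) (\<Pi>\<^sub>M i\<in>{..<m}. borel)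
       (\<lambda>z. \<lambda>i\<in>{..<m}. z i / (\<Sum>j<m. z j))"

definition is_dirichlet_process :: "real measure \<Rightarrow> real measure measure \<Rightarrow> bool" where
  "is_dirichlet_process \<alpha> D \<longleftrightarrow>
     prob_space D \<and> sets D = sets (prob_algebra borel) \<and>
     (\<forall>m (A :: nat \<Rightarrow> real set).
        (\<forall>i<m. A i \<in> sets borel) \<and> disjoint_family_on A {..<m} \<and> (\<Union>i<m. A i) = UNIV \<longrightarrow>
        distr D (\<Pi>\<^sub>M i\<in>{..<m}. borel) (\<lambda>F. \<lambda>i\<in>{..<m}. measure F (A i)) =
          dirichlet_distribution m (\<lambda>i. measure \<alpha> (A i)))"

definition normal_mixture :: "real measure \<Rightarrow> real \<Rightarrow> real \<Rightarrow> real" where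
  "normal_mixture F \<sigma> x = (\<integral>y. inverse \<sigma> * std_normal_density ((x - y) / \<sigma>) \<partial>F)"

text \<open>
  The law of a random element \<open>f\<close> of a set \<open>P\<close>, carried by the largest sigma-algebra over \<open>P\<close>
  that makes \<open>f\<close> measurable. (The product sigma-algebra on functions would not contain
  supremum-norm balls.)
\<close>

definition law_on :: "'a measure \<Rightarrow> 'b set \<Rightarrow> ('a \<Rightarrow> 'b) \<Rightarrow> 'b measure" where
  "law_on S P f = distr S (sigma P {A. A \<subseteq> P \<and> f -` A \<inter> space S \<in> sets S}) f"

text \<open>
  The law of \<open>\<sigma>\<close> is restricted to the positive half-line, which carries all its mass, so that
  every point of the sample space yields a probability density.
\<close>

definition mixture_prior :: "real measure measure \<Rightarrow> real measure \<Rightarrow> (real \<Rightarrow> real) measure" where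
  "mixture_prior D G =
     law_on (D \<Otimes>\<^sub>M restrict_space G {0<..}) prob_densities (\<lambda>(F, \<sigma>). normal_mixture F \<sigma>)"

text \<open>The observations are \<open>X 0, \<dots>, X (n - 1)\<close>.\<close>

definition posterior ::
  "(real \<Rightarrow> real) measure \<Rightarrow> nat \<Rightarrow> (nat \<Rightarrow> real) \<Rightarrow> (real \<Rightarrow> real) set \<Rightarrow> real" where
  "posterior Q n X A =
     (LINT p:A|Q. (\<Prod>i<n. p (X i))) / (LINT p|Q. (\<Prod>i<n. p (X i)))"

definition tendsto_in_prob :: "'a measure \<Rightarrow> (nat \<Rightarrow> 'a \<Rightarrow> real) \<Rightarrow> real \<Rightarrow> bool" where
  "tendsto_in_prob M Y c \<longleftrightarrow>
     (\<forall>\<epsilon>>0. (\<lambda>n. measure M {\<omega> \<in> space M. \<epsilon> < \<bar>Y n \<omega> - c\<bar>}) \<longlonglongrightarrow> 0)"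

end

theory Submission
  imports Defs "HOL-Real_Asymp.Real_Asymp"
begin

text \<open>
  Write \<open>L = ln n\<close>. After division by \<open>\<Prod>i<n. p\<^sub>0 (X i)\<close> the posterior is a quotient of integrals of
  likelihood ratios, and up to constants a polylogarithmic amount in the exponent may be lost.

  Denominator: on the event that all observations lie in \<open>[- 2 L, 2 L]\<close> it suffices that
  \<open>exp (- 4 / n) * p\<^sub>0 \<le> p\<close> on this interval; no Kullback-Leibler neighbourhoods are needed. Discretise
  \<open>F\<^sub>0\<close> on a grid of \<open>n\<^sup>2\<close> cells and, by Caratheodory's elimination, replace the discretised measure
  by one with the same first \<open>2 N\<close> moments and at most \<open>2 N + 1\<close> atoms, \<open>N \<approx> L\<^sup>4\<close>; the Taylor polynomials of
  the Gaussian kernel see only these moments. In the Gamma representation the Dirichlet process gives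
  the required masses to the \<open>2 N + 1\<close> cells with probability at least \<open>exp (- L\<^sup>6 / 2)\<close>.

  Numerator: by Fourier inversion \<open>2 \<pi> (p - p\<^sub>0) x\<close> is the integral over \<open>t\<close> of the difference of the
  expectations of \<open>cos (t (X - x))\<close>. Both expectations are at most \<open>exp (- a\<^sup>2 t\<^sup>2 / 2)\<close> and Lipschitz in
  \<open>t\<close>, so if \<open>p\<close> is far from \<open>p\<^sub>0\<close> in supremum norm, then the expectations of \<open>cos (t X + c)\<close> under \<open>p\<close> and
  \<open>p\<^sub>0\<close> differ by at least \<open>L\<^sup>4 / sqrt n\<close> for one of polynomially many \<open>(t, c)\<close>. Hoeffding's inequality
  then bounds the expected numerator by \<open>exp (- L\<^sup>8 / 8)\<close> up to polynomial factors.
\<close>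

section \<open>Normal mixtures\<close>

text \<open>The powers of \<open>L\<close> are chosen only so that each dominates the next, with
  room for all constants. The Gaussian exponent on \<open>[- 2 L, 2 L]\<close> is of order
  \<open>L^2\<close>, so a Taylor degree of order \<open>L^4\<close> leaves a remainder smaller than
  any power of \<open>n\<close>, whatever \<open>\<sigma>\<^sub>0\<close> is. Every cell costs a
  fixed power of \<open>n\<close>, so the negative logarithm of the prior mass is at most of order
  \<open>L^5\<close>, below \<open>L^6 / 2\<close>. Tests with separation
  \<open>L^4 / sqrt n\<close> have an error exponent of order \<open>L^8\<close>, which wins over
  \<open>L^6\<close>; integrated over the frequencies up to \<open>L\<close> this separation is of
  order \<open>L^5 / sqrt n\<close>, below the radius \<open>L^6 / sqrt n\<close>. The lower bound
  on \<open>p\<close> must hold pointwise, also where \<open>p\<^sub>0\<close> is small. Absolute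
  errors therefore have to become relative ones, and only scales above
  \<open>\<sigma>\<^sub>0\<close> are used: widening a kernel costs a bounded factor, narrowing it
  does not. The set of densities far from \<open>p\<^sub>0\<close> is not assumed measurable, so it
  is only enclosed, up to a null set, in a finite union of measurable sets on each of which one
  cosine mean is too large.\<close>

lemma AE_msupport:
  fixes \<mu> :: "'a::second_countable_topology measure"
  assumes "sets \<mu> = sets borel"
  shows "AE x in \<mu>. x \<in> msupport \<mu>"
proof -
  obtain B :: "'a set set" where B: "countable B" "topological_basis B"
    using ex_countable_basis by blast
  \<comment> \<open>Second countability: the basic open sets of measure zero are countably many and
    cover the complement of the support.\<close>
  define N where "N = \<Union>{b\<in>B. emeasure \<mu> b = 0}"
  have "N \<in> null_sets \<mu>"
    unfolding N_def
  proof (intro null_sets_UN'[where N="\<lambda>x. x", unfolded image_ident])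
    show "countable {b \<in> B. emeasure \<mu> b = 0}"
      using B(1) by (auto intro: countable_subset[rotated])
    show "b \<in> null_sets \<mu>" if "b \<in> {b \<in> B. emeasure \<mu> b = 0}" for b
      using that topological_basis_open[OF B(2)] assms by auto
  qed
  then show ?thesis
  proof (rule AE_I')
    show "{x \<in> space \<mu>. x \<notin> msupport \<mu>} \<subseteq> N"
    proof
      fix x assume "x \<in> {x \<in> space \<mu>. x \<notin> msupport \<mu>}"
      then obtain U where U: "open U" "x \<in> U" "emeasure \<mu> U = 0"
        by (auto simp: msupport_def)
      then obtain b where b: "b \<in> B" "x \<in> b" "b \<subseteq> U"
        using topological_basisE[OF B(2)] by metis
      have "emeasure \<mu> b \<le> emeasure \<mu> U"
        using b U assms by (intro emeasure_mono) auto
      with b U show "x \<in> N" by (auto simp: N_def)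
    qed
  qed
qed

lemma normal_density_scale:
  assumes "0 < \<sigma>"
  shows "inverse \<sigma> * std_normal_density ((x - y) / \<sigma>) = normal_density y \<sigma> x"
  using assms by (simp add: normal_density_def real_sqrt_mult field_simps power_divide)

lemma normal_mixture_eq:
  "0 < \<sigma> \<Longrightarrow> normal_mixture F \<sigma> x = (\<integral>y. normal_density y \<sigma> x \<partial>F)"
  by (simp add: normal_mixture_def normal_density_scale)

lemma normal_density_le:
  assumes "0 < \<sigma>"
  shows "normal_density y \<sigma> x \<le> 1 / \<sigma>"
proof -
  have "1 \<le> sqrt (2 * pi)" using pi_gt3 by (intro real_le_rsqrt) auto
  then have s: "\<sigma> \<le> sqrt (2 * pi * \<sigma>\<^sup>2)"
    using assms by (simp add: real_sqrt_mult)
  then have "1 / sqrt (2 * pi * \<sigma>\<^sup>2) \<le> 1 / \<sigma>"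
    using assms by (intro frac_le) auto
  moreover have "exp (- (x - y)\<^sup>2 / (2 * \<sigma>\<^sup>2)) \<le> 1" by simp
  ultimately show ?thesis
    unfolding normal_density_def using s assms by (intro mult_mono[of _ "1/\<sigma>" _ 1, simplified]) auto
qed

lemma borel_measurable_on_borel_sets:
  assumes "sets F = sets borel" "f \<in> borel_measurable borel"
  shows "f \<in> borel_measurable F"
  using assms by (simp cong: measurable_cong_sets)

lemma borel_measurable_on_lborel_pair:
  assumes "sets F = sets borel" "f \<in> borel_measurable (borel \<Otimes>\<^sub>M borel)"
  shows "f \<in> borel_measurable (lborel \<Otimes>\<^sub>M F)"
proof -
  have "sets (lborel \<Otimes>\<^sub>M F) = sets (borel \<Otimes>\<^sub>M borel)"
    by (intro sets_pair_measure_cong) (simp_all add: assms)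
  with measurable_cong_sets[OF this refl] assms(2) show ?thesis by blast
qed

lemma measurable_normal_density2 [measurable]:
  "(\<lambda>(y, x). normal_density y \<sigma> x) \<in> borel_measurable (borel \<Otimes>\<^sub>M borel)"
  unfolding normal_density_def by measurable

context
  fixes F :: "real measure" and \<sigma> :: real
  assumes F: "prob_space F" "sets F = sets borel" and \<sigma>: "0 < \<sigma>"
begin

interpretation prob_space F by (rule F)
declare F(2) [measurable_cong]

lemma measurable_normal_density_location [measurable]:
  "(\<lambda>y. normal_density y \<sigma> x) \<in> borel_measurable F"
  by (simp add: normal_density_def[abs_def])

lemma integrable_normal_density_location: "integrable F (\<lambda>y. normal_density y \<sigma> x)"
  using normal_density_le[OF \<sigma>] \<sigma>
  by (intro integrable_const_bound[where B="1/\<sigma>"]) auto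

lemma ennreal_normal_mixture:
  "ennreal (normal_mixture F \<sigma> x) = (\<integral>\<^sup>+y. ennreal (normal_density y \<sigma> x) \<partial>F)"
  using integrable_normal_density_location
  by (subst nn_integral_eq_integral) (auto simp: normal_mixture_eq[OF \<sigma>])

lemma normal_mixture_pos: "0 < normal_mixture F \<sigma> x"
proof -
  have "(\<integral>y. normal_density y \<sigma> x \<partial>F) \<noteq> 0"
    using integral_nonneg_eq_0_iff_AE[OF integrable_normal_density_location[of x]]
      normal_density_pos[OF \<sigma>, of _ x] emeasure_space_1
    by (auto simp: less_le AE_False)
  moreover have "0 \<le> (\<integral>y. normal_density y \<sigma> x \<partial>F)" by (intro Bochner_Integration.integral_nonneg) auto
  ultimately show ?thesis unfolding normal_mixture_eq[OF \<sigma>] by linarith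
qed

lemma borel_measurable_normal_mixture: "normal_mixture F \<sigma> \<in> borel_measurable borel"
proof -
  have "(\<lambda>x. enn2real (\<integral>\<^sup>+y. ennreal (normal_density y \<sigma> x) \<partial>F)) \<in> borel_measurable borel"
    by measurable
  also have "(\<lambda>x. enn2real (\<integral>\<^sup>+y. ennreal (normal_density y \<sigma> x) \<partial>F)) = normal_mixture F \<sigma>"
    by (auto simp: ennreal_normal_mixture[symmetric] normal_mixture_pos less_imp_le)
  finally show ?thesis .
qed

lemma nn_integral_normal_mixture:
  assumes [measurable]: "f \<in> borel_measurable borel"
  shows "(\<integral>\<^sup>+x. ennreal (normal_mixture F \<sigma> x) * f x \<partial>lborel) =
         (\<integral>\<^sup>+y. (\<integral>\<^sup>+x. ennreal (normal_density y \<sigma> x) * f x \<partial>lborel) \<partial>F)"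
proof -
  interpret pair_sigma_finite lborel F ..
  have "(\<integral>\<^sup>+x. ennreal (normal_mixture F \<sigma> x) * f x \<partial>lborel) =
        (\<integral>\<^sup>+x. (\<integral>\<^sup>+y. ennreal (normal_density y \<sigma> x) * f x \<partial>F) \<partial>lborel)"
    by (simp add: ennreal_normal_mixture nn_integral_multc)
  also have "\<dots> = (\<integral>\<^sup>+y. (\<integral>\<^sup>+x. ennreal (normal_density y \<sigma> x) * f x \<partial>lborel) \<partial>F)"
    by (rule Fubini'[symmetric]) measurable
  finally show ?thesis .
qed

lemma nn_integral_normal_mixture_eq_1: "(\<integral>\<^sup>+x. ennreal (normal_mixture F \<sigma> x) \<partial>lborel) = 1"
proof -
  have *: "(\<integral>\<^sup>+x. ennreal (normal_density y \<sigma> x) \<partial>lborel) = 1" for y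
    using integrable_normal_density[OF \<sigma>, of y] integral_normal_density[OF \<sigma>, of y]
    by (subst nn_integral_eq_integral) auto
  show ?thesis
    using nn_integral_normal_mixture[of "\<lambda>_. 1"] emeasure_space_1 by (simp add: *)
qed

lemma normal_mixture_in_prob_densities: "normal_mixture F \<sigma> \<in> prob_densities"
  using borel_measurable_normal_mixture nn_integral_normal_mixture_eq_1 normal_mixture_pos
  by (auto simp: prob_densities_def less_imp_le)

lemma prob_space_normal_mixture: "prob_space (density lborel (\<lambda>x. ennreal (normal_mixture F \<sigma> x)))"
  using borel_measurable_normal_mixture
  by (intro prob_spaceI) (simp add: emeasure_density nn_integral_normal_mixture_eq_1)

end

text \<open>Measurability jointly in mixing measure, scale and argument is what permits Fubini
  between prior and sample. The nonnegative integral against a measurable kernel of measures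
  provides it, and positivity of the mixture brings the value back to the reals.\<close>

lemma measurable_normal_mixture:
  assumes f [measurable]: "f \<in> M \<rightarrow>\<^sub>M prob_algebra borel"
    and [measurable]: "s \<in> borel_measurable M" "g \<in> borel_measurable M"
    and s: "\<And>w. w \<in> space M \<Longrightarrow> 0 < s w"
  shows "(\<lambda>w. normal_mixture (f w) (s w) (g w)) \<in> borel_measurable M"
proof -
  have "f \<in> M \<rightarrow>\<^sub>M subprob_algebra borel" by (rule measurable_prob_algebraD) (rule f)
  then have "(\<lambda>w. \<integral>\<^sup>+y. ennreal (normal_density y (s w) (g w)) \<partial>f w) \<in> borel_measurable M"
    by (rule nn_integral_measurable_subprob_algebra2[rotated])
      (simp add: normal_density_def[abs_def])
  then have "(\<lambda>w. enn2real (\<integral>\<^sup>+y. ennreal (normal_density y (s w) (g w)) \<partial>f w)) \<in> borel_measurable M"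
    by simp
  moreover have "enn2real (\<integral>\<^sup>+y. ennreal (normal_density y (s w) (g w)) \<partial>f w) =
      normal_mixture (f w) (s w) (g w)" if "w \<in> space M" for w
  proof -
    have "prob_space (f w)" "sets (f w) = sets borel"
      using measurable_space[OF f that] by (auto simp: space_prob_algebra)
    then show ?thesis
      using s[OF that] normal_mixture_pos[of "f w" "s w" "g w"]
      by (simp add: ennreal_normal_mixture[symmetric])
  qed
  ultimately show ?thesis by (simp cong: measurable_cong)
qed

text \<open>A majorant uniform in the location. Expanding \<open>0 \<le> (x - 2 * y)\<^sup>2\<close>
  leaves half of the Gaussian exponent in \<open>x\<close>; half of that is kept as a normal density
  of scale \<open>2 * \<sigma>\<close>, whose normalising constant accounts for the factor 2, and
  the other half dominates \<open>\<bar>x\<bar>\<close> up to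
  \<open>2 * \<sigma>\<^sup>2\<close>.\<close>

lemma normal_density_le_exp:
  assumes "0 < \<sigma>" "\<bar>y\<bar> \<le> k"
  shows "normal_density y \<sigma> x \<le>
    2 * exp (k\<^sup>2 / (2 * \<sigma>\<^sup>2) + 2 * \<sigma>\<^sup>2) * (exp (- \<bar>x\<bar>) * normal_density 0 (2 * \<sigma>) x)"
proof -
  have "0 \<le> (x - 2 * y)\<^sup>2" by simp
  then have "x\<^sup>2 / 2 - y\<^sup>2 \<le> (x - y)\<^sup>2" by (simp add: power2_eq_square algebra_simps)
  moreover have "y\<^sup>2 \<le> k\<^sup>2" using power_mono[OF assms(2), of 2] by simp
  ultimately have "x\<^sup>2 / 2 - k\<^sup>2 \<le> (x - y)\<^sup>2" by linarith
  then have 1: "- (x - y)\<^sup>2 / (2 * \<sigma>\<^sup>2) \<le> k\<^sup>2 / (2 * \<sigma>\<^sup>2) - x\<^sup>2 / (4 * \<sigma>\<^sup>2)"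
    using assms by (simp add: field_simps)
  have "0 \<le> (\<bar>x\<bar> - 4 * \<sigma>\<^sup>2)\<^sup>2" by simp
  then have "\<bar>x\<bar> * 8 * \<sigma>\<^sup>2 \<le> \<bar>x\<bar>\<^sup>2 + 16 * \<sigma>\<^sup>2 * \<sigma>\<^sup>2"
    by (simp add: power2_eq_square algebra_simps)
  then have "\<bar>x\<bar> \<le> x\<^sup>2 / (8 * \<sigma>\<^sup>2) + 2 * \<sigma>\<^sup>2"
    using assms by (simp add: field_simps)
  then have "- (x - y)\<^sup>2 / (2 * \<sigma>\<^sup>2) \<le>
      (k\<^sup>2 / (2 * \<sigma>\<^sup>2) + 2 * \<sigma>\<^sup>2) + (- \<bar>x\<bar> + - x\<^sup>2 / (2 * (2 * \<sigma>)\<^sup>2))"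
    using 1 by (simp add: field_simps)
  then have "exp (- (x - y)\<^sup>2 / (2 * \<sigma>\<^sup>2)) \<le>
      exp (k\<^sup>2 / (2 * \<sigma>\<^sup>2) + 2 * \<sigma>\<^sup>2) * (exp (- \<bar>x\<bar>) * exp (- x\<^sup>2 / (2 * (2 * \<sigma>)\<^sup>2)))"
    by (simp only: exp_add[symmetric] exp_le_cancel_iff)
  then have "1 / sqrt (2 * pi * \<sigma>\<^sup>2) * exp (- (x - y)\<^sup>2 / (2 * \<sigma>\<^sup>2)) \<le> 1 / sqrt (2 * pi * \<sigma>\<^sup>2) *
      (exp (k\<^sup>2 / (2 * \<sigma>\<^sup>2) + 2 * \<sigma>\<^sup>2) * (exp (- \<bar>x\<bar>) * exp (- x\<^sup>2 / (2 * (2 * \<sigma>)\<^sup>2))))"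
    by (rule mult_left_mono) simp
  moreover have "1 / sqrt (2 * pi * \<sigma>\<^sup>2) = 2 * (1 / sqrt (2 * pi * (2 * \<sigma>)\<^sup>2))"
  proof -
    have "sqrt (2 * pi * (2 * \<sigma>)\<^sup>2) = sqrt (2\<^sup>2 * (2 * pi * \<sigma>\<^sup>2))"
      by (simp add: power_mult_distrib mult_ac)
    also have "\<dots> = 2 * sqrt (2 * pi * \<sigma>\<^sup>2)"
      by (simp only: real_sqrt_mult real_sqrt_abs)
    finally show ?thesis by simp
  qed
  then have "1 / sqrt (2 * pi * \<sigma>\<^sup>2) *
      (exp (k\<^sup>2 / (2 * \<sigma>\<^sup>2) + 2 * \<sigma>\<^sup>2) * (exp (- \<bar>x\<bar>) * exp (- x\<^sup>2 / (2 * (2 * \<sigma>)\<^sup>2)))) =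
    2 * exp (k\<^sup>2 / (2 * \<sigma>\<^sup>2) + 2 * \<sigma>\<^sup>2) * (exp (- \<bar>x\<bar>) * normal_density 0 (2 * \<sigma>) x)"
    unfolding normal_density_def by (simp only: diff_zero mult_ac)
  ultimately show ?thesis
    unfolding normal_density_def[of y] by linarith
qed

text \<open>The exponential rate one suffices: with \<open>R = 2 * ln n\<close> a single observation
  escapes with probability of order \<open>1 / n\<^sup>2\<close>, hence some observation among
  \<open>n\<close> with probability of order \<open>1 / n\<close>.\<close>

lemma normal_mixture_tail:
  assumes F: "prob_space F" "sets F = sets borel" and \<sigma>: "0 < \<sigma>"
    and k: "AE y in F. \<bar>y\<bar> \<le> k"
  shows "emeasure (density lborel (\<lambda>x. ennreal (normal_mixture F \<sigma> x))) {x. R < \<bar>x\<bar>} \<le>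
    ennreal (2 * exp (k\<^sup>2 / (2 * \<sigma>\<^sup>2) + 2 * \<sigma>\<^sup>2) * exp (- R))"
proof -
  interpret F: prob_space F by fact
  let ?C = "2 * exp (k\<^sup>2 / (2 * \<sigma>\<^sup>2) + 2 * \<sigma>\<^sup>2) * exp (- R)"
  have *: "(\<integral>\<^sup>+x. ennreal (normal_density y \<sigma> x) * indicator {x. R < \<bar>x\<bar>} x \<partial>lborel) \<le> ennreal ?C"
    if "\<bar>y\<bar> \<le> k" for y
  proof -
    have "(\<integral>\<^sup>+x. ennreal (normal_density y \<sigma> x) * indicator {x. R < \<bar>x\<bar>} x \<partial>lborel) \<le>
      (\<integral>\<^sup>+x. ennreal ?C * ennreal (normal_density 0 (2 * \<sigma>) x) \<partial>lborel)"
    proof (intro nn_integral_mono)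
      fix x
      have "normal_density y \<sigma> x \<le> ?C * normal_density 0 (2 * \<sigma>) x" if "R < \<bar>x\<bar>"
      proof -
        note normal_density_le_exp[OF \<sigma> \<open>\<bar>y\<bar> \<le> k\<close>, of x]
        also have "2 * exp (k\<^sup>2 / (2 * \<sigma>\<^sup>2) + 2 * \<sigma>\<^sup>2) * (exp (- \<bar>x\<bar>) * normal_density 0 (2 * \<sigma>) x)
          \<le> 2 * exp (k\<^sup>2 / (2 * \<sigma>\<^sup>2) + 2 * \<sigma>\<^sup>2) * (exp (- R) * normal_density 0 (2 * \<sigma>) x)"
          using that by (intro mult_left_mono mult_right_mono) auto
        finally show ?thesis by (simp add: mult.assoc)
      qed
      then show "ennreal (normal_density y \<sigma> x) * indicator {x. R < \<bar>x\<bar>} x \<le>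
          ennreal ?C * ennreal (normal_density 0 (2 * \<sigma>) x)"
        by (auto simp: indicator_def ennreal_mult[symmetric] intro!: ennreal_leI)
    qed
    also have "\<dots> = ennreal ?C"
      using \<sigma> integrable_normal_density[of "2 * \<sigma>" 0] integral_normal_density[of "2 * \<sigma>" 0]
      by (simp add: nn_integral_cmult nn_integral_eq_integral)
    finally show ?thesis .
  qed
  have "emeasure (density lborel (\<lambda>x. ennreal (normal_mixture F \<sigma> x))) {x. R < \<bar>x\<bar>} =
      (\<integral>\<^sup>+x. ennreal (normal_mixture F \<sigma> x) * indicator {x. R < \<bar>x\<bar>} x \<partial>lborel)"
    using borel_measurable_normal_mixture[OF F \<sigma>] by (subst emeasure_density) auto
  also have "\<dots> = (\<integral>\<^sup>+y. (\<integral>\<^sup>+x. ennreal (normal_density y \<sigma> x) * indicator {x. R < \<bar>x\<bar>} x \<partial>lborel) \<partial>F)"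
    by (rule nn_integral_normal_mixture[OF F \<sigma>]) simp
  also have "\<dots> \<le> (\<integral>\<^sup>+y. ennreal ?C \<partial>F)"
    using k * by (intro nn_integral_mono_AE) auto
  also have "\<dots> = ennreal ?C" by (simp add: F.emeasure_space_1)
  finally show ?thesis .
qed

section \<open>Fourier analysis of normal mixtures\<close>

lemma
  shows integral_std_normal_cos: "(\<integral>x. std_normal_density x * cos (t * x) \<partial>lborel) = exp (- t\<^sup>2 / 2)"
    and integral_std_normal_sin: "(\<integral>x. std_normal_density x * sin (t * x) \<partial>lborel) = 0"
proof -
  let ?N = "std_normal_distribution"
  interpret N: real_distribution ?N by (rule real_dist_normal_dist)
  have char: "(\<integral>x. iexp (t * x) \<partial>?N) = complex_of_real (exp (- t\<^sup>2 / 2))"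
    using fun_cong[OF char_std_normal_distribution, of t] by (simp add: char_def)
  have int: "integrable ?N (\<lambda>x. iexp (t * x))"
    by (rule N.integrable_iexp) auto
  have "(\<integral>x. cos (t * x) \<partial>?N) = Re (\<integral>x. iexp (t * x) \<partial>?N)"
    by (subst integral_Re[OF int, symmetric]) (simp add: Re_exp)
  then have "(\<integral>x. cos (t * x) \<partial>?N) = exp (- t\<^sup>2 / 2)" by (simp only: char Re_complex_of_real)
  moreover have "(\<integral>x. cos (t * x) \<partial>?N) = (\<integral>x. std_normal_density x * cos (t * x) \<partial>lborel)"
    by (subst integral_density) auto
  ultimately show "(\<integral>x. std_normal_density x * cos (t * x) \<partial>lborel) = exp (- t\<^sup>2 / 2)" by simp
  have "(\<integral>x. sin (t * x) \<partial>?N) = Im (\<integral>x. iexp (t * x) \<partial>?N)"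
    by (subst integral_Im[OF int, symmetric]) (simp add: Im_exp)
  then have "(\<integral>x. sin (t * x) \<partial>?N) = 0" by (simp only: char Im_complex_of_real)
  moreover have "(\<integral>x. sin (t * x) \<partial>?N) = (\<integral>x. std_normal_density x * sin (t * x) \<partial>lborel)"
    by (subst integral_density) auto
  ultimately show "(\<integral>x. std_normal_density x * sin (t * x) \<partial>lborel) = 0" by simp
qed

text \<open>Substituting \<open>x = y + \<sigma> * z\<close> and expanding the cosine reduces to the
  characteristic function of the standard normal law, whose imaginary part vanishes.\<close>

lemma integral_normal_density_cos:
  assumes \<sigma>: "0 < \<sigma>"
  shows "(\<integral>x. normal_density y \<sigma> x * cos (t * x + c) \<partial>lborel) = exp (- (\<sigma> * t)\<^sup>2 / 2) * cos (t * y + c)"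
proof -
  have nd: "\<sigma> * normal_density y \<sigma> (y + \<sigma> * z) = std_normal_density z" for z
    using \<sigma> by (simp add: normal_density_scale[OF \<sigma>, symmetric])
  have ic: "integrable lborel (\<lambda>z. std_normal_density z * cos (t * \<sigma> * z))"
    and ints: "integrable lborel (\<lambda>z. std_normal_density z * sin (t * \<sigma> * z))"
    by (rule Bochner_Integration.integrable_bound[OF integrable_normal_density[of 1 0]];
        auto simp: abs_mult intro!: AE_I2 mult_left_le)+
  have "(\<integral>x. normal_density y \<sigma> x * cos (t * x + c) \<partial>lborel) =
      \<sigma> * (\<integral>z. normal_density y \<sigma> (y + \<sigma> * z) * cos (t * (y + \<sigma> * z) + c) \<partial>lborel)"
    using \<sigma> by (subst lborel_integral_real_affine[where c=\<sigma> and t=y]) auto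
  also have "\<dots> = (\<integral>z. \<sigma> * (normal_density y \<sigma> (y + \<sigma> * z) * cos (t * (y + \<sigma> * z) + c)) \<partial>lborel)"
    by simp
  also have "\<dots> = (\<integral>z. std_normal_density z * cos (t * (y + \<sigma> * z) + c) \<partial>lborel)"
    by (simp only: mult.assoc[symmetric] nd)
  also have "\<dots> = (\<integral>z. cos (t * y + c) * (std_normal_density z * cos (t * \<sigma> * z)) -
      sin (t * y + c) * (std_normal_density z * sin (t * \<sigma> * z)) \<partial>lborel)"
  proof (intro Bochner_Integration.integral_cong refl)
    fix z
    have "t * (y + \<sigma> * z) + c = (t * y + c) + t * \<sigma> * z" by (simp add: algebra_simps)
    then show "std_normal_density z * cos (t * (y + \<sigma> * z) + c) =
      cos (t * y + c) * (std_normal_density z * cos (t * \<sigma> * z)) -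
      sin (t * y + c) * (std_normal_density z * sin (t * \<sigma> * z))"
      by (simp only: cos_add) (simp add: algebra_simps)
  qed
  also have "\<dots> = cos (t * y + c) * exp (- (t * \<sigma>)\<^sup>2 / 2)"
    using ic ints by (simp add: integral_std_normal_cos integral_std_normal_sin)
  finally show ?thesis by (simp add: mult.commute)
qed

text \<open>The mean of \<open>cos (t * X + c)\<close> when \<open>X\<close> has density
  \<open>normal_mixture F \<sigma>\<close>, as \<open>expectation_cos_normal_mixture\<close>
  confirms: the characteristic function in real form, the phase \<open>c\<close> selecting a
  combination of its real and imaginary parts.\<close>

definition trig_mean :: "real measure \<Rightarrow> real \<Rightarrow> real \<Rightarrow> real \<Rightarrow> real" where
  "trig_mean F \<sigma> t c = exp (- (\<sigma> * t)\<^sup>2 / 2) * (\<integral>y. cos (t * y + c) \<partial>F)"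

text \<open>The cosine transform with the roles of frequency and argument exchanged: up to a
  constant, \<open>exp (- (\<sigma> * t)\<^sup>2 / 2)\<close> is a normal density in
  \<open>t\<close> of scale \<open>1 / \<sigma>\<close>.\<close>

lemma normal_density_fourier:
  assumes \<sigma>: "0 < \<sigma>"
  shows "2 * pi * normal_density y \<sigma> x = (\<integral>t. exp (- (\<sigma> * t)\<^sup>2 / 2) * cos (t * y - t * x) \<partial>lborel)"
proof -
  have s2: "sqrt (2 * pi) * sqrt (2 * pi) = 2 * pi" by simp
  have "exp (- (\<sigma> * t)\<^sup>2 / 2) = sqrt (2 * pi) / \<sigma> * normal_density 0 (1 / \<sigma>) t" for t
    using \<sigma> by (simp add: normal_density_def real_sqrt_mult real_sqrt_divide field_simps)
  then have "(\<integral>t. exp (- (\<sigma> * t)\<^sup>2 / 2) * cos (t * y - t * x) \<partial>lborel) =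
      (\<integral>t. sqrt (2 * pi) / \<sigma> * (normal_density 0 (1 / \<sigma>) t * cos ((y - x) * t + 0)) \<partial>lborel)"
    by (simp add: algebra_simps)
  also have "\<dots> = sqrt (2 * pi) / \<sigma> * exp (- (1 / \<sigma> * (y - x))\<^sup>2 / 2)"
    using \<sigma> by (subst integral_mult_right_zero, subst integral_normal_density_cos) auto
  also have "\<dots> = 2 * pi * normal_density y \<sigma> x"
    using \<sigma> s2 by (simp add: normal_density_def real_sqrt_mult field_simps power2_commute)
  finally show ?thesis by simp
qed

lemma integrable_exp_square: "0 < a \<Longrightarrow> integrable lborel (\<lambda>t. exp (- (a * t)\<^sup>2 / 2))"
  and integral_exp_square: "0 < a \<Longrightarrow> (\<integral>t. exp (- (a * t)\<^sup>2 / 2) \<partial>lborel) = sqrt (2 * pi) / a"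
proof -
  assume a: "0 < a"
  have "exp (- (a * t)\<^sup>2 / 2) = sqrt (2 * pi) / a * normal_density 0 (1 / a) t" for t
    using a by (simp add: normal_density_def real_sqrt_mult real_sqrt_divide field_simps)
  then show "integrable lborel (\<lambda>t. exp (- (a * t)\<^sup>2 / 2))"
    "(\<integral>t. exp (- (a * t)\<^sup>2 / 2) \<partial>lborel) = sqrt (2 * pi) / a"
    using a integrable_normal_density[of "1 / a" 0] integral_normal_density[of "1 / a" 0] by simp_all
qed

context
  fixes F :: "real measure" and \<sigma> :: real
  assumes F: "prob_space F" "sets F = sets borel" and \<sigma>: "0 < \<sigma>"
begin

interpretation prob_space F by (rule F)
declare F(2) [measurable_cong]

lemma integrable_cos_location [simp]: "integrable F (\<lambda>y. cos (t * y + c))"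
  by (rule integrable_const_bound[where B=1])
    (auto intro!: borel_measurable_on_borel_sets[OF F(2)])

lemma abs_integral_cos_le_1: "\<bar>\<integral>y. cos (t * y + c) \<partial>F\<bar> \<le> 1"
proof -
  have "\<bar>\<integral>y. cos (t * y + c) \<partial>F\<bar> \<le> (\<integral>y. \<bar>cos (t * y + c)\<bar> \<partial>F)"
    by (rule integral_abs_bound)
  also have "\<dots> \<le> (\<integral>y. 1 \<partial>F)" by (intro integral_mono) (auto intro: integrable_abs)
  finally show ?thesis by (simp add: prob_space)
qed

lemma expectation_cos_normal_mixture:
  "(\<integral>x. cos (t * x + c) \<partial>density lborel (\<lambda>x. ennreal (normal_mixture F \<sigma> x))) = trig_mean F \<sigma> t c"
proof -
  interpret P: pair_sigma_finite lborel F ..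
  have "integrable (lborel \<Otimes>\<^sub>M F) (\<lambda>(x, y). normal_density y \<sigma> x * cos (t * x + c))"
  proof (rule integrableI_bounded)
    have "(\<integral>\<^sup>+z. ennreal (norm (case z of (x, y) \<Rightarrow> normal_density y \<sigma> x * cos (t * x + c))) \<partial>(lborel \<Otimes>\<^sub>M F)) \<le>
      (\<integral>\<^sup>+z. ennreal (case z of (x, y) \<Rightarrow> normal_density y \<sigma> x) \<partial>(lborel \<Otimes>\<^sub>M F))"
      by (intro nn_integral_mono ennreal_leI) (auto simp: abs_mult intro!: mult_left_le)
    also have "\<dots> = (\<integral>\<^sup>+x. \<integral>\<^sup>+y. ennreal (normal_density y \<sigma> x) \<partial>F \<partial>lborel)"
      by (subst nn_integral_fst[symmetric])
        (auto intro!: borel_measurable_on_lborel_pair[OF F(2)] simp: normal_density_def[abs_def])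
    also have "\<dots> = 1"
      using nn_integral_normal_mixture_eq_1[OF F \<sigma>] by (simp add: ennreal_normal_mixture[OF F \<sigma>])
    finally show "(\<integral>\<^sup>+z. ennreal (norm (case z of (x, y) \<Rightarrow> normal_density y \<sigma> x * cos (t * x + c)))
      \<partial>(lborel \<Otimes>\<^sub>M F)) < \<infinity>" by (rule le_less_trans) simp
  qed (auto intro!: borel_measurable_on_lborel_pair[OF F(2)] simp: normal_density_def[abs_def])
  from P.Fubini_integral[OF this]
  have "(\<integral>x. \<integral>y. normal_density y \<sigma> x * cos (t * x + c) \<partial>F \<partial>lborel) =
    (\<integral>y. \<integral>x. normal_density y \<sigma> x * cos (t * x + c) \<partial>lborel \<partial>F)" by simp
  also have "\<dots> = trig_mean F \<sigma> t c"
    by (simp add: integral_normal_density_cos[OF \<sigma>] trig_mean_def)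
  also have "(\<integral>x. \<integral>y. normal_density y \<sigma> x * cos (t * x + c) \<partial>F \<partial>lborel) =
    (\<integral>x. normal_mixture F \<sigma> x * cos (t * x + c) \<partial>lborel)"
    by (simp add: normal_mixture_eq[OF \<sigma>])
  also have "\<dots> = (\<integral>x. cos (t * x + c) \<partial>density lborel (\<lambda>x. ennreal (normal_mixture F \<sigma> x)))"
    using borel_measurable_normal_mixture[OF F \<sigma>] normal_mixture_pos[OF F \<sigma>]
    by (subst integral_density) (auto simp: less_imp_le)
  finally show ?thesis by simp
qed

text \<open>Fubini reduces inversion to a single kernel. The Gaussian factor makes the double
  integral absolutely convergent, and the phase \<open>- t * x\<close> recentres the mean at
  \<open>x\<close>.\<close>

lemma
  shows integrable_trig_mean: "integrable lborel (\<lambda>t. trig_mean F \<sigma> t (- t * x))"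
    and normal_mixture_fourier: "2 * pi * normal_mixture F \<sigma> x = (\<integral>t. trig_mean F \<sigma> t (- t * x) \<partial>lborel)"
proof -
  interpret P: pair_sigma_finite lborel F ..
  let ?f = "\<lambda>t y. exp (- (\<sigma> * t)\<^sup>2 / 2) * cos (t * y + - t * x)"
  have int: "integrable (lborel \<Otimes>\<^sub>M F) (case_prod ?f)"
  proof (rule integrableI_bounded)
    have "(\<integral>\<^sup>+z. ennreal (norm (case_prod ?f z)) \<partial>(lborel \<Otimes>\<^sub>M F)) \<le>
      (\<integral>\<^sup>+z. ennreal (case z of (t, y) \<Rightarrow> exp (- (\<sigma> * t)\<^sup>2 / 2)) \<partial>(lborel \<Otimes>\<^sub>M F))"
      by (intro nn_integral_mono ennreal_leI) (auto simp: abs_mult)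
    also have "\<dots> = (\<integral>\<^sup>+t. \<integral>\<^sup>+y. ennreal (exp (- (\<sigma> * t)\<^sup>2 / 2)) \<partial>F \<partial>lborel)"
      by (subst nn_integral_fst[symmetric])
        (auto intro!: borel_measurable_on_lborel_pair[OF F(2)] simp: normal_density_def[abs_def])
    also have "\<dots> = ennreal (sqrt (2 * pi) / \<sigma>)"
      using integrable_exp_square[OF \<sigma>] integral_exp_square[OF \<sigma>]
      by (simp add: emeasure_space_1 nn_integral_eq_integral)
    finally show "(\<integral>\<^sup>+z. ennreal (norm (case_prod ?f z)) \<partial>(lborel \<Otimes>\<^sub>M F)) < \<infinity>"
      by (rule le_less_trans) simp
  qed (auto intro!: borel_measurable_on_lborel_pair[OF F(2)] simp: normal_density_def[abs_def])
  have "integrable lborel (\<lambda>t. \<integral>y. ?f t y \<partial>F)"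
    using P.integrable_fst[OF int] by simp
  then show "integrable lborel (\<lambda>t. trig_mean F \<sigma> t (- t * x))"
    by (simp add: trig_mean_def)
  have "(\<integral>t. trig_mean F \<sigma> t (- t * x) \<partial>lborel) = (\<integral>t. \<integral>y. ?f t y \<partial>F \<partial>lborel)"
    by (simp add: trig_mean_def)
  also have "\<dots> = (\<integral>y. \<integral>t. ?f t y \<partial>lborel \<partial>F)"
    by (rule P.Fubini_integral[OF int, symmetric])
  also have "\<dots> = (\<integral>y. 2 * pi * normal_density y \<sigma> x \<partial>F)"
    by (simp add: normal_density_fourier[OF \<sigma>])
  finally show "2 * pi * normal_mixture F \<sigma> x = (\<integral>t. trig_mean F \<sigma> t (- t * x) \<partial>lborel)"
    by (simp add: normal_mixture_eq[OF \<sigma>])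
qed

lemma abs_trig_mean_le: "\<bar>trig_mean F \<sigma> t c\<bar> \<le> exp (- (\<sigma> * t)\<^sup>2 / 2)"
  using abs_integral_cos_le_1[of t c] by (simp add: trig_mean_def abs_mult)

text \<open>The addition formula reduces all phases to 0 and \<open>pi / 2\<close>, so finitely many
  tests per frequency serve all points \<open>x\<close> at once.\<close>

lemma trig_mean_rotate:
  "trig_mean F \<sigma> t c = cos c * trig_mean F \<sigma> t 0 + sin c * trig_mean F \<sigma> t (pi / 2)"
proof -
  have "(\<integral>y. cos (t * y + c) \<partial>F) =
      (\<integral>y. cos c * cos (t * y + 0) + sin c * cos (t * y + pi / 2) \<partial>F)"
    by (intro Bochner_Integration.integral_cong refl) (simp add: cos_add algebra_simps)
  also have "\<dots> = cos c * (\<integral>y. cos (t * y + 0) \<partial>F) + sin c * (\<integral>y. cos (t * y + pi / 2) \<partial>F)"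
    using integrable_cos_location[of t 0] integrable_cos_location[of t "pi / 2"]
    by (subst Bochner_Integration.integral_add) auto
  finally show ?thesis by (simp add: trig_mean_def algebra_simps)
qed

text \<open>The Gaussian factor contributes \<open>\<sigma>\<close>, since
  \<open>exp (- u\<^sup>2 / 2)\<close> has slope at most one, and the cosine integral contributes
  \<open>k\<close>, since the mass lies in \<open>[- k, k]\<close>. This is what makes a grid of
  frequencies sufficient.\<close>

lemma trig_mean_lipschitz:
  assumes k: "AE y in F. \<bar>y\<bar> \<le> k"
  shows "\<bar>trig_mean F \<sigma> t c - trig_mean F \<sigma> s c\<bar> \<le> (\<sigma> + k) * \<bar>t - s\<bar>"
proof -
  have gauss: "\<bar>exp (- u\<^sup>2 / 2) - exp (- v\<^sup>2 / 2)\<bar> \<le> \<bar>u - v\<bar>" for u v :: real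
  proof -
    have "norm (exp (- u\<^sup>2 / 2) - exp (- v\<^sup>2 / 2)) \<le> 1 * norm (u - v)"
    proof (rule field_differentiable_bound[where S=UNIV and f'="\<lambda>u. - u * exp (- u\<^sup>2 / 2)"])
      show "((\<lambda>u. exp (- u\<^sup>2 / 2)) has_field_derivative - z * exp (- z\<^sup>2 / 2)) (at z within UNIV)" for z :: real
        by (auto intro!: derivative_eq_intros)
      show "norm (- z * exp (- z\<^sup>2 / 2)) \<le> 1" for z :: real
      proof -
        have "0 \<le> (\<bar>z\<bar> - 1)\<^sup>2" by simp
        then have "\<bar>z\<bar> \<le> 1 + z\<^sup>2 / 2" by (simp add: power2_eq_square algebra_simps)
        also have "\<dots> \<le> exp (z\<^sup>2 / 2)" by (rule exp_ge_add_one_self)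
        finally have "\<bar>z\<bar> * exp (- (z\<^sup>2 / 2)) \<le> exp (z\<^sup>2 / 2) * exp (- (z\<^sup>2 / 2))"
          by (rule mult_right_mono) simp
        then show ?thesis by (simp add: abs_mult exp_minus)
      qed
    qed auto
    then show ?thesis by simp
  qed
  have cosl: "\<bar>cos u - cos v\<bar> \<le> \<bar>u - v\<bar>" for u v :: real
  proof -
    have "norm (cos u - cos v) \<le> 1 * norm (u - v)"
      by (rule field_differentiable_bound[where S=UNIV and f'="\<lambda>u. - sin u"])
        (auto intro!: derivative_eq_intros)
    then show ?thesis by simp
  qed
  have "AE y in F. \<bar>cos (t * y + c) - cos (s * y + c)\<bar> \<le> k * \<bar>t - s\<bar>"
    using k
  proof eventually_elim
    fix y assume y: "\<bar>y\<bar> \<le> k"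
    have "\<bar>cos (t * y + c) - cos (s * y + c)\<bar> \<le> \<bar>y\<bar> * \<bar>t - s\<bar>"
      using cosl[of "t * y + c" "s * y + c"]
      by (simp add: abs_mult[symmetric] algebra_simps)
    also have "\<dots> \<le> k * \<bar>t - s\<bar>" using y by (intro mult_right_mono) auto
    finally show "\<bar>cos (t * y + c) - cos (s * y + c)\<bar> \<le> k * \<bar>t - s\<bar>" .
  qed
  then have "(\<integral>y. \<bar>cos (t * y + c) - cos (s * y + c)\<bar> \<partial>F) \<le> (\<integral>y. k * \<bar>t - s\<bar> \<partial>F)"
    by (intro integral_mono_AE) auto
  moreover have "\<bar>(\<integral>y. cos (t * y + c) \<partial>F) - (\<integral>y. cos (s * y + c) \<partial>F)\<bar> \<le>
      (\<integral>y. \<bar>cos (t * y + c) - cos (s * y + c)\<bar> \<partial>F)"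
    using integral_abs_bound[of F "\<lambda>y. cos (t * y + c) - cos (s * y + c)"] by simp
  ultimately have C: "\<bar>(\<integral>y. cos (t * y + c) \<partial>F) - (\<integral>y. cos (s * y + c) \<partial>F)\<bar> \<le> k * \<bar>t - s\<bar>"
    by (simp add: prob_space)
  let ?e = "\<lambda>t. exp (- (\<sigma> * t)\<^sup>2 / 2)" and ?I = "\<lambda>t. \<integral>y. cos (t * y + c) \<partial>F"
  have "\<bar>trig_mean F \<sigma> t c - trig_mean F \<sigma> s c\<bar> = \<bar>(?e t - ?e s) * ?I t + ?e s * (?I t - ?I s)\<bar>"
    by (simp add: trig_mean_def algebra_simps)
  also have "\<dots> \<le> \<bar>?e t - ?e s\<bar> * \<bar>?I t\<bar> + ?e s * \<bar>?I t - ?I s\<bar>"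
    by (rule order_trans[OF abs_triangle_ineq]) (simp add: abs_mult)
  also have "\<dots> \<le> \<bar>\<sigma> * t - \<sigma> * s\<bar> * 1 + 1 * (k * \<bar>t - s\<bar>)"
    by (intro add_mono mult_mono gauss abs_integral_cos_le_1 C) auto
  also have "\<bar>\<sigma> * t - \<sigma> * s\<bar> = \<sigma> * \<bar>t - s\<bar>"
    using \<sigma> by (simp add: right_diff_distrib[symmetric] abs_mult)
  finally show ?thesis by (simp add: algebra_simps)
qed

end

text \<open>The inversion integral is cut at \<open>\<bar>t\<bar> = T\<close>: below the cut the
  assumed closeness is integrated, above it both means are small by their Gaussian factors.\<close>

lemma normal_mixture_diff_le:
  assumes F: "prob_space F" "sets F = sets borel" and F': "prob_space F'" "sets F' = sets borel"
    and a: "0 < a" "a \<le> \<sigma>" "a \<le> \<sigma>'" and T: "0 \<le> T" and \<eta>: "0 \<le> \<eta>"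
    and close: "\<And>t c. \<bar>t\<bar> \<le> T \<Longrightarrow> \<bar>trig_mean F \<sigma> t c - trig_mean F' \<sigma>' t c\<bar> \<le> \<eta>"
  shows "\<bar>normal_mixture F \<sigma> x - normal_mixture F' \<sigma>' x\<bar> \<le> T * \<eta> + 2 / a * exp (- (a * T)\<^sup>2 / 4)"
proof -
  have \<sigma>: "0 < \<sigma>" "0 < \<sigma>'" using a by auto
  let ?d = "\<lambda>t. trig_mean F \<sigma> t (- t * x) - trig_mean F' \<sigma>' t (- t * x)"
  let ?E = "exp (- (a * T)\<^sup>2 / 4)"
  \<comment> \<open>Half of the Gaussian exponent is spent on the factor \<open>?E\<close>; the
    other half keeps the majorant integrable over the line.\<close>
  let ?g = "\<lambda>t. \<eta> * indicator {- T..T} t + 2 * ?E * exp (- (a / sqrt 2 * t)\<^sup>2 / 2)"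
  have int: "integrable lborel ?d"
    using integrable_trig_mean[OF F \<sigma>(1)] integrable_trig_mean[OF F' \<sigma>(2)] by auto
  have sq: "(a / sqrt 2 * t)\<^sup>2 / 2 = (a * t)\<^sup>2 / 4" for t
    by (simp add: power_mult_distrib power_divide)
  have intg: "integrable lborel ?g"
    using integrable_exp_square[of "a / sqrt 2"] a
    by (intro Bochner_Integration.integrable_add Bochner_Integration.integrable_mult_right
      integrable_real_indicator) (auto simp: emeasure_lborel_Icc_eq)
  have bound: "\<bar>?d t\<bar> \<le> ?g t" for t
  proof (cases "\<bar>t\<bar> \<le> T")
    case True
    then show ?thesis using close[OF True, of "- t * x"]
      by (intro add_increasing2) (auto simp: indicator_def)
  next
    case False
    have "(a * t)\<^sup>2 / 4 + (a * T)\<^sup>2 / 4 \<le> (s * t)\<^sup>2 / 2" if "a \<le> s" for s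
    proof -
      have "(a * T)\<^sup>2 \<le> (a * t)\<^sup>2"
        using False T a by (simp add: power_mult_distrib abs_le_square_iff[symmetric])
      moreover have "(a * t)\<^sup>2 \<le> (s * t)\<^sup>2"
        using a that by (simp add: power_mult_distrib mult_right_mono power_mono)
      ultimately show ?thesis by linarith
    qed
    then have "- (s * t)\<^sup>2 / 2 \<le> - (a * T)\<^sup>2 / 4 + - (a / sqrt 2 * t)\<^sup>2 / 2" if "a \<le> s" for s
      using that[THEN \<open>\<And>s. a \<le> s \<Longrightarrow> (a * t)\<^sup>2 / 4 + (a * T)\<^sup>2 / 4 \<le> (s * t)\<^sup>2 / 2\<close>] sq[of t] by linarith
    then have e: "exp (- (s * t)\<^sup>2 / 2) \<le> ?E * exp (- (a / sqrt 2 * t)\<^sup>2 / 2)" if "a \<le> s" for s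
      unfolding exp_add[symmetric] using that by simp
    have "\<bar>?d t\<bar> \<le> \<bar>trig_mean F \<sigma> t (- t * x)\<bar> + \<bar>trig_mean F' \<sigma>' t (- t * x)\<bar>" by simp
    also have "\<dots> \<le> 2 * ?E * exp (- (a / sqrt 2 * t)\<^sup>2 / 2)"
      using abs_trig_mean_le[OF F \<sigma>(1), of t "- t * x"] abs_trig_mean_le[OF F' \<sigma>(2), of t "- t * x"]
        e[OF a(2)] e[OF a(3)] by linarith
    finally show ?thesis using False \<eta> by (simp add: indicator_def)
  qed
  have "2 * pi * normal_mixture F \<sigma> x - 2 * pi * normal_mixture F' \<sigma>' x = (\<integral>t. ?d t \<partial>lborel)"
    unfolding normal_mixture_fourier[OF F \<sigma>(1), of x] normal_mixture_fourier[OF F' \<sigma>(2), of x]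
    by (rule Bochner_Integration.integral_diff[symmetric])
      (rule integrable_trig_mean[OF F \<sigma>(1)] integrable_trig_mean[OF F' \<sigma>(2)])+
  then have "2 * pi * \<bar>normal_mixture F \<sigma> x - normal_mixture F' \<sigma>' x\<bar> = \<bar>\<integral>t. ?d t \<partial>lborel\<bar>"
  proof -
    assume "2 * pi * normal_mixture F \<sigma> x - 2 * pi * normal_mixture F' \<sigma>' x = (\<integral>t. ?d t \<partial>lborel)"
    then have "\<bar>\<integral>t. ?d t \<partial>lborel\<bar> = \<bar>2 * pi * (normal_mixture F \<sigma> x - normal_mixture F' \<sigma>' x)\<bar>"
      by (simp only: right_diff_distrib)
    also have "\<dots> = 2 * pi * \<bar>normal_mixture F \<sigma> x - normal_mixture F' \<sigma>' x\<bar>"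
      by (simp only: abs_mult) simp
    finally show ?thesis by simp
  qed
  also have "\<dots> \<le> (\<integral>t. \<bar>?d t\<bar> \<partial>lborel)" by (rule integral_abs_bound)
  also have "\<dots> \<le> (\<integral>t. ?g t \<partial>lborel)"
    using bound int intg by (intro integral_mono) auto
  also have "\<dots> = \<eta> * (2 * T) + 2 * ?E * (sqrt (2 * pi) / (a / sqrt 2))"
    using integrable_exp_square[of "a / sqrt 2"] integral_exp_square[of "a / sqrt 2"] a T
    by (subst Bochner_Integration.integral_add) auto
  also have "sqrt (2 * pi) / (a / sqrt 2) = 2 * sqrt pi / a"
    by (simp add: real_sqrt_mult)
  also have "\<dots> \<le> 2 * pi / a"
  proof -
    have "sqrt pi \<le> pi" using pi_gt3 by (intro real_le_lsqrt) (auto simp: power2_eq_square)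
    then show ?thesis using a by (intro divide_right_mono) auto
  qed
  finally have "2 * pi * \<bar>normal_mixture F \<sigma> x - normal_mixture F' \<sigma>' x\<bar> \<le> 2 * (T * \<eta>) + 2 * pi * (2 / a * ?E)"
    by (simp add: mult_left_mono field_simps)
  also have "\<dots> \<le> 2 * pi * (T * \<eta>) + 2 * pi * (2 / a * ?E)"
    using mult_right_mono[of 1 pi "T * \<eta>"] pi_gt3 T \<eta> by simp
  finally have "2 * pi * \<bar>normal_mixture F \<sigma> x - normal_mixture F' \<sigma>' x\<bar> \<le> 2 * pi * (T * \<eta> + 2 / a * ?E)"
    by (simp only: distrib_left)
  then show ?thesis by (rule mult_left_le_imp_le) simp
qed

text \<open>The hypothesis is one-sided because each test is. Shifting the phase by
  \<open>pi\<close> changes the sign of a mean, so the four multiples of \<open>pi / 2\<close> yield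
  two-sided bounds at the phases 0 and \<open>pi / 2\<close>. The frequencies \<open>j / n\<close>
  fill \<open>[- n, n]\<close> with spacing \<open>1 / n\<close>, and rounding costs one Lipschitz
  term for each mixture.\<close>

lemma normal_mixture_diff_le_grid:
  assumes F: "prob_space F" "sets F = sets borel" and F': "prob_space F'" "sets F' = sets borel"
    and a: "0 < a" "a \<le> \<sigma>" "a \<le> \<sigma>'" and b: "\<sigma> \<le> b" "\<sigma>' \<le> b"
    and k: "AE y in F. \<bar>y\<bar> \<le> k" "AE y in F'. \<bar>y\<bar> \<le> k" and k0: "0 \<le> k"
    and T: "0 \<le> T" "T \<le> real n" and n: "0 < n" and \<delta>: "0 \<le> \<delta>"
    and grid: "\<And>j q. j \<in> {- (int n)\<^sup>2..(int n)\<^sup>2} \<Longrightarrow> q < (4::nat) \<Longrightarrow>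
      trig_mean F \<sigma> (of_int j / n) (q * (pi / 2)) \<le> trig_mean F' \<sigma>' (of_int j / n) (q * (pi / 2)) + \<delta>"
  shows "\<bar>normal_mixture F \<sigma> x - normal_mixture F' \<sigma>' x\<bar> \<le>
    T * (2 * \<delta> + 2 * (b + k) / n) + 2 / a * exp (- (a * T)\<^sup>2 / 4)"
proof (rule normal_mixture_diff_le[OF F F' a T(1)])
  have \<sigma>: "0 < \<sigma>" "0 < \<sigma>'" using a by auto
  show "0 \<le> 2 * \<delta> + 2 * (b + k) / n" using \<delta> k0 b \<sigma> by simp
  fix t c :: real assume t: "\<bar>t\<bar> \<le> T"
  let ?A = "\<lambda>t c. trig_mean F \<sigma> t c - trig_mean F' \<sigma>' t c"
  define j where "j = \<lfloor>t * n\<rfloor>"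
  have "\<bar>t * n\<bar> \<le> real n * real n"
    using t T by (auto simp: abs_mult intro!: mult_right_mono)
  then have tn: "- (real n)\<^sup>2 \<le> t * n" "t * n \<le> (real n)\<^sup>2" by (auto simp: power2_eq_square)
  have j: "j \<in> {- (int n)\<^sup>2..(int n)\<^sup>2}"
    unfolding j_def using tn by (auto simp: le_floor_iff floor_le_iff)
  have "\<bar>t * n - j\<bar> \<le> 1" unfolding j_def by linarith
  then have tj: "\<bar>t - j / n\<bar> \<le> 1 / n"
    using n by (simp add: field_simps abs_le_iff)
  have rot2: "trig_mean G s u (real 2 * (pi / 2)) = - trig_mean G s u (real 0 * (pi / 2))"
    and rot3: "trig_mean G s u (real 3 * (pi / 2)) = - trig_mean G s u (real 1 * (pi / 2))" for G s u
  proof -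
    have "cos (u * y + 3 * pi / 2) = - cos (u * y + pi / 2)" for y
    proof -
      have "u * y + 3 * pi / 2 = (u * y + pi / 2) + pi" by simp
      then show ?thesis by (simp only: cos_periodic_pi)
    qed
    then show "trig_mean G s u (real 2 * (pi / 2)) = - trig_mean G s u (real 0 * (pi / 2))"
      "trig_mean G s u (real 3 * (pi / 2)) = - trig_mean G s u (real 1 * (pi / 2))"
      by (simp_all add: trig_mean_def)
  qed
  have A: "\<bar>?A (j / n) 0\<bar> \<le> \<delta>" "\<bar>?A (j / n) (pi / 2)\<bar> \<le> \<delta>"
    using grid[OF j, of 0] grid[OF j, of 1] grid[OF j, of 2] grid[OF j, of 3]
    unfolding rot2 rot3 by (simp_all add: abs_le_iff)
  have "\<bar>?A (j / n) c\<bar> = \<bar>cos c * ?A (j / n) 0 + sin c * ?A (j / n) (pi / 2)\<bar>"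
    using trig_mean_rotate[OF F \<sigma>(1), of "j / n" c] trig_mean_rotate[OF F' \<sigma>(2), of "j / n" c]
    by (simp add: algebra_simps)
  also have "\<dots> \<le> 1 * \<delta> + 1 * \<delta>"
    by (rule order_trans[OF abs_triangle_ineq])
      (unfold abs_mult, intro add_mono mult_mono A, auto)
  finally have m: "\<bar>?A (j / n) c\<bar> \<le> 2 * \<delta>" by simp
  have L: "(s + k) * \<bar>t - j / n\<bar> \<le> (b + k) / n" if "0 < s" "s \<le> b" for s
    using mult_mono[of "s + k" "b + k" "\<bar>t - j / n\<bar>" "1 / n"] that k0 tj by simp
  have "\<bar>?A t c\<bar> \<le> \<bar>?A (j / n) c\<bar> + \<bar>trig_mean F \<sigma> t c - trig_mean F \<sigma> (j / n) c\<bar> +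
    \<bar>trig_mean F' \<sigma>' t c - trig_mean F' \<sigma>' (j / n) c\<bar>" by linarith
  also have "\<dots> \<le> 2 * \<delta> + (b + k) / n + (b + k) / n"
    using m trig_mean_lipschitz[OF F \<sigma>(1) k(1), of t c "j / n"] L[OF \<sigma>(1) b(1)]
      trig_mean_lipschitz[OF F' \<sigma>(2) k(2), of t c "j / n"] L[OF \<sigma>(2) b(2)] by linarith
  finally show "\<bar>?A t c\<bar> \<le> 2 * \<delta> + 2 * (b + k) / n" by simp
qed

section \<open>Dirichlet processes and conic Caratheodory\<close>

text \<open>Elimination by induction on the number of equations: the last equation is solved for a
  pivot \<open>p\<close>, which leaves one equation and one unknown fewer.\<close>

lemma homogeneous_system_nontrivial_solution:
  fixes f :: "nat \<Rightarrow> 'a \<Rightarrow> real"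
  assumes "finite S" "q < card S"
  shows "\<exists>v. (\<exists>s\<in>S. v s \<noteq> 0) \<and> (\<forall>i<q. (\<Sum>s\<in>S. v s * f i s) = 0)"
  using assms
proof (induction q arbitrary: S f)
  case 0
  then obtain s where "s \<in> S" by (metis all_not_in_conv card.empty less_irrefl)
  then show ?case by (intro exI[of _ "\<lambda>_. 1"]) auto
next
  case (Suc q)
  show ?case
  proof (cases "\<forall>s\<in>S. f q s = 0")
    case True
    from Suc.IH[of S f] Suc.prems obtain v where "\<exists>s\<in>S. v s \<noteq> 0" "\<forall>i<q. (\<Sum>s\<in>S. v s * f i s) = 0"
      by auto
    with True show ?thesis by (auto simp: less_Suc_eq)
  next
    case False
    then obtain p where p: "p \<in> S" "f q p \<noteq> 0" by auto
    let ?S = "S - {p}"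
    let ?f = "\<lambda>i s. f i s - f i p * f q s / f q p"
    have "finite ?S" "q < card ?S" using Suc.prems p by auto
    from Suc.IH[OF this, of ?f] obtain v
      where v: "\<exists>s\<in>?S. v s \<noteq> 0" "\<forall>i<q. (\<Sum>s\<in>?S. v s * ?f i s) = 0" by auto
    let ?v = "v(p := - (\<Sum>s\<in>?S. v s * f q s) / f q p)"
    have "(\<Sum>s\<in>S. ?v s * f i s) = (\<Sum>s\<in>?S. v s * ?f i s)" for i
    proof -
      have "(\<Sum>s\<in>S. ?v s * f i s) = ?v p * f i p + (\<Sum>s\<in>?S. ?v s * f i s)"
        using p Suc.prems by (subst sum.remove[of S p]) auto
      also have "(\<Sum>s\<in>?S. ?v s * f i s) = (\<Sum>s\<in>?S. v s * f i s)"
        by (intro sum.cong) auto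
      also have "?v p * f i p = - (\<Sum>s\<in>?S. v s * (f i p * f q s / f q p))"
        by (simp add: sum_distrib_left sum_distrib_right sum_divide_distrib sum_negf[symmetric] algebra_simps)
      finally show ?thesis by (simp add: right_diff_distrib sum_subtractf)
    qed
    moreover have "(\<Sum>s\<in>?S. v s * ?f q s) = 0" using p by simp
    ultimately have "\<forall>i<Suc q. (\<Sum>s\<in>S. ?v s * f i s) = 0"
      using v(2) by (auto simp: less_Suc_eq)
    moreover have "\<exists>s\<in>S. ?v s \<noteq> 0" using v(1) by auto
    ultimately show ?thesis by blast
  qed
qed

text \<open>As long as more than \<open>q\<close> weights are nonzero, some nonzero \<open>v\<close>
  carried by their indices is annihilated by all \<open>q\<close> functionals. Subtracting the
  largest multiple of \<open>v\<close> that keeps the weights nonnegative removes at least one index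
  and changes none of the sums.\<close>

lemma conic_caratheodory:
  fixes f :: "nat \<Rightarrow> 'a \<Rightarrow> real"
  assumes J: "finite J" and "\<And>j. j \<in> J \<Longrightarrow> 0 \<le> w j"
  shows "\<exists>w'. (\<forall>j\<in>J. 0 \<le> w' j) \<and> card {j\<in>J. w' j \<noteq> 0} \<le> q \<and>
    (\<forall>i<q. (\<Sum>j\<in>J. w' j * f i j) = (\<Sum>j\<in>J. w j * f i j))"
  using assms(2)
proof (induction "card {j\<in>J. w j \<noteq> 0}" arbitrary: w rule: less_induct)
  case less
  let ?S = "{j\<in>J. w j \<noteq> 0}"
  show ?case
  proof (cases "card ?S \<le> q")
    case True
    then show ?thesis using less.prems by blast
  next
    case False
    then obtain v0 where v0: "\<exists>s\<in>?S. v0 s \<noteq> 0" "\<forall>i<q. (\<Sum>s\<in>?S. v0 s * f i s) = 0"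
      using homogeneous_system_nontrivial_solution[of ?S q f] J by auto
    \<comment> \<open>The sign is chosen so that \<open>v\<close> has a positive entry; otherwise
      the minimum of the ratios \<open>w s / v s\<close> would range over the empty set.\<close>
    define v where "v = (if \<exists>s\<in>?S. 0 < v0 s then v0 else (\<lambda>s. - v0 s))"
    have v: "\<exists>s\<in>?S. 0 < v s" "\<forall>i<q. (\<Sum>s\<in>?S. v s * f i s) = 0"
    proof -
      from v0(1) obtain s where "s \<in> ?S" "v0 s \<noteq> 0" by blast
      then have "0 < v0 s \<or> 0 < - v0 s" by linarith
      with \<open>s \<in> ?S\<close> show "\<exists>s\<in>?S. 0 < v s" unfolding v_def by (cases "\<exists>s\<in>?S. 0 < v0 s") force+
      show "\<forall>i<q. (\<Sum>s\<in>?S. v s * f i s) = 0" using v0(2) by (simp add: v_def sum_negf)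
    qed
    let ?P = "{s\<in>?S. 0 < v s}"
    have P: "finite ?P" "?P \<noteq> {}" using J v by auto
    define t where "t = Min ((\<lambda>s. w s / v s) ` ?P)"
    have "t \<in> (\<lambda>s. w s / v s) ` ?P"
      unfolding t_def using P by (intro Min_in) auto
    then obtain p where p: "p \<in> ?P" "t = w p / v p" by blast
    have t: "t \<le> w s / v s" if "s \<in> ?P" for s
      unfolding t_def using P that by (intro Min_le) auto
    have t0: "0 \<le> t" using p less.prems by auto
    define u where "u = (\<lambda>j. if j \<in> ?S then w j - t * v j else 0)"
    have nonneg: "0 \<le> u j" if "j \<in> J" for j
    proof (cases "j \<in> ?P")
      case True
      then show ?thesis using t[OF True] by (auto simp: u_def field_simps)
    next
      case False
      then show ?thesis
        using t0 less.prems[OF that] mult_nonneg_nonpos[of t "v j"] by (auto simp: u_def)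
    qed
    have "u p = 0" using p by (auto simp: u_def)
    then have "{j\<in>J. u j \<noteq> 0} \<subseteq> ?S - {p}" by (auto simp: u_def)
    then have "{j\<in>J. u j \<noteq> 0} \<subset> ?S" using p by blast
    then have "card {j\<in>J. u j \<noteq> 0} < card ?S"
      using J by (intro psubset_card_mono) auto
    from less.hyps[OF this nonneg] obtain w' where w': "\<forall>j\<in>J. 0 \<le> w' j"
      "card {j\<in>J. w' j \<noteq> 0} \<le> q" "\<forall>i<q. (\<Sum>j\<in>J. w' j * f i j) = (\<Sum>j\<in>J. u j * f i j)" by auto
    moreover have "(\<Sum>j\<in>J. u j * f i j) = (\<Sum>j\<in>J. w j * f i j)" if "i < q" for i
    proof -
      have "(\<Sum>j\<in>J. u j * f i j) = (\<Sum>j\<in>?S. u j * f i j)"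
        using J by (intro sum.mono_neutral_right) (auto simp: u_def)
      also have "\<dots> = (\<Sum>j\<in>?S. w j * f i j - t * (v j * f i j))"
        by (intro sum.cong) (auto simp: u_def algebra_simps)
      also have "\<dots> = (\<Sum>j\<in>?S. w j * f i j)"
        using v(2) that by (simp add: sum_subtractf sum_distrib_left[symmetric])
      also have "\<dots> = (\<Sum>j\<in>J. w j * f i j)"
        using J by (intro sum.mono_neutral_left) auto
      finally show ?thesis .
    qed
    ultimately show ?thesis by auto
  qed
qed

section \<open>Gamma laws and Dirichlet distributions\<close>

lemma sets_gamma_law [simp, measurable_cong]: "sets (gamma_law a) = sets borel"
  and space_gamma_law [simp]: "space (gamma_law a) = UNIV"
  by (simp_all add: gamma_law_def)

lemma sigma_finite_gamma_law: "sigma_finite_measure (gamma_law a)"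
proof (cases "a = 0")
  case True
  then show ?thesis
    by (simp add: gamma_law_def) (intro prob_space_imp_sigma_finite prob_space_return, simp)
next
  case False
  have "sigma_finite_measure (density lborel
      (\<lambda>x. ennreal (if 0 < x then x powr (a - 1) * exp (- x) / Gamma a else 0)))"
    by (subst sigma_finite_measure.sigma_finite_iff_density_finite[OF sigma_finite_lborel]) auto
  then show ?thesis using False by (simp add: gamma_law_def)
qed

text \<open>Cell parameters may be arbitrarily close to 0, where \<open>Gamma\<close> blows up. The
  shift by one moves the argument into the compact interval \<open>[1, A + 1]\<close>, on which
  continuity gives one bound for all cells.\<close>

lemma Gamma_bounded_above:
  fixes A :: real
  obtains C where "0 < C" "\<And>a. 0 \<le> a \<Longrightarrow> a \<le> A \<Longrightarrow> Gamma (a + 1) \<le> C"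
proof -
  have "continuous_on {1..A + 1} (Gamma :: real \<Rightarrow> real)"
    by (intro continuous_on_Gamma continuous_on_id) (auto elim!: nonpos_Ints_cases)
  then have "bounded (Gamma ` {1..A + 1})"
    by (intro compact_imp_bounded compact_continuous_image) auto
  then obtain C where "\<forall>x\<in>{1..A + 1}. \<bar>Gamma x\<bar> \<le> C"
    by (auto simp: bounded_iff)
  then have "Gamma (a + 1) \<le> max C 1" if "0 \<le> a" "a \<le> A" for a
  proof -
    have "\<bar>Gamma (a + 1)\<bar> \<le> C" using \<open>\<forall>x\<in>{1..A + 1}. \<bar>Gamma x\<bar> \<le> C\<close> that by simp
    then show ?thesis by linarith
  qed
  then show thesis by (intro that[of "max C 1"]) auto
qed

text \<open>The density is bounded below factor by factor:
  \<open>1 / Gamma a = a / Gamma (a + 1)\<close> is at least \<open>a / C\<close>, the exponential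
  is at least \<open>exp (- 2)\<close>, and the power is at least
  \<open>(\<delta> / 2) powr A / 2\<close> because the argument lies in
  \<open>[\<delta> / 2, 2]\<close>. The length \<open>\<delta> / 2\<close> of the interval supplies
  the last power. Starting at \<open>v + \<delta> / 2\<close> keeps the argument away from 0 even if
  \<open>v = 0\<close>.\<close>

lemma emeasure_gamma_law_Icc_ge:
  assumes a: "0 < a" "a \<le> A" and C: "0 < C" "Gamma (a + 1) \<le> C"
    and v: "0 \<le> v" "v \<le> 1" and \<delta>: "0 < \<delta>" "\<delta> \<le> 1"
  shows "ennreal (a / (2 * exp 2 * C) * (\<delta> / 2) powr (A + 1)) \<le> emeasure (gamma_law a) {v + \<delta> / 2..v + \<delta>}"
proof -
  let ?B = "a / (2 * exp 2 * C) * (\<delta> / 2) powr A"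
  have ge: "?B \<le> z powr (a - 1) * exp (- z) / Gamma a" if z: "\<delta> / 2 \<le> z" "z \<le> 2" for z
  proof -
    have z0: "0 < z" using z \<delta> by linarith
    have "(\<delta> / 2) powr A \<le> (\<delta> / 2) powr a" using \<delta> a by (intro powr_mono') auto
    also have "\<dots> \<le> z powr a" using \<delta> a z by (intro powr_mono2) auto
    finally have "(\<delta> / 2) powr A / 2 \<le> z powr a / z" using z0 z by (intro frac_le) auto
    also have "z powr a / z = z powr (a - 1)" using z0 by (simp add: powr_diff)
    finally have 1: "(\<delta> / 2) powr A / 2 \<le> z powr (a - 1)" .
    have 2: "exp (- 2) \<le> exp (- z)" using z by simp
    have G: "0 < Gamma a" "0 < Gamma (a + 1)" "Gamma (a + 1) = a * Gamma a"
      using a by (auto simp: Gamma_plus1 nonpos_Ints_def intro!: Gamma_real_pos)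
    have 3: "a / C \<le> 1 / Gamma a"
      using G C a by (simp add: field_simps)
    have "(\<delta> / 2) powr A / 2 * exp (- 2) * (a / C) \<le> z powr (a - 1) * exp (- z) * (1 / Gamma a)"
      using 1 2 3 a C by (intro mult_mono) auto
    then show ?thesis by (simp add: exp_minus field_simps)
  qed
  have "ennreal (a / (2 * exp 2 * C) * (\<delta> / 2) powr (A + 1)) = ennreal ?B * ennreal (\<delta> / 2)"
    using a C \<delta> by (subst ennreal_mult[symmetric]) (auto simp: powr_add)
  also have "\<dots> = (\<integral>\<^sup>+z. ennreal ?B * indicator {v + \<delta> / 2..v + \<delta>} z \<partial>lborel)"
    using \<delta> by (simp add: nn_integral_cmult_indicator)
  also have "\<dots> \<le> (\<integral>\<^sup>+z. ennreal (if 0 < z then z powr (a - 1) * exp (- z) / Gamma a else 0) *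
      indicator {v + \<delta> / 2..v + \<delta>} z \<partial>lborel)"
  proof (intro nn_integral_mono)
    fix z
    show "ennreal ?B * indicator {v + \<delta> / 2..v + \<delta>} z \<le>
      ennreal (if 0 < z then z powr (a - 1) * exp (- z) / Gamma a else 0) * indicator {v + \<delta> / 2..v + \<delta>} z"
      using ge[of z] v \<delta> by (auto simp: indicator_def intro!: ennreal_leI)
  qed
  also have "\<dots> = emeasure (gamma_law a) {v + \<delta> / 2..v + \<delta>}"
    using a by (simp add: gamma_law_def emeasure_density)
  finally show ?thesis .
qed

lemma prod_mono_ennreal:
  fixes f g :: "'a \<Rightarrow> ennreal"
  assumes "\<And>i. i \<in> A \<Longrightarrow> f i \<le> g i"
  shows "prod f A \<le> prod g A"
  using assms by (induction A rule: infinite_finite_induct) (auto intro: mult_mono)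

lemma measurable_dirichlet_normalisation:
  "(\<lambda>z. \<lambda>i\<in>{..<m}. z i / (\<Sum>j<m. z j)) \<in> (\<Pi>\<^sub>M i\<in>{..<m}. gamma_law (a i)) \<rightarrow>\<^sub>M (\<Pi>\<^sub>M i\<in>{..<m}. borel)"
proof -
  have "sets (\<Pi>\<^sub>M i\<in>{..<m}. gamma_law (a i)) = sets (\<Pi>\<^sub>M i\<in>{..<m}. borel)"
    by (intro sets_PiM_cong) auto
  moreover have "(\<lambda>z. \<lambda>i\<in>{..<m}. z i / (\<Sum>j<m. z j)) \<in>
      (\<Pi>\<^sub>M i\<in>{..<m}. borel) \<rightarrow>\<^sub>M (\<Pi>\<^sub>M i\<in>{..<m}. (borel :: real measure))"
    by (intro measurable_restrict borel_measurable_divide borel_measurable_sum measurable_component_singleton)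
      auto
  ultimately show ?thesis by (simp cong: measurable_cong_sets)
qed

text \<open>If the independent gamma variables satisfy
  \<open>v i + \<delta> / 2 \<le> z i \<le> v i + \<delta>\<close>, then their sum is at most
  \<open>1 + m * \<delta>\<close>, so normalisation loses no more than this factor. Independence
  turns the probability into a product of \<open>m\<close> one-dimensional bounds.\<close>

lemma emeasure_dirichlet_distribution_ge:
  fixes a v :: "nat \<Rightarrow> real"
  assumes a: "\<And>i. i < m \<Longrightarrow> a\<^sub>0 \<le> a i" "\<And>i. i < m \<Longrightarrow> a i \<le> A" and a\<^sub>0: "0 < a\<^sub>0"
    and C: "0 < C" "\<And>i. i < m \<Longrightarrow> Gamma (a i + 1) \<le> C"
    and v: "\<And>i. i < m \<Longrightarrow> 0 \<le> v i" "(\<Sum>i<m. v i) = 1" and \<delta>: "0 < \<delta>" "\<delta> \<le> 1"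
  shows "ennreal ((a\<^sub>0 / (2 * exp 2 * C) * (\<delta> / 2) powr (A + 1)) ^ m) \<le>
    emeasure (dirichlet_distribution m a)
      {x \<in> space (\<Pi>\<^sub>M i\<in>{..<m}. borel). \<forall>i<m. v i / (1 + m * \<delta>) \<le> x i}"
proof -
  interpret product_sigma_finite "\<lambda>i. gamma_law (a i)"
    by (simp add: product_sigma_finite_def sigma_finite_gamma_law)
  let ?P = "\<Pi>\<^sub>M i\<in>{..<m}. gamma_law (a i)"
  let ?g = "\<lambda>z. \<lambda>i\<in>{..<m}. z i / (\<Sum>j<m. z j)"
  let ?I = "\<lambda>i. {v i + \<delta> / 2..v i + \<delta>}"
  let ?E = "{x \<in> space (\<Pi>\<^sub>M i\<in>{..<m}. borel). \<forall>i<m. v i / (1 + m * \<delta>) \<le> x i}"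
  have m: "0 < m" using v(2) by (cases m) auto
  have v1: "v i \<le> 1" if "i < m" for i
  proof -
    have "v i \<le> (\<Sum>i<m. v i)" using that v(1) by (intro member_le_sum) auto
    then show ?thesis using v(2) by simp
  qed
  have E: "?E \<in> sets (\<Pi>\<^sub>M i\<in>{..<m}. borel)"
    by measurable
  have sp: "Pi\<^sub>E {..<m} ?I \<subseteq> ?g -` ?E \<inter> space ?P"
  proof
    fix z assume z: "z \<in> Pi\<^sub>E {..<m} ?I"
    have zi: "v i + \<delta> / 2 \<le> z i" "z i \<le> v i + \<delta>" if "i < m" for i
      using PiE_mem[OF z, of i] that by auto
    have pos: "0 < z i" if "i < m" for i
      using zi[OF that] v(1)[OF that] \<delta> by linarith
    have "(\<Sum>i<m. z i) \<le> (\<Sum>i<m. v i + \<delta>)" using zi by (intro sum_mono) auto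
    then have S: "(\<Sum>i<m. z i) \<le> 1 + m * \<delta>" using v(2) by (simp add: sum.distrib)
    have S0: "0 < (\<Sum>i<m. z i)" using pos m by (intro sum_pos) auto
    have "v i / (1 + m * \<delta>) \<le> z i / (\<Sum>j<m. z j)" if "i < m" for i
      using zi[OF that] v(1)[OF that] \<delta> S S0 by (intro frac_le) auto
    moreover have "z \<in> space ?P" using z by (auto simp: space_PiM PiE_def)
    ultimately show "z \<in> ?g -` ?E \<inter> space ?P" by (auto simp: space_PiM)
  qed
  have "ennreal ((a\<^sub>0 / (2 * exp 2 * C) * (\<delta> / 2) powr (A + 1)) ^ m) =
      (\<Prod>i<m. ennreal (a\<^sub>0 / (2 * exp 2 * C) * (\<delta> / 2) powr (A + 1)))"
    using a\<^sub>0 C by (simp add: ennreal_power)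
  also have "\<dots> \<le> (\<Prod>i<m. emeasure (gamma_law (a i)) (?I i))"
  proof (rule prod_mono_ennreal)
    fix i assume "i \<in> {..<m}"
    then have i: "i < m" by simp
    have "ennreal (a\<^sub>0 / (2 * exp 2 * C) * (\<delta> / 2) powr (A + 1)) \<le>
        ennreal (a i / (2 * exp 2 * C) * (\<delta> / 2) powr (A + 1))"
      using a(1)[OF i] C(1) by (intro ennreal_leI mult_right_mono divide_right_mono) auto
    also have "\<dots> \<le> emeasure (gamma_law (a i)) (?I i)"
      using a(1,2)[OF i] a\<^sub>0 C(1) C(2)[OF i] v(1)[OF i] v1[OF i] \<delta>
      by (intro emeasure_gamma_law_Icc_ge) auto
    finally show "ennreal (a\<^sub>0 / (2 * exp 2 * C) * (\<delta> / 2) powr (A + 1)) \<le> emeasure (gamma_law (a i)) (?I i)" .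
  qed
  also have "\<dots> = emeasure ?P (Pi\<^sub>E {..<m} ?I)"
    by (subst emeasure_PiM) auto
  also have "\<dots> \<le> emeasure ?P (?g -` ?E \<inter> space ?P)"
    by (intro emeasure_mono sp measurable_sets[OF measurable_dirichlet_normalisation E])
  also have "\<dots> = emeasure (dirichlet_distribution m a) ?E"
    unfolding dirichlet_distribution_def
    by (rule emeasure_distr[OF measurable_dirichlet_normalisation E, symmetric])
  finally show ?thesis .
qed

section \<open>Dirichlet processes on finite partitions\<close>

lemma is_dirichlet_processD:
  assumes "is_dirichlet_process \<alpha> D" "\<And>i. i < m \<Longrightarrow> A i \<in> sets borel"
    and "disjoint_family_on A {..<m}" "(\<Union>i<m. A i) = UNIV"
  shows "distr D (\<Pi>\<^sub>M i\<in>{..<m}. borel) (\<lambda>F. \<lambda>i\<in>{..<m}. measure F (A i)) =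
    dirichlet_distribution m (\<lambda>i. measure \<alpha> (A i))"
proof -
  have "(\<forall>i<m. A i \<in> sets borel) \<and> disjoint_family_on A {..<m} \<and> (\<Union>i<m. A i) = UNIV"
    using assms(2-4) by blast
  with assms(1)[unfolded is_dirichlet_process_def, THEN conjunct2, THEN conjunct2,
      THEN spec, of m, THEN spec, of A]
  show ?thesis by (rule mp)
qed

lemma measurable_measure_prob_algebra:
  assumes "sets D = sets (prob_algebra borel)" "A \<in> sets borel"
  shows "(\<lambda>F. measure F A) \<in> borel_measurable D"
proof -
  have "(\<lambda>F. measure F A) \<in> borel_measurable (prob_algebra borel)"
    unfolding prob_algebra_def
    by (intro measurable_restrict_space1 measurable_measure_subprob_algebra assms)
  then show ?thesis using assms(1) by (simp cong: measurable_cong_sets)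
qed

text \<open>The complement of the cells completes them to a partition and receives the target mass
  0. Its gamma variable has to fall into a prescribed interval as well, which explains its share
  \<open>a\<^sub>0\<close> of base mass and the additional factor in the exponent
  \<open>Suc (card J)\<close>.\<close>

lemma dirichlet_process_cells_ge:
  fixes \<delta> :: real
  assumes D: "is_dirichlet_process \<alpha> D" and \<alpha>: "finite_measure \<alpha>" "sets \<alpha> = sets borel"
    and J: "finite J" and U: "\<And>j. j \<in> J \<Longrightarrow> U j \<in> sets borel" "disjoint_family_on U J"
    and a\<^sub>0: "0 < a\<^sub>0" "\<And>j. j \<in> J \<Longrightarrow> a\<^sub>0 \<le> measure \<alpha> (U j)" "a\<^sub>0 \<le> measure \<alpha> (- (\<Union>j\<in>J. U j))"
    and C: "0 < C" "\<And>a. 0 \<le> a \<Longrightarrow> a \<le> measure \<alpha> UNIV \<Longrightarrow> Gamma (a + 1) \<le> C"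
    and w: "\<And>j. j \<in> J \<Longrightarrow> 0 \<le> w j" "(\<Sum>j\<in>J. w j) = 1" and \<delta>: "0 < \<delta>" "\<delta> \<le> 1"
  shows "ennreal ((a\<^sub>0 / (2 * exp 2 * C) * (\<delta> / 2) powr (measure \<alpha> UNIV + 1)) ^ Suc (card J)) \<le>
    emeasure D {F \<in> space D. \<forall>j\<in>J. w j / (1 + Suc (card J) * \<delta>) \<le> measure F (U j)}"
proof -
  interpret \<alpha>: finite_measure \<alpha> by fact
  let ?N = "card J" and ?m = "Suc (card J)"
  obtain e where e: "bij_betw e {0..<?N} J" using ex_bij_betw_nat_finite[OF J] by auto
  have eJ: "e i \<in> J" if "i < ?N" for i using bij_betwE[OF e] that by auto
  have e_img: "e ` {..<?N} = J" using e by (simp add: bij_betw_def lessThan_atLeast0)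
  have e_inj: "i = j" if "e i = e j" "i < ?N" "j < ?N" for i j
    using e that by (auto simp: bij_betw_def inj_on_def)
  define A where "A i = (if i < ?N then U (e i) else - (\<Union>j\<in>J. U j))" for i
  define v where "v i = (if i < ?N then w (e i) else 0)" for i
  have A: "A i \<in> sets borel" for i
    using U(1) eJ J unfolding A_def by (cases "i < ?N") (auto intro!: borel_comp sets.finite_UN simp del: Compl_UN)
  have "disjoint_family_on A {..<?m}"
    unfolding disjoint_family_on_def
  proof (intro ballI impI)
    fix i j assume ij: "i \<in> {..<?m}" "j \<in> {..<?m}" "i \<noteq> j"
    have "U (e i) \<inter> U (e j) = {}" if "i < ?N" "j < ?N"
    proof -
      have "e i \<noteq> e j" using e_inj[of i j] that ij by blast
      then show ?thesis using disjoint_family_onD[OF U(2) eJ[OF that(1)] eJ[OF that(2)]] by simp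
    qed
    then show "A i \<inter> A j = {}" using ij eJ by (auto simp: A_def)
  qed
  moreover have "(\<Union>i<?m. A i) = UNIV"
  proof -
    have "(\<Union>i<?N. A i) = (\<Union>j\<in>e ` {..<?N}. U j)"
      by (auto simp: A_def)
    then have "(\<Union>i<?N. A i) = (\<Union>j\<in>J. U j)" by (simp only: e_img)
    then show ?thesis by (auto simp: lessThan_Suc A_def[of ?N])
  qed
  ultimately have distr: "distr D (\<Pi>\<^sub>M i\<in>{..<?m}. borel) (\<lambda>F. \<lambda>i\<in>{..<?m}. measure F (A i)) =
      dirichlet_distribution ?m (\<lambda>i. measure \<alpha> (A i))"
    using A by (intro is_dirichlet_processD[OF D]) auto
  have setsD: "sets D = sets (prob_algebra borel)" using D by (simp add: is_dirichlet_process_def)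
  have meas: "(\<lambda>F. \<lambda>i\<in>{..<?m}. measure F (A i)) \<in> D \<rightarrow>\<^sub>M (\<Pi>\<^sub>M i\<in>{..<?m}. borel)"
    by (intro measurable_restrict measurable_measure_prob_algebra[OF setsD A])
  let ?E = "{x \<in> space (\<Pi>\<^sub>M i\<in>{..<?m}. borel). \<forall>i<?m. v i / (1 + ?m * \<delta>) \<le> x i}"
  have "(\<Sum>i<?N. v i) = (\<Sum>j\<in>J. w j)"
    using sum.reindex_bij_betw[OF e, of w] by (simp add: v_def lessThan_atLeast0)
  then have v_sum: "(\<Sum>i<?m. v i) = 1" using w(2) by (simp add: v_def[of ?N])
  have "ennreal ((a\<^sub>0 / (2 * exp 2 * C) * (\<delta> / 2) powr (measure \<alpha> UNIV + 1)) ^ ?m) \<le>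
    emeasure (dirichlet_distribution ?m (\<lambda>i. measure \<alpha> (A i))) ?E"
  proof (rule emeasure_dirichlet_distribution_ge)
    show "measure \<alpha> (A i) \<le> measure \<alpha> UNIV" for i
      using \<alpha>.finite_measure_mono[of "A i" UNIV] \<alpha>(2) by simp
    then show "Gamma (measure \<alpha> (A i) + 1) \<le> C" for i
      by (intro C) auto
    show "a\<^sub>0 \<le> measure \<alpha> (A i)" for i
      using a\<^sub>0 eJ by (auto simp: A_def)
    show "0 \<le> v i" for i using w eJ by (auto simp: v_def)
  qed (use a\<^sub>0 C \<delta> v_sum in auto)
  also have "\<dots> = emeasure D ((\<lambda>F. \<lambda>i\<in>{..<?m}. measure F (A i)) -` ?E \<inter> space D)"
    unfolding distr[symmetric] by (rule emeasure_distr[OF meas]) measurable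
  also have "\<dots> \<le> emeasure D {F \<in> space D. \<forall>j\<in>J. w j / (1 + ?m * \<delta>) \<le> measure F (U j)}"
  proof (rule emeasure_mono)
    show "(\<lambda>F. \<lambda>i\<in>{..<?m}. measure F (A i)) -` ?E \<inter> space D \<subseteq>
        {F \<in> space D. \<forall>j\<in>J. w j / (1 + ?m * \<delta>) \<le> measure F (U j)}"
    proof (intro subsetI CollectI conjI ballI)
      fix F j assume F: "F \<in> (\<lambda>F. \<lambda>i\<in>{..<?m}. measure F (A i)) -` ?E \<inter> space D" and j: "j \<in> J"
      have "j \<in> e ` {..<?N}" using j e_img by simp
      then obtain i where i: "i < ?N" "j = e i" by blast
      have "v i / (1 + ?m * \<delta>) \<le> measure F (A i)" using F i by auto
      then show "w j / (1 + ?m * \<delta>) \<le> measure F (U j)"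
        using i by (simp add: A_def v_def)
    qed auto
    have "(\<lambda>F. measure F (U j)) \<in> borel_measurable D" if "j \<in> J" for j
      by (rule measurable_measure_prob_algebra[OF setsD U(1)[OF that]])
    then show "{F \<in> space D. \<forall>j\<in>J. w j / (1 + ?m * \<delta>) \<le> measure F (U j)} \<in> sets D"
      using J by (intro sets.sets_Collect_finite_All) auto
  qed
  finally show ?thesis .
qed

text \<open>In the partition into \<open>B\<close> and its complement the second shape parameter is
  0, so the second gamma variable is the constant 0 and remains 0 after normalisation.\<close>

lemma dirichlet_process_AE_null:
  assumes D: "is_dirichlet_process \<alpha> D" and B: "B \<in> sets borel" "measure \<alpha> (- B) = 0"
  shows "AE F in D. measure F (- B) = 0"
proof -
  let ?A = "\<lambda>i::nat. if i = 0 then B else - B"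
  let ?M = "\<Pi>\<^sub>M i\<in>{..<2::nat}. (borel :: real measure)"
  let ?f = "\<lambda>F. \<lambda>i\<in>{..<2}. measure F (?A i)" and ?a = "\<lambda>i. measure \<alpha> (?A i)"
  have "disjoint_family_on ?A {..<2}" by (auto simp: disjoint_family_on_def split: if_splits)
  moreover have "(\<Union>i<2. ?A i) = UNIV" by (auto simp: numeral_2_eq_2 lessThan_Suc)
  moreover have "\<forall>i<2. ?A i \<in> sets borel" using B by auto
  ultimately have distr: "distr D ?M ?f = dirichlet_distribution 2 ?a"
    by (intro is_dirichlet_processD[OF D]) auto
  have setsD: "sets D = sets (prob_algebra borel)" using D by (simp add: is_dirichlet_process_def)
  have meas: "?f \<in> D \<rightarrow>\<^sub>M ?M"
  proof (intro measurable_restrict measurable_measure_prob_algebra[OF setsD])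
    show "?A i \<in> sets borel" for i using B(1) by (cases "i = 0") auto
  qed
  interpret product_sigma_finite "\<lambda>i. gamma_law (?a i)"
    by (simp add: product_sigma_finite_def sigma_finite_gamma_law)
  let ?P = "\<Pi>\<^sub>M i\<in>{..<2}. gamma_law (?a i)"
  have pred: "{x \<in> space ?M. x 1 = 0} \<in> sets ?M"
    by measurable
  have "AE z in ?P. z 1 = 0"
  proof (rule AE_I)
    show "{z \<in> space ?P. \<not> z 1 = 0} \<subseteq> Pi\<^sub>E {..<2} (\<lambda>i. if i = 0 then UNIV else - {0})"
      by (auto simp: space_PiM PiE_def less_2_cases_iff)
    have "emeasure ?P (Pi\<^sub>E {..<2} (\<lambda>i. if i = 0 then UNIV else - {0})) =
        (\<Prod>i<2. emeasure (gamma_law (?a i)) (if i = 0 then UNIV else - {0}))"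
      by (rule emeasure_PiM) auto
    also have "\<dots> = 0"
      using B by (simp add: numeral_2_eq_2 gamma_law_def)
    finally show "emeasure ?P (Pi\<^sub>E {..<2} (\<lambda>i. if i = 0 then UNIV else - {0})) = 0" .
    show "Pi\<^sub>E {..<2} (\<lambda>i. if i = 0 then UNIV else - {0}) \<in> sets ?P"
      by (intro sets_PiM_I_finite) auto
  qed
  then have "AE x in dirichlet_distribution 2 ?a. x 1 = 0"
    unfolding dirichlet_distribution_def
    by (subst AE_distr_iff[OF measurable_dirichlet_normalisation pred]) (auto elim: eventually_mono)
  then have "AE F in D. ?f F 1 = 0"
    unfolding distr[symmetric] by (subst (asm) AE_distr_iff[OF meas pred])
  then show ?thesis by simp
qed

section \<open>Likelihood ratios of moment-matched mixtures\<close>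

lemma sum_indicator_disjoint_family:
  fixes a :: "'i \<Rightarrow> real"
  assumes "finite J" "disjoint_family_on U J" "i \<in> J" "y \<in> U i"
  shows "(\<Sum>j\<in>J. a j * indicator (U j) y) = a i"
proof -
  have "y \<notin> U j" if "j \<in> J" "j \<noteq> i" for j
    using disjoint_family_onD[OF assms(2) that(1) assms(3) that(2)] assms(4) by auto
  then have "(\<Sum>j\<in>J. a j * indicator (U j) y) = (\<Sum>j\<in>J. if j = i then a j else 0)"
    using assms(4) by (intro sum.cong) (auto simp: indicator_def)
  then show ?thesis using assms by simp
qed

context prob_space
begin

lemma integral_sum_indicator:
  fixes a :: "'i \<Rightarrow> real"
  assumes "\<And>j. j \<in> J \<Longrightarrow> U j \<in> events"
  shows "integrable M (\<lambda>y. \<Sum>j\<in>J. a j * indicator (U j) y)"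
    and "(\<integral>y. (\<Sum>j\<in>J. a j * indicator (U j) y) \<partial>M) = (\<Sum>j\<in>J. a j * prob (U j))"
proof -
  have i: "integrable M (\<lambda>y. a j * indicator (U j) y)" if "j \<in> J" for j
    using assms[OF that] by (intro integrable_mult_right integrable_real_indicator) (auto simp: emeasure_eq_measure)
  then show "integrable M (\<lambda>y. \<Sum>j\<in>J. a j * indicator (U j) y)"
    by (rule Bochner_Integration.integrable_sum)
  have "(\<integral>y. (\<Sum>j\<in>J. a j * indicator (U j) y) \<partial>M) = (\<Sum>j\<in>J. \<integral>y. a j * indicator (U j) y \<partial>M)"
    by (intro Bochner_Integration.integral_sum i)
  also have "\<dots> = (\<Sum>j\<in>J. a j * prob (U j))"
    using assms by (intro sum.cong) (auto simp: Int_absorb2 sets.sets_into_space)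
  finally show "(\<integral>y. (\<Sum>j\<in>J. a j * indicator (U j) y) \<partial>M) = (\<Sum>j\<in>J. a j * prob (U j))" .
qed

lemma sum_cells_le_expectation:
  fixes a :: "'i \<Rightarrow> real"
  assumes J: "finite J" "disjoint_family_on U J" "\<And>j. j \<in> J \<Longrightarrow> U j \<in> events"
    and f: "integrable M f" "\<And>y. 0 \<le> f y" "\<And>j y. j \<in> J \<Longrightarrow> y \<in> U j \<Longrightarrow> a j \<le> f y"
  shows "(\<Sum>j\<in>J. a j * prob (U j)) \<le> expectation f"
proof -
  have "(\<Sum>j\<in>J. a j * indicator (U j) y) \<le> f y" for y
  proof (cases "\<exists>i\<in>J. y \<in> U i")
    case True
    then obtain i where "i \<in> J" "y \<in> U i" by auto
    then show ?thesis using sum_indicator_disjoint_family[OF J(1,2), of i y a] f(3) by simp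
  next
    case False
    then have "(\<Sum>j\<in>J. a j * indicator (U j) y) = 0" by (intro sum.neutral) auto
    then show ?thesis using f(2)[of y] by simp
  qed
  then have "(\<integral>y. (\<Sum>j\<in>J. a j * indicator (U j) y) \<partial>M) \<le> expectation f"
    using J f by (intro integral_mono integral_sum_indicator) auto
  then show ?thesis by (simp only: integral_sum_indicator(2)[OF J(3)])
qed

lemma expectation_le_sum_cells:
  fixes b :: "'i \<Rightarrow> real"
  assumes J: "finite J" "disjoint_family_on U J" "\<And>j. j \<in> J \<Longrightarrow> U j \<in> events"
    and f: "integrable M f" "\<And>j y. j \<in> J \<Longrightarrow> y \<in> U j \<Longrightarrow> f y \<le> b j"
    and AE: "AE y in M. y \<in> (\<Union>j\<in>J. U j)"
  shows "expectation f \<le> (\<Sum>j\<in>J. b j * prob (U j))"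
proof -
  have "AE y in M. f y \<le> (\<Sum>j\<in>J. b j * indicator (U j) y)"
    using AE
  proof eventually_elim
    fix y assume "y \<in> (\<Union>j\<in>J. U j)"
    then obtain i where "i \<in> J" "y \<in> U i" by auto
    then show "f y \<le> (\<Sum>j\<in>J. b j * indicator (U j) y)"
      using sum_indicator_disjoint_family[OF J(1,2), of i y b] f(2) by simp
  qed
  then have "expectation f \<le> (\<integral>y. (\<Sum>j\<in>J. b j * indicator (U j) y) \<partial>M)"
    using J f by (intro integral_mono_AE integral_sum_indicator) auto
  then show ?thesis by (simp only: integral_sum_indicator(2)[OF J(3)])
qed

end

section \<open>Moment matching for the Gaussian kernel\<close>

lemma sum_poly_eq_of_moments:
  fixes w v z :: "'i \<Rightarrow> real"
  assumes "\<And>i. i < q \<Longrightarrow> (\<Sum>j\<in>J. w j * z j ^ i) = (\<Sum>j\<in>J. v j * z j ^ i)" "degree p < q"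
  shows "(\<Sum>j\<in>J. w j * poly p (z j)) = (\<Sum>j\<in>J. v j * poly p (z j))"
proof -
  have "(\<Sum>j\<in>J. w j * poly p (z j)) = (\<Sum>i\<le>degree p. coeff p i * (\<Sum>j\<in>J. w j * z j ^ i))" for w
  proof -
    have "(\<Sum>j\<in>J. w j * poly p (z j)) = (\<Sum>j\<in>J. \<Sum>i\<le>degree p. coeff p i * (w j * z j ^ i))"
      by (simp add: poly_altdef sum_distrib_left mult_ac)
    also have "\<dots> = (\<Sum>i\<le>degree p. \<Sum>j\<in>J. coeff p i * (w j * z j ^ i))" by (rule sum.swap)
    finally show ?thesis by (simp add: sum_distrib_left)
  qed
  then show ?thesis using assms by (auto intro!: sum.cong)
qed

text \<open>The Taylor polynomial of \<open>exp\<close> is composed with the quadratic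
  \<open>- (x - y)\<^sup>2 / s\<close>, which makes it a polynomial in the location
  \<open>y\<close>, seen by a mixture only through moments. The remainder is taken in Lagrange form,
  with intermediate point of modulus at most \<open>u\<close>.\<close>

lemma exp_minus_poly_approx:
  fixes x s u :: real and N :: nat
  assumes "(x - y)\<^sup>2 / s \<le> u" "0 < s"
  defines "p \<equiv> (\<Sum>i<N. smult (1 / fact i) ([:- x\<^sup>2 / s, 2 * x / s, - 1 / s:] ^ i))"
  shows "\<bar>exp (- (x - y)\<^sup>2 / s) - poly p y\<bar> \<le> exp u * u ^ N / fact N"
proof -
  let ?t = "- (x - y)\<^sup>2 / s"
  have "poly [:- x\<^sup>2 / s, 2 * x / s, - 1 / s:] y = ?t"
    using assms by (simp add: field_simps power2_eq_square)
  then have p: "poly p y = (\<Sum>i<N. ?t ^ i / fact i)"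
    by (simp add: p_def poly_sum poly_power)
  obtain t where t: "\<bar>t\<bar> \<le> \<bar>?t\<bar>" "exp ?t = (\<Sum>i<N. ?t ^ i / fact i) + exp t / fact N * ?t ^ N"
    using Maclaurin_exp_le[of ?t N] by auto
  have abs: "\<bar>?t\<bar> \<le> u" using assms by (simp add: abs_div)
  then have "exp t \<le> exp u" using t(1) by simp
  moreover have "\<bar>?t ^ N\<bar> \<le> u ^ N" unfolding power_abs by (intro power_mono abs) simp
  ultimately have "exp t * \<bar>?t ^ N\<bar> \<le> exp u * u ^ N" by (intro mult_mono) auto
  then have "\<bar>exp t / fact N * ?t ^ N\<bar> \<le> exp u * u ^ N / fact N"
    by (simp add: abs_mult divide_right_mono)
  then show ?thesis using t(2) p by simp
qed

lemma degree_exp_minus_poly: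
  "degree (\<Sum>i<N. smult (1 / fact i) ([:a, b, c:] ^ i) :: real poly) \<le> 2 * N"
proof (intro degree_sum_le)
  fix i assume "i \<in> {..<N}"
  have "degree (smult (1 / fact i) ([:a, b, c:] ^ i)) \<le> degree ([:a, b, c:] ^ i)"
    by (rule degree_smult_le)
  also have "\<dots> \<le> degree [:a, b, c:] * i" by (rule degree_power_le)
  also have "\<dots> \<le> 2 * i" by (intro mult_right_mono) auto
  also have "\<dots> \<le> 2 * N" using \<open>i \<in> {..<N}\<close> by simp
  finally show "degree (smult (1 / fact i) ([:a, b, c:] ^ i)) \<le> 2 * N" .
qed simp

text \<open>Two weight families with equal moments agree on the Taylor polynomial, and each pays the
  remainder \<open>\<tau>\<close> once. Every kernel value is at least \<open>exp (- u)\<close>, so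
  this absolute error becomes a relative one at the price of a second factor \<open>exp u\<close>;
  hence \<open>exp (2 * u)\<close>.\<close>

lemma normal_sum_of_moments:
  fixes w v z :: "'i \<Rightarrow> real"
  assumes J: "finite J" and z: "\<And>j. j \<in> J \<Longrightarrow> \<bar>z j\<bar> \<le> k" and x: "\<bar>x\<bar> \<le> R" and s: "0 < s"
    and w: "\<And>j. j \<in> J \<Longrightarrow> 0 \<le> w j" and v: "\<And>j. j \<in> J \<Longrightarrow> 0 \<le> v j" "(\<Sum>j\<in>J. v j) = 1"
    and moments: "\<And>i. i < 2 * N + 1 \<Longrightarrow> (\<Sum>j\<in>J. w j * z j ^ i) = (\<Sum>j\<in>J. v j * z j ^ i)"
  defines "u \<equiv> (R + k)\<^sup>2 / s"
  shows "(1 - 2 * exp (2 * u) * u ^ N / fact N) * (\<Sum>j\<in>J. v j * exp (- (x - z j)\<^sup>2 / s)) \<le>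
    (\<Sum>j\<in>J. w j * exp (- (x - z j)\<^sup>2 / s))"
proof -
  let ?E = "\<lambda>j. exp (- (x - z j)\<^sup>2 / s)"
  define p where "p = (\<Sum>i<N. smult (1 / fact i) ([:- x\<^sup>2 / s, 2 * x / s, - 1 / s:] ^ i))"
  define \<tau> where "\<tau> = exp u * u ^ N / fact N"
  have u: "(x - z j)\<^sup>2 / s \<le> u" if "j \<in> J" for j
  proof -
    have "\<bar>x - z j\<bar> \<le> R + k" using z[OF that] x by linarith
    then have "(x - z j)\<^sup>2 \<le> (R + k)\<^sup>2" using power_mono[of "\<bar>x - z j\<bar>" "R + k" 2] by simp
    then show ?thesis using s by (simp add: u_def divide_right_mono)
  qed
  have approx: "\<bar>?E j - poly p (z j)\<bar> \<le> \<tau>" if "j \<in> J" for j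
    unfolding p_def \<tau>_def by (rule exp_minus_poly_approx[OF u[OF that] s])
  then have le: "?E j - \<tau> \<le> poly p (z j)" "poly p (z j) \<le> ?E j + \<tau>" if "j \<in> J" for j
    using that by (simp_all add: abs_le_iff) (force simp: algebra_simps)+
  have w_sum: "(\<Sum>j\<in>J. w j) = 1" using moments[of 0] v by simp
  have eq: "(\<Sum>j\<in>J. w j * poly p (z j)) = (\<Sum>j\<in>J. v j * poly p (z j))"
    using degree_exp_minus_poly[of "- x\<^sup>2 / s" "2 * x / s" "- 1 / s" N]
    by (intro sum_poly_eq_of_moments[OF moments]) (auto simp: p_def)
  have "(\<Sum>j\<in>J. v j * ?E j) - \<tau> = (\<Sum>j\<in>J. v j * (?E j - \<tau>))"
    using v by (simp add: right_diff_distrib sum_subtractf flip: sum_distrib_right)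
  also have "\<dots> \<le> (\<Sum>j\<in>J. v j * poly p (z j))"
    using le v by (intro sum_mono mult_left_mono) auto
  finally have 1: "(\<Sum>j\<in>J. v j * ?E j) - \<tau> \<le> (\<Sum>j\<in>J. v j * poly p (z j))" .
  have "(\<Sum>j\<in>J. w j * poly p (z j)) \<le> (\<Sum>j\<in>J. w j * (?E j + \<tau>))"
    using le w by (intro sum_mono mult_left_mono) auto
  also have "\<dots> = (\<Sum>j\<in>J. w j * ?E j) + \<tau>"
    using w_sum by (simp add: distrib_left sum.distrib flip: sum_distrib_right)
  finally have 2: "(\<Sum>j\<in>J. v j * ?E j) - 2 * \<tau> \<le> (\<Sum>j\<in>J. w j * ?E j)"
    using 1 eq by simp
  have "exp (- u) = (\<Sum>j\<in>J. v j * exp (- u))" using v by (simp add: sum_distrib_right[symmetric])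
  also have "\<dots> \<le> (\<Sum>j\<in>J. v j * ?E j)"
    using u v by (intro sum_mono mult_left_mono) auto
  finally have "1 \<le> exp u * (\<Sum>j\<in>J. v j * ?E j)"
    by (simp add: exp_minus field_simps)
  moreover have "0 \<le> u" using s by (simp add: u_def)
  ultimately have "2 * \<tau> * 1 \<le> 2 * \<tau> * (exp u * (\<Sum>j\<in>J. v j * ?E j))"
    by (intro mult_left_mono) (auto simp: \<tau>_def)
  also have "\<dots> = 2 * exp (2 * u) * u ^ N / fact N * (\<Sum>j\<in>J. v j * ?E j)"
    by (simp add: \<tau>_def exp_double power2_eq_square)
  finally show ?thesis using 2 by (simp add: left_diff_distrib)
qed

text \<open>Widening brings the exponent closer to 0, so the loss is confined to the prefactor and
  is uniform in \<open>x\<close>. Narrowing would lose without bound in the tails.\<close>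

lemma normal_density_scale_mono:
  assumes "0 < \<sigma>\<^sub>0" "\<sigma>\<^sub>0 \<le> \<sigma>"
  shows "\<sigma>\<^sub>0 / \<sigma> * normal_density y \<sigma>\<^sub>0 x \<le> normal_density y \<sigma> x"
proof -
  have nd: "normal_density y s x = 1 / s * (1 / sqrt (2 * pi)) * exp (- (x - y)\<^sup>2 / (2 * s\<^sup>2))" if "0 < s" for s
    using that by (simp add: normal_density_def real_sqrt_mult)
  have "(x - y)\<^sup>2 / (2 * \<sigma>\<^sup>2) \<le> (x - y)\<^sup>2 / (2 * \<sigma>\<^sub>0\<^sup>2)"
    using assms by (intro divide_left_mono) (auto intro!: power_mono mult_pos_pos)
  then have "exp (- (x - y)\<^sup>2 / (2 * \<sigma>\<^sub>0\<^sup>2)) \<le> exp (- (x - y)\<^sup>2 / (2 * \<sigma>\<^sup>2))" by simp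
  then have "1 / \<sigma> * (1 / sqrt (2 * pi)) * exp (- (x - y)\<^sup>2 / (2 * \<sigma>\<^sub>0\<^sup>2)) \<le>
      1 / \<sigma> * (1 / sqrt (2 * pi)) * exp (- (x - y)\<^sup>2 / (2 * \<sigma>\<^sup>2))"
    using assms by (intro mult_left_mono) auto
  then show ?thesis using assms by (simp add: nd)
qed

text \<open>The difference of the two squares factors into the shift and a term linear in
  \<open>x\<close>, so on a window of logarithmic size a fine grid changes the density by a factor
  close to one.\<close>

lemma normal_density_location_le:
  assumes "0 < \<sigma>" "\<bar>y\<bar> \<le> k" "\<bar>z\<bar> \<le> k" "\<bar>y - z\<bar> \<le> h" "\<bar>x\<bar> \<le> R"
  shows "exp (- (h * (R + k) / \<sigma>\<^sup>2)) * normal_density z \<sigma> x \<le> normal_density y \<sigma> x"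
proof -
  have "(x - y)\<^sup>2 - (x - z)\<^sup>2 = (z - y) * (2 * x - y - z)"
    by (simp add: power2_eq_square algebra_simps)
  also have "\<dots> \<le> \<bar>y - z\<bar> * \<bar>2 * x - y - z\<bar>"
    by (metis abs_ge_self abs_minus_commute abs_mult)
  also have "\<dots> \<le> h * (2 * (R + k))" using assms by (intro mult_mono) auto
  finally have "(x - y)\<^sup>2 \<le> (x - z)\<^sup>2 + 2 * (h * (R + k))" by (simp add: algebra_simps)
  then have "(x - y)\<^sup>2 / (2 * \<sigma>\<^sup>2) \<le> ((x - z)\<^sup>2 + 2 * (h * (R + k))) / (2 * \<sigma>\<^sup>2)"
    by (rule divide_right_mono) simp
  then have "- (h * (R + k) / \<sigma>\<^sup>2) + - (x - z)\<^sup>2 / (2 * \<sigma>\<^sup>2) \<le> - (x - y)\<^sup>2 / (2 * \<sigma>\<^sup>2)"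
    by (simp add: add_divide_distrib)
  then have "exp (- (h * (R + k) / \<sigma>\<^sup>2)) * exp (- (x - z)\<^sup>2 / (2 * \<sigma>\<^sup>2)) \<le> exp (- (x - y)\<^sup>2 / (2 * \<sigma>\<^sup>2))"
    unfolding exp_add[symmetric] by simp
  then have "1 / sqrt (2 * pi * \<sigma>\<^sup>2) * (exp (- (h * (R + k) / \<sigma>\<^sup>2)) * exp (- (x - z)\<^sup>2 / (2 * \<sigma>\<^sup>2))) \<le>
      1 / sqrt (2 * pi * \<sigma>\<^sup>2) * exp (- (x - y)\<^sup>2 / (2 * \<sigma>\<^sup>2))"
    by (rule mult_left_mono) simp
  then show ?thesis unfolding normal_density_def by (simp only: mult_ac)
qed

text \<open>Four comparisons are chained, each with its own factor: scale \<open>\<sigma>\<close>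
  against \<open>\<sigma>\<^sub>0\<close>; \<open>F\<close> against atoms at \<open>z j\<close> of
  weight \<open>w j / t\<close>; the weights \<open>w\<close> against the cell masses of
  \<open>F\<^sub>0\<close>, by equality of moments; and the atoms with these masses against
  \<open>F\<^sub>0\<close> itself. Passing between a cell and its point happens twice, which is the
  2 in the exponent.\<close>

lemma normal_mixture_ge_of_cells:
  fixes U :: "nat \<Rightarrow> real set"
  assumes F: "prob_space F" "sets F = sets borel" and F0: "prob_space F\<^sub>0" "sets F\<^sub>0 = sets borel"
    and \<sigma>: "0 < \<sigma>\<^sub>0" "\<sigma>\<^sub>0 \<le> \<sigma>" and I: "finite I"
    and U: "\<And>j. j \<in> I \<Longrightarrow> U j \<in> sets borel" "disjoint_family_on U I"
    and z: "\<And>j. j \<in> I \<Longrightarrow> \<bar>z j\<bar> \<le> k" "\<And>j y. j \<in> I \<Longrightarrow> y \<in> U j \<Longrightarrow> \<bar>y\<bar> \<le> k \<and> \<bar>y - z j\<bar> \<le> h"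
    and AE: "AE y in F\<^sub>0. y \<in> (\<Union>j\<in>I. U j)"
    and w: "\<And>j. j \<in> I \<Longrightarrow> 0 \<le> w j" and t: "0 < t"
    and moments: "\<And>i. i < 2 * N + 1 \<Longrightarrow>
      (\<Sum>j\<in>I. w j * z j ^ i) = (\<Sum>j\<in>I. measure F\<^sub>0 (U j) * z j ^ i)"
    and mass: "\<And>j. j \<in> I \<Longrightarrow> w j \<noteq> 0 \<Longrightarrow> w j / t \<le> measure F (U j)"
    and x: "\<bar>x\<bar> \<le> R"
  defines "u \<equiv> (R + k)\<^sup>2 / (2 * \<sigma>\<^sub>0\<^sup>2)"
  assumes small: "2 * exp (2 * u) * u ^ N / fact N \<le> 1"
  shows "\<sigma>\<^sub>0 / \<sigma> * (1 / t) * exp (- (2 * (h * (R + k) / \<sigma>\<^sub>0\<^sup>2))) * (1 - 2 * exp (2 * u) * u ^ N / fact N) *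
    normal_mixture F\<^sub>0 \<sigma>\<^sub>0 x \<le> normal_mixture F \<sigma> x"
proof -
  interpret F: prob_space F by fact
  interpret F0: prob_space F\<^sub>0 by fact
  let ?\<kappa> = "h * (R + k) / \<sigma>\<^sub>0\<^sup>2"
  let ?\<rho> = "1 - 2 * exp (2 * u) * u ^ N / fact N"
  let ?q = "\<lambda>y. normal_density y \<sigma>\<^sub>0 x"
  let ?v = "\<lambda>j. measure F\<^sub>0 (U j)"
  have \<sigma>': "0 < \<sigma>" using \<sigma> by simp
  have v1: "(\<Sum>j\<in>I. ?v j) = 1"
  proof -
    have "(\<Sum>j\<in>I. ?v j) = measure F\<^sub>0 (\<Union>j\<in>I. U j)"
      using I U F0(2) by (intro F0.finite_measure_finite_Union[symmetric]) auto
    also have "\<dots> = 1"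
      using AE U I F0(2) by (subst F0.prob_eq_1) auto
    finally show ?thesis .
  qed
  have near: "exp (- ?\<kappa>) * ?q (z j) \<le> ?q y" "exp (- ?\<kappa>) * ?q y \<le> ?q (z j)" if "j \<in> I" "y \<in> U j" for j y
    using z(1)[OF that(1)] z(2)[OF that] x \<sigma>(1)
    by (auto intro!: normal_density_location_le[where k=k] simp: abs_minus_commute)
  have m1: "\<sigma>\<^sub>0 / \<sigma> * normal_mixture F \<sigma>\<^sub>0 x \<le> normal_mixture F \<sigma> x"
    using integrable_normal_density_location[OF F \<sigma>(1), of x] integrable_normal_density_location[OF F \<sigma>', of x]
      normal_density_scale_mono[OF \<sigma>]
    unfolding normal_mixture_eq[OF \<sigma>(1)] normal_mixture_eq[OF \<sigma>'] integral_mult_right_zero[symmetric]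
    by (intro integral_mono) auto
  have "(\<Sum>j\<in>I. exp (- ?\<kappa>) * ?q (z j) * (w j / t)) \<le> (\<Sum>j\<in>I. exp (- ?\<kappa>) * ?q (z j) * measure F (U j))"
    using mass by (intro sum_mono mult_left_mono) (case_tac "w j = 0", auto)
  also have "\<dots> \<le> F.expectation ?q"
    using I U F(2) near integrable_normal_density_location[OF F \<sigma>(1), of x]
    by (intro F.sum_cells_le_expectation) auto
  also have "(\<Sum>j\<in>I. exp (- ?\<kappa>) * ?q (z j) * (w j / t)) = exp (- ?\<kappa>) / t * (\<Sum>j\<in>I. w j * ?q (z j))"
    by (simp only: sum_distrib_left) (simp add: mult_ac)
  finally have m2: "exp (- ?\<kappa>) / t * (\<Sum>j\<in>I. w j * ?q (z j)) \<le> normal_mixture F \<sigma>\<^sub>0 x"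
    by (simp only: normal_mixture_eq[OF \<sigma>(1)])
  have "?\<rho> * (\<Sum>j\<in>I. ?v j * exp (- (x - z j)\<^sup>2 / (2 * \<sigma>\<^sub>0\<^sup>2))) \<le> (\<Sum>j\<in>I. w j * exp (- (x - z j)\<^sup>2 / (2 * \<sigma>\<^sub>0\<^sup>2)))"
    unfolding u_def
    by (rule normal_sum_of_moments[OF I z(1) x _ w _ v1 moments]) (use \<sigma> in auto)
  then have "1 / sqrt (2 * pi * \<sigma>\<^sub>0\<^sup>2) * (?\<rho> * (\<Sum>j\<in>I. ?v j * exp (- (x - z j)\<^sup>2 / (2 * \<sigma>\<^sub>0\<^sup>2)))) \<le>
      1 / sqrt (2 * pi * \<sigma>\<^sub>0\<^sup>2) * (\<Sum>j\<in>I. w j * exp (- (x - z j)\<^sup>2 / (2 * \<sigma>\<^sub>0\<^sup>2)))"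
    by (rule mult_left_mono) simp
  then have m3: "?\<rho> * (\<Sum>j\<in>I. ?v j * ?q (z j)) \<le> (\<Sum>j\<in>I. w j * ?q (z j))"
    unfolding normal_density_def by (simp only: sum_distrib_left mult_ac)
  have "F0.expectation (\<lambda>y. exp (- ?\<kappa>) * ?q y) \<le> (\<Sum>j\<in>I. ?q (z j) * ?v j)"
    using I U F0(2) near integrable_normal_density_location[OF F0 \<sigma>(1), of x] AE
    by (intro F0.expectation_le_sum_cells) auto
  then have m4: "exp (- ?\<kappa>) * normal_mixture F\<^sub>0 \<sigma>\<^sub>0 x \<le> (\<Sum>j\<in>I. ?v j * ?q (z j))"
    by (simp add: normal_mixture_eq[OF \<sigma>(1)] mult_ac)
  have "?\<rho> * (exp (- ?\<kappa>) * normal_mixture F\<^sub>0 \<sigma>\<^sub>0 x) \<le> (\<Sum>j\<in>I. w j * ?q (z j))"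
    using mult_left_mono[OF m4, of ?\<rho>] small m3 by simp
  then have "exp (- ?\<kappa>) / t * (?\<rho> * (exp (- ?\<kappa>) * normal_mixture F\<^sub>0 \<sigma>\<^sub>0 x)) \<le> normal_mixture F \<sigma>\<^sub>0 x"
    using t by (intro order_trans[OF _ m2] mult_left_mono) auto
  then have "\<sigma>\<^sub>0 / \<sigma> * (exp (- ?\<kappa>) / t * (?\<rho> * (exp (- ?\<kappa>) * normal_mixture F\<^sub>0 \<sigma>\<^sub>0 x))) \<le> normal_mixture F \<sigma> x"
    using \<sigma> by (intro order_trans[OF _ m1] mult_left_mono) auto
  moreover have "exp (- (2 * ?\<kappa>)) = exp (- ?\<kappa>) * exp (- ?\<kappa>)"
    unfolding exp_add[symmetric] by simp
  ultimately show ?thesis by (simp only: mult_ac times_divide_eq_right times_divide_eq_left mult_1_left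
        divide_divide_eq_left)
qed

section \<open>Prior mass\<close>

lemma power_div_fact_le_exp:
  fixes v :: real
  assumes "0 \<le> v"
  shows "v ^ N / fact N \<le> exp v"
proof -
  have "(\<lambda>n. v ^ n /\<^sub>R fact n) sums exp v" by (rule exp_converges)
  then have s: "summable (\<lambda>n. v ^ n /\<^sub>R fact n)" "exp v = (\<Sum>n. v ^ n /\<^sub>R fact n)"
    by (auto simp: sums_iff)
  have "(\<Sum>n\<in>{N}. v ^ n /\<^sub>R fact n) \<le> (\<Sum>n. v ^ n /\<^sub>R fact n)"
    using assms s by (intro sum_le_suminf) auto
  then show ?thesis using s by (simp add: divide_inverse mult.commute)
qed

text \<open>The point \<open>z j\<close> is the left end of its cell. The open interval of full
  width inside each cell is what later gives the cell its base mass.\<close>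

lemma grid_cells:
  fixes k :: real
  assumes k: "0 < k" and m: "0 < m"
  obtains U :: "nat \<Rightarrow> real set" and z :: "nat \<Rightarrow> real" where
    "\<And>j. U j \<in> sets borel" "disjoint_family U" "(\<Union>j<m. U j) = {- k..k}"
    "\<And>j. j < m \<Longrightarrow> \<bar>z j\<bar> \<le> k"
    "\<And>j y. j < m \<Longrightarrow> y \<in> U j \<Longrightarrow> \<bar>y\<bar> \<le> k \<and> \<bar>y - z j\<bar> \<le> 2 * k / m"
    "\<And>j. j < m \<Longrightarrow> \<exists>a b. - k \<le> a \<and> a \<le> b \<and> b \<le> k \<and> b - a = 2 * k / m \<and> {a<..<b} \<subseteq> U j"
proof -
  define h where "h = 2 * k / m"
  have h: "0 < h" "m * h = 2 * k" using k m by (auto simp: h_def)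
  \<comment> \<open>The minimum puts the right end \<open>k\<close>, whose floor would be
    \<open>m\<close>, into the last cell.\<close>
  define c where "c y = min (nat \<lfloor>(y + k) / h\<rfloor>) (m - 1)" for y
  define U where "U j = {y \<in> {- k..k}. c y = j}" for j
  define z where "z j = - k + j * h" for j :: nat
  have zb: "- k \<le> z j" "z j + h \<le> k" if "j < m" for j
  proof -
    have "real (Suc j) * h \<le> real m * h" using that h by (intro mult_right_mono) auto
    then show "- k \<le> z j" "z j + h \<le> k" using h by (auto simp: z_def algebra_simps)
  qed
  have near: "0 \<le> y - z j \<and> y - z j \<le> h" if "j < m" "y \<in> U j" for j y
  proof -
    have y: "- k \<le> y" "y \<le> k" "c y = j" using that by (auto simp: U_def)
    let ?q = "(y + k) / h"
    have q0: "0 \<le> ?q" using y h by simp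
    have fl: "real (nat \<lfloor>?q\<rfloor>) \<le> ?q" "?q < real (nat \<lfloor>?q\<rfloor>) + 1"
      using q0 by (auto simp: of_nat_nat)
    have "real j \<le> ?q" using y fl by (auto simp: c_def)
    then have 1: "0 \<le> y - z j" using h by (simp add: z_def field_simps)
    have "?q \<le> real j + 1"
    proof (cases "nat \<lfloor>?q\<rfloor> \<le> m - 1")
      case True
      then show ?thesis using y fl by (simp add: c_def)
    next
      case False
      then have "real j + 1 = m" using y m by (simp add: c_def)
      moreover have "?q \<le> m" using y h by (simp add: field_simps)
      ultimately show ?thesis by simp
    qed
    then have "y - z j \<le> h" using h by (simp add: z_def field_simps)
    with 1 show ?thesis by simp
  qed
  show thesis
  proof (rule that[of U z])
    show "U j \<in> sets borel" for j
    proof -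
      have "Measurable.pred borel (\<lambda>y. c y = j)" unfolding c_def by measurable
      then show ?thesis unfolding U_def by measurable
    qed
    show "disjoint_family U" by (auto simp: disjoint_family_on_def U_def)
    show "(\<Union>j<m. U j) = {- k..k}"
    proof -
      have "c y < m" for y using m by (auto simp: c_def min_def)
      then show ?thesis by (auto simp: U_def)
    qed
    fix j assume j: "j < m"
    show "\<bar>z j\<bar> \<le> k" using zb[OF j] h by linarith
    show "\<exists>a b. - k \<le> a \<and> a \<le> b \<and> b \<le> k \<and> b - a = 2 * k / m \<and> {a<..<b} \<subseteq> U j"
    proof (intro exI conjI subsetI)
      show "- k \<le> z j" "z j + h \<le> k" "z j \<le> z j + h" "z j + h - z j = 2 * k / m"
        using zb[OF j] h by (auto simp: h_def)
      fix y assume y: "y \<in> {z j<..<z j + h}"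
      then have "real j < (y + k) / h" "(y + k) / h < real j + 1"
        using h by (auto simp: z_def field_simps)
      then have "\<lfloor>(y + k) / h\<rfloor> = int j" by (simp add: floor_eq_iff)
      then show "y \<in> U j" using y zb[OF j] j by (auto simp: U_def c_def)
    qed
    fix y assume "y \<in> U j"
    then show "\<bar>y\<bar> \<le> k \<and> \<bar>y - z j\<bar> \<le> 2 * k / m"
      using near[OF j] unfolding h_def[symmetric] by (auto simp: U_def)
  qed
qed

text \<open>Only cells of nonzero weight are asked to carry mass, and elimination leaves at most
  \<open>2 * N + 1\<close> of them. Since \<open>m\<close> is larger, some cell has weight 0, and
  this cell gives the complement of the chosen ones the base mass that the completed partition
  requires.\<close>

lemma dirichlet_mixture_prior_mass:
  fixes \<delta> k c C B R \<sigma>\<^sub>0 :: real and m N :: nat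
  assumes D: "is_dirichlet_process \<alpha> D" and \<alpha>: "finite_measure \<alpha>" "sets \<alpha> = sets borel"
    and F0: "prob_space F\<^sub>0" "sets F\<^sub>0 = sets borel" "AE y in F\<^sub>0. \<bar>y\<bar> \<le> k"
    and k: "0 < k" and c: "0 < c"
    and dens: "\<And>a b. - k \<le> a \<Longrightarrow> a \<le> b \<Longrightarrow> b \<le> k \<Longrightarrow> c * (b - a) \<le> measure \<alpha> {a<..<b}"
    and C: "0 < C" "\<And>a. 0 \<le> a \<Longrightarrow> a \<le> measure \<alpha> UNIV \<Longrightarrow> Gamma (a + 1) \<le> C"
    and m: "2 * N + 1 < m" and \<delta>: "0 < \<delta>" "\<delta> \<le> 1" and \<sigma>\<^sub>0: "0 < \<sigma>\<^sub>0"
    and B: "0 \<le> B" "B \<le> 1"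
      "B \<le> c * (2 * k / m) / (2 * exp 2 * C) * (\<delta> / 2) powr (measure \<alpha> UNIV + 1)"
  defines "u \<equiv> (R + k)\<^sup>2 / (2 * \<sigma>\<^sub>0\<^sup>2)"
  assumes small: "2 * exp (2 * u) * u ^ N / fact N \<le> 1"
  shows "\<exists>E\<in>sets D. ennreal (B ^ (2 * N + 2)) \<le> emeasure D E \<and>
    (\<forall>F\<in>E. \<forall>\<sigma> x. \<sigma>\<^sub>0 \<le> \<sigma> \<longrightarrow> \<bar>x\<bar> \<le> R \<longrightarrow>
      \<sigma>\<^sub>0 / \<sigma> * (1 / (1 + (2 * N + 2) * \<delta>)) * exp (- (2 * (2 * k / m * (R + k) / \<sigma>\<^sub>0\<^sup>2))) *
        (1 - 2 * exp (2 * u) * u ^ N / fact N) * normal_mixture F\<^sub>0 \<sigma>\<^sub>0 x \<le> normal_mixture F \<sigma> x)"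
proof -
  interpret \<alpha>: finite_measure \<alpha> by fact
  have "0 < m" using m by simp
  then obtain U :: "nat \<Rightarrow> real set" and z :: "nat \<Rightarrow> real" where U: "\<And>j. U j \<in> sets borel" "disjoint_family U"
    and cover: "(\<Union>j<m. U j) = {- k..k}" and z: "\<And>j. j < m \<Longrightarrow> \<bar>z j\<bar> \<le> k"
    and near: "\<And>j y. j < m \<Longrightarrow> y \<in> U j \<Longrightarrow> \<bar>y\<bar> \<le> k \<and> \<bar>y - z j\<bar> \<le> 2 * k / m"
    and inner: "\<And>j. j < m \<Longrightarrow> \<exists>a b. - k \<le> a \<and> a \<le> b \<and> b \<le> k \<and> b - a = 2 * k / m \<and> {a<..<b} \<subseteq> U j"
    using grid_cells[OF k, of m] by metis
  define a\<^sub>0 where "a\<^sub>0 = c * (2 * k / m)"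
  have a\<^sub>0: "0 < a\<^sub>0" using c k \<open>0 < m\<close> by (simp add: a\<^sub>0_def)
  have \<alpha>U: "a\<^sub>0 \<le> measure \<alpha> (U j)" if "j < m" for j
  proof -
    obtain a b where ab: "- k \<le> a" "a \<le> b" "b \<le> k" "b - a = 2 * k / m" "{a<..<b} \<subseteq> U j"
      using inner[OF \<open>j < m\<close>] by blast
    have "a\<^sub>0 \<le> measure \<alpha> {a<..<b}" using dens[OF ab(1-3)] ab(4) by (simp add: a\<^sub>0_def)
    also have "\<dots> \<le> measure \<alpha> (U j)" using ab U \<alpha>(2) by (intro \<alpha>.finite_measure_mono) auto
    finally show ?thesis .
  qed
  have "\<exists>w'. (\<forall>j\<in>{..<m}. 0 \<le> w' j) \<and> card {j\<in>{..<m}. w' j \<noteq> 0} \<le> 2 * N + 1 \<and>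
    (\<forall>i<2 * N + 1. (\<Sum>j<m. w' j * z j ^ i) = (\<Sum>j<m. measure F\<^sub>0 (U j) * z j ^ i))"
    by (rule conic_caratheodory) auto
  then obtain w where w: "\<And>j. j < m \<Longrightarrow> 0 \<le> w j" and card: "card {j\<in>{..<m}. w j \<noteq> 0} \<le> 2 * N + 1"
    and moments: "\<And>i. i < 2 * N + 1 \<Longrightarrow> (\<Sum>j<m. w j * z j ^ i) = (\<Sum>j<m. measure F\<^sub>0 (U j) * z j ^ i)"
    by auto
  define J where "J = {j\<in>{..<m}. w j \<noteq> 0}"
  have J: "finite J" "J \<subseteq> {..<m}" "card J \<le> 2 * N + 1" using card by (auto simp: J_def)
  interpret F0: prob_space F\<^sub>0 by (rule F0)
  have AE: "AE y in F\<^sub>0. y \<in> (\<Union>j<m. U j)"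
    using F0(3) unfolding cover by eventually_elim auto
  have w_sum: "(\<Sum>j\<in>J. w j) = 1"
  proof -
    have "(\<Sum>j\<in>J. w j) = (\<Sum>j<m. w j)"
      unfolding J_def by (intro sum.mono_neutral_left) auto
    also have "\<dots> = (\<Sum>j<m. measure F\<^sub>0 (U j))" using moments[of 0] by simp
    also have "\<dots> = measure F\<^sub>0 (\<Union>j<m. U j)"
      using U F0(2) by (intro F0.finite_measure_finite_Union[symmetric])
        (auto simp: disjoint_family_on_def)
    also have "\<dots> = 1"
      using AE U F0(2) by (subst F0.prob_eq_1) auto
    finally show ?thesis .
  qed
  have rest: "a\<^sub>0 \<le> measure \<alpha> (- (\<Union>j\<in>J. U j))"
  proof -
    have "card J < card {..<m}" using J m by simp
    then obtain i where i: "i < m" "i \<notin> J" using J(2) by (metis card_mono finite_lessThan lessThan_iff not_le subsetI J(1))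
    have "a\<^sub>0 \<le> measure \<alpha> (U i)" using \<alpha>U[OF i(1)] .
    also have "\<dots> \<le> measure \<alpha> (- (\<Union>j\<in>J. U j))"
    proof (rule \<alpha>.finite_measure_mono)
      show "U i \<subseteq> - (\<Union>j\<in>J. U j)"
      proof -
        have "U i \<inter> U j = {}" if "j \<in> J" for j
          using disjoint_family_onD[OF U(2), of i j] i(2) that by auto
        then show ?thesis by blast
      qed
      have "(\<Union>j\<in>J. U j) \<in> sets borel" using U(1) J(1) by auto
      then show "- (\<Union>j\<in>J. U j) \<in> sets \<alpha>" unfolding \<alpha>(2) by (rule borel_comp)
    qed
    finally show ?thesis .
  qed
  let ?t = "1 + real (Suc (card J)) * \<delta>"
  define E where "E = {F \<in> space D. \<forall>j\<in>J. w j / ?t \<le> measure F (U j)}"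
  have setsD: "sets D = sets (prob_algebra borel)" using D by (simp add: is_dirichlet_process_def)
  have E: "E \<in> sets D"
    unfolding E_def using measurable_measure_prob_algebra[OF setsD U(1)] J(1)
    by (intro sets.sets_Collect_finite_All) auto
  \<comment> \<open>Since \<open>B \<le> 1\<close>, the exponent may be raised to its largest
    possible value: \<open>2 * N + 1\<close> cells and their complement.\<close>
  have "ennreal (B ^ (2 * N + 2)) \<le> ennreal (B ^ Suc (card J))"
    using B J by (intro ennreal_leI power_decreasing) auto
  also have "\<dots> \<le> ennreal ((a\<^sub>0 / (2 * exp 2 * C) * (\<delta> / 2) powr (measure \<alpha> UNIV + 1)) ^ Suc (card J))"
    using B by (intro ennreal_leI power_mono) (auto simp: a\<^sub>0_def)
  also have "\<dots> \<le> emeasure D E"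
    unfolding E_def
  proof (rule dirichlet_process_cells_ge[OF D \<alpha> J(1)])
    show "disjoint_family_on U J" using U(2) by (auto simp: disjoint_family_on_def)
    show "a\<^sub>0 \<le> measure \<alpha> (U j)" if "j \<in> J" for j using \<alpha>U J(2) that by auto
    show "0 \<le> w j" if "j \<in> J" for j using w J(2) that by auto
  qed (use U a\<^sub>0 rest C w_sum \<delta> in auto)
  finally have mass: "ennreal (B ^ (2 * N + 2)) \<le> emeasure D E" .
  have "\<sigma>\<^sub>0 / \<sigma> * (1 / (1 + (2 * N + 2) * \<delta>)) * exp (- (2 * (2 * k / m * (R + k) / \<sigma>\<^sub>0\<^sup>2))) *
        (1 - 2 * exp (2 * u) * u ^ N / fact N) * normal_mixture F\<^sub>0 \<sigma>\<^sub>0 x \<le> normal_mixture F \<sigma> x"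
    if FE: "F \<in> E" and \<sigma>: "\<sigma>\<^sub>0 \<le> \<sigma>" and x: "\<bar>x\<bar> \<le> R" for F \<sigma> x
    unfolding u_def
  proof (rule normal_mixture_ge_of_cells[where I="{..<m}" and U=U and z=z and w=w])
    have "F \<in> space (prob_algebra borel)" using FE sets_eq_imp_space_eq[OF setsD] by (auto simp: E_def)
    then show "prob_space F" "sets F = sets borel" by (auto simp: space_prob_algebra)
    show "disjoint_family_on U {..<m}" using U(2) by (auto simp: disjoint_family_on_def)
    show "0 < 1 + real (2 * N + 2) * \<delta>" using \<delta> by (simp add: add_pos_nonneg)
    show "w j / (1 + real (2 * N + 2) * \<delta>) \<le> measure F (U j)" if "j \<in> {..<m}" "w j \<noteq> 0" for j
    proof -
      have "real (Suc (card J)) * \<delta> \<le> real (2 * N + 2) * \<delta>"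
        using J(3) \<delta> by (intro mult_right_mono) auto
      then have "w j / (1 + real (2 * N + 2) * \<delta>) \<le> w j / ?t"
        using w[of j] that \<delta> by (intro divide_left_mono) (auto intro!: mult_pos_pos add_pos_nonneg)
      also have "\<dots> \<le> measure F (U j)" using FE that by (auto simp: E_def J_def)
      finally show ?thesis .
    qed
  qed (use F0 \<sigma>\<^sub>0 \<sigma> U z near AE w moments x small u_def in auto)
  with E mass show ?thesis by blast
qed

lemma eventually_dirichlet_mixture_prior_mass:
  fixes k c \<sigma>\<^sub>0 :: real
  assumes D: "is_dirichlet_process \<alpha> D" and \<alpha>: "finite_measure \<alpha>" "sets \<alpha> = sets borel"
    and F0: "prob_space F\<^sub>0" "sets F\<^sub>0 = sets borel" "AE y in F\<^sub>0. \<bar>y\<bar> \<le> k"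
    and k: "0 < k" and c: "0 < c" and \<sigma>\<^sub>0: "0 < \<sigma>\<^sub>0"
    and dens: "\<And>a b. - k \<le> a \<Longrightarrow> a \<le> b \<Longrightarrow> b \<le> k \<Longrightarrow> c * (b - a) \<le> measure \<alpha> {a<..<b}"
  shows "\<forall>\<^sub>F n in sequentially. \<exists>E\<in>sets D. ennreal (exp (- (ln n ^ 6 / 2))) \<le> emeasure D E \<and>
    (\<forall>F\<in>E. \<forall>\<sigma> x. \<sigma>\<^sub>0 \<le> \<sigma> \<longrightarrow> \<sigma> \<le> \<sigma>\<^sub>0 + \<sigma>\<^sub>0 / n \<longrightarrow> \<bar>x\<bar> \<le> 2 * ln n \<longrightarrow>
      exp (- 4 / n) * normal_mixture F\<^sub>0 \<sigma>\<^sub>0 x \<le> normal_mixture F \<sigma> x)"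
proof -
  obtain C where C: "0 < C" "\<And>a. 0 \<le> a \<Longrightarrow> a \<le> measure \<alpha> UNIV \<Longrightarrow> Gamma (a + 1) \<le> C"
    using Gamma_bounded_above by metis
  define A where "A = measure \<alpha> UNIV"
  have A: "0 \<le> A" by (simp add: A_def)
  \<comment> \<open>A base mass of order \<open>1 / n\<^sup>2\<close> and the power
    \<open>A + 1\<close> of \<open>\<delta>\<close>, itself at least \<open>1 / n\<^sup>2\<close>,
    make each gamma factor at least of order \<open>n powr - (2 * A + 4)\<close>; two further powers
    of \<open>n\<close> absorb the constant \<open>K\<close>.\<close>
  define b where "b = 2 * A + 6"
  define N where "N n = nat \<lceil>ln (real n) ^ 4\<rceil>" for n
  define u where "u n = (2 * ln (real n) + k)\<^sup>2 / (2 * \<sigma>\<^sub>0\<^sup>2)" for n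
  define K where "K = c * (2 * k) / (2 * exp 2 * C) * (1 / 2) powr (A + 1)"
  have K: "0 < K" using c k C by (simp add: K_def)
  have N: "ln (real n) ^ 4 \<le> N n" "N n \<le> ln (real n) ^ 4 + 1" for n
    unfolding N_def by (auto simp: of_nat_nat)
  have ev1: "\<forall>\<^sub>F n in sequentially. 2 * ln (real n) ^ 4 + 4 < real n" by real_asymp
  have ev2: "\<forall>\<^sub>F n in sequentially. 2 * exp (5 * u n - ln (real n) ^ 4) \<le> 1 / (2 * real n)"
    unfolding u_def using k \<sigma>\<^sub>0 by real_asymp
  have ev3: "\<forall>\<^sub>F n in sequentially. exp (- (b * ln (real n))) \<le> K * exp (- ((2 * A + 4) * ln (real n)))"
  proof -
    have "\<forall>\<^sub>F n in sequentially. exp (- (2 * ln (real n))) \<le> K" using K by real_asymp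
    then show ?thesis
    proof eventually_elim
      case (elim n)
      have "exp (- (b * ln (real n))) = exp (- (2 * ln (real n))) * exp (- ((2 * A + 4) * ln (real n)))"
        by (simp add: b_def mult_exp_exp algebra_simps)
      then show ?case using elim by (simp add: mult_right_mono)
    qed
  qed
  have ev4: "\<forall>\<^sub>F n in sequentially. 2 * (2 * k / (real n)\<^sup>2 * (2 * ln (real n) + k) / \<sigma>\<^sub>0\<^sup>2) \<le> 1 / real n"
    using k \<sigma>\<^sub>0 by real_asymp
  have ev5: "\<forall>\<^sub>F n in sequentially. b * ln (real n) * (2 * ln (real n) ^ 4 + 4) \<le> ln (real n) ^ 6 / 2"
    unfolding b_def using A by real_asymp
  have ev6: "\<forall>\<^sub>F n in sequentially. 1 < n" by (rule eventually_gt_at_top)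
  show ?thesis
    using ev1 ev2 ev3 ev4 ev5 ev6
  proof eventually_elim
    case (elim n)
    let ?L = "ln (real n)"
    have n: "1 < real n" "0 < ?L" using elim(6) by auto
    \<comment> \<open>This choice makes the normalisation loss
      \<open>1 + (2 * N n + 2) * \<delta>\<close> equal to \<open>1 + 1 / n\<close>.\<close>
    define \<delta> where "\<delta> = 1 / (real n * real (2 * N n + 2))"
    have N2: "real (2 * N n + 2) < real n" using N(2)[of n] elim(1) by simp
    have \<delta>: "0 < \<delta>" "\<delta> \<le> 1"
      using n by (auto simp: \<delta>_def divide_le_eq_1 intro!: mult_ge1_I)
    have m: "2 * N n + 1 < n\<^sup>2"
    proof -
      have "2 * N n + 1 < n" using N2 by (simp flip: of_nat_less_iff)
      also have "n \<le> n\<^sup>2" by (simp add: power2_eq_square)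
      finally show ?thesis .
    qed
    define B where "B = exp (- (b * ?L))"
    have b: "0 \<le> b" using A by (simp add: b_def)
    have B: "0 \<le> B" "B \<le> 1" using b n by (auto simp: B_def)
    have "B \<le> K * exp (- ((2 * A + 4) * ?L))" using elim(3) by (simp add: B_def)
    also have "exp (- ((2 * A + 4) * ?L)) = 1 / (real n)\<^sup>2 * (1 / (real n)\<^sup>2) powr (A + 1)"
    proof -
      have "(real n)\<^sup>2 = exp (2 * ?L)" using n by (simp add: exp_double)
      then show ?thesis
        by (simp add: powr_def ln_div exp_minus[symmetric] inverse_eq_divide[symmetric] mult_exp_exp algebra_simps)
    qed
    also have "K * (1 / (real n)\<^sup>2 * (1 / (real n)\<^sup>2) powr (A + 1)) =
        c * (2 * k / real (n\<^sup>2)) / (2 * exp 2 * C) * (1 / (real n)\<^sup>2 / 2) powr (A + 1)"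
      by (simp add: K_def powr_divide powr_mult)
    also have "\<dots> \<le> c * (2 * k / real (n\<^sup>2)) / (2 * exp 2 * C) * (\<delta> / 2) powr (A + 1)"
    proof (intro mult_left_mono powr_mono2)
      have "real n * real (2 * N n + 2) \<le> (real n)\<^sup>2"
        using N2 n by (simp add: power2_eq_square)
      then have "1 / (real n)\<^sup>2 \<le> \<delta>"
        unfolding \<delta>_def using n by (intro divide_left_mono) auto
      then show "1 / (real n)\<^sup>2 / 2 \<le> \<delta> / 2" by simp
    qed (use A c k C n in auto)
    finally have B3: "B \<le> c * (2 * k / real (n\<^sup>2)) / (2 * exp 2 * C) * (\<delta> / 2) powr (measure \<alpha> UNIV + 1)"
      by (simp add: A_def)
    have u0: "0 \<le> u n" by (simp add: u_def)
    \<comment> \<open>Pulling out \<open>exp (- N)\<close> leaves a single term of the series of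
      \<open>exp (exp 1 * u)\<close>, and \<open>exp 1 \<le> 3\<close>. As \<open>u\<close> is of
      order \<open>L^2\<close> while \<open>N\<close> is at least \<open>L^4\<close>, the factor
      \<open>exp (- N)\<close> wins.\<close>
    have "u n ^ N n / fact (N n) = exp (- real (N n)) * ((exp 1 * u n) ^ N n / fact (N n))"
      by (simp add: power_mult_distrib exp_minus flip: exp_of_nat_mult)
    also have "\<dots> \<le> exp (- real (N n)) * exp (exp 1 * u n)"
      using u0 by (intro mult_left_mono power_div_fact_le_exp) auto
    also have "\<dots> \<le> exp (- (?L ^ 4)) * exp (3 * u n)"
      using N(1)[of n] u0 exp_le by (intro mult_mono) (auto intro: mult_right_mono)
    finally have "2 * exp (2 * u n) * (u n ^ N n / fact (N n)) \<le>
        2 * exp (2 * u n) * (exp (- (?L ^ 4)) * exp (3 * u n))"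
      by (intro mult_left_mono) auto
    also have "\<dots> = 2 * exp (5 * u n - ?L ^ 4)" by (simp add: mult_exp_exp)
    also have "\<dots> \<le> 1 / (2 * real n)" by (rule elim(2))
    finally have small: "2 * exp (2 * u n) * u n ^ N n / fact (N n) \<le> 1 / (2 * real n)" by simp
    have small': "2 * exp (2 * u n) * u n ^ N n / fact (N n) \<le> 1"
      using n by (intro order_trans[OF small]) (simp add: divide_le_eq_1)
    obtain E where E: "E \<in> sets D" "ennreal (B ^ (2 * N n + 2)) \<le> emeasure D E"
      and ge: "\<And>F \<sigma> x. F \<in> E \<Longrightarrow> \<sigma>\<^sub>0 \<le> \<sigma> \<Longrightarrow> \<bar>x\<bar> \<le> 2 * ?L \<Longrightarrow>
        \<sigma>\<^sub>0 / \<sigma> * (1 / (1 + (2 * N n + 2) * \<delta>)) *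
        exp (- (2 * (2 * k / real (n\<^sup>2) * (2 * ?L + k) / \<sigma>\<^sub>0\<^sup>2))) *
        (1 - 2 * exp (2 * u n) * u n ^ N n / fact (N n)) * normal_mixture F\<^sub>0 \<sigma>\<^sub>0 x \<le> normal_mixture F \<sigma> x"
      using dirichlet_mixture_prior_mass[OF D \<alpha> F0 k c dens C m \<delta> \<sigma>\<^sub>0 B B3, of "2 * ?L"] small'
      unfolding u_def by blast
    have "exp (- (?L ^ 6 / 2)) \<le> exp (- (b * ?L * (2 * ?L ^ 4 + 4)))" using elim(5) by simp
    also have "\<dots> \<le> exp (- (b * ?L * real (2 * N n + 2)))"
      using N(2)[of n] b n by (auto intro!: mult_left_mono)
    also have "\<dots> = B ^ (2 * N n + 2)"
      unfolding B_def by (subst exp_of_nat_mult[symmetric]) (simp add: mult_ac)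
    finally have mass: "ennreal (exp (- (?L ^ 6 / 2))) \<le> emeasure D E"
      using E(2) by (meson ennreal_leI order_trans)
    have "exp (- 4 / n) * normal_mixture F\<^sub>0 \<sigma>\<^sub>0 x \<le> normal_mixture F \<sigma> x"
      if F: "F \<in> E" and \<sigma>: "\<sigma>\<^sub>0 \<le> \<sigma>" "\<sigma> \<le> \<sigma>\<^sub>0 + \<sigma>\<^sub>0 / n" and x: "\<bar>x\<bar> \<le> 2 * ?L" for F \<sigma> x
    proof -
      have inv: "exp (- (1 / n)) \<le> 1 / y" if "0 < y" "y \<le> 1 + 1 / n" for y :: real
      proof -
        have "y \<le> exp (1 / n)" using that exp_ge_add_one_self[of "1 / n"] by linarith
        then show ?thesis using that by (simp add: exp_minus field_simps)
      qed
      have "\<sigma> / \<sigma>\<^sub>0 \<le> 1 + 1 / n" using \<sigma> \<sigma>\<^sub>0 by (simp add: field_simps)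
      then have 1: "exp (- (1 / n)) \<le> \<sigma>\<^sub>0 / \<sigma>"
        using inv[of "\<sigma> / \<sigma>\<^sub>0"] \<sigma> \<sigma>\<^sub>0 by simp
      have "y * (1 / (real n * y)) = 1 / n" if "y \<noteq> 0" for y :: real using that by simp
      from this[of "2 * N n + 2"] have "1 + (2 * N n + 2) * \<delta> = 1 + 1 / n" by (simp add: \<delta>_def)
      then have 2: "exp (- (1 / n)) \<le> 1 / (1 + (2 * N n + 2) * \<delta>)"
        using inv[of "1 + 1 / n"] n by (simp add: add_pos_pos)
      have 3: "exp (- (1 / n)) \<le> exp (- (2 * (2 * k / real (n\<^sup>2) * (2 * ?L + k) / \<sigma>\<^sub>0\<^sup>2)))"
        using elim(4) by simp
      have "exp (- (1 / n)) * (1 + 1 / n) \<le> 1"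
        using inv[of "1 + 1 / n"] n by (simp add: field_simps add_pos_pos)
      then have "exp (- (1 / n)) \<le> n / (n + 1)" using n by (simp add: field_simps)
      also have "\<dots> \<le> 1 - 1 / (2 * n)" using n by (simp add: field_simps)
      finally have 4: "exp (- (1 / n)) \<le> 1 - 2 * exp (2 * u n) * u n ^ N n / fact (N n)"
        using small by simp
      have p: "0 \<le> normal_mixture F\<^sub>0 \<sigma>\<^sub>0 x"
        using normal_mixture_pos[OF F0(1,2) \<sigma>\<^sub>0] by (rule less_imp_le)
      \<comment> \<open>One factor \<open>exp (- (1 / n))\<close> for each of the four losses:
        scale, normalisation, location and moments. Over \<open>n\<close> observations they multiply
        to \<open>exp (- 4)\<close>.\<close>
      have "exp (- 4 / n) = exp (- (1 / n)) * exp (- (1 / n)) * exp (- (1 / n)) * exp (- (1 / n))"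
        by (simp add: mult_exp_exp)
      also have "\<dots> \<le> \<sigma>\<^sub>0 / \<sigma> * (1 / (1 + (2 * N n + 2) * \<delta>)) *
        exp (- (2 * (2 * k / real (n\<^sup>2) * (2 * ?L + k) / \<sigma>\<^sub>0\<^sup>2))) *
        (1 - 2 * exp (2 * u n) * u n ^ N n / fact (N n))"
        using \<sigma> \<sigma>\<^sub>0 \<delta> by (intro mult_mono 1 2 3 4 mult_nonneg_nonneg) auto
      finally show ?thesis
        by (rule order_trans[OF mult_right_mono[OF _ p] ge[OF F \<sigma>(1) x]])
    qed
    with E(1) mass show ?case by blast
  qed
qed

section \<open>Exponential tests and posteriors\<close>

text \<open>After centring, Hoeffding's lemma for a variable of range 2 gives
  \<open>exp (d\<^sup>2 / 2)\<close>, and the gap in the mean contributes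
  \<open>exp (- d\<^sup>2)\<close>. Tilting by the gap itself minimises the resulting
  exponent.\<close>

lemma (in prob_space) exponential_moment_le:
  assumes [measurable]: "\<psi> \<in> borel_measurable M" and \<psi>: "\<And>x. \<bar>\<psi> x\<bar> \<le> 1"
    and d: "0 < d" and mean: "expectation \<psi> \<le> c - d"
  shows "(\<integral>\<^sup>+x. ennreal (exp (d * (\<psi> x - c))) \<partial>M) \<le> ennreal (exp (- (d\<^sup>2 / 2)))"
proof -
  let ?e = "expectation \<psi>"
  have int: "integrable M \<psi>" using \<psi> by (intro integrable_const_bound[where B=1]) auto
  interpret interval_bounded_random_variable M "\<lambda>x. \<psi> x - ?e" "- 1 - ?e" "1 - ?e"
    using \<psi> by unfold_locales (auto simp: abs_le_iff algebra_simps)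
  have "expectation (\<lambda>x. \<psi> x - ?e) = 0" using int by (simp add: prob_space)
  from Hoeffdings_lemma_nn_integral_0[OF d this]
  have H: "(\<integral>\<^sup>+x. ennreal (exp (d * (\<psi> x - ?e))) \<partial>M) \<le> ennreal (exp (d\<^sup>2 / 2))" by simp
  have "(\<integral>\<^sup>+x. ennreal (exp (d * (\<psi> x - c))) \<partial>M) =
      (\<integral>\<^sup>+x. ennreal (exp (d * (?e - c))) * ennreal (exp (d * (\<psi> x - ?e))) \<partial>M)"
    by (simp add: ennreal_mult[symmetric] mult_exp_exp algebra_simps)
  also have "\<dots> = ennreal (exp (d * (?e - c))) * (\<integral>\<^sup>+x. ennreal (exp (d * (\<psi> x - ?e))) \<partial>M)"
    by (rule nn_integral_cmult) measurable
  also have "\<dots> \<le> ennreal (exp (d * (- d))) * ennreal (exp (d\<^sup>2 / 2))"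
  proof (intro mult_mono ennreal_leI H)
    have "d * (?e - c) \<le> d * (- d)" using mean d by (intro mult_left_mono) auto
    then show "exp (d * (?e - c)) \<le> exp (d * (- d))" by simp
  qed auto
  also have "\<dots> = ennreal (exp (- (d\<^sup>2 / 2)))"
    by (simp add: ennreal_mult[symmetric] mult_exp_exp power2_eq_square)
  finally show ?thesis .
qed

lemma nn_integral_PiM_prod_power:
  assumes P: "prob_space P" and [measurable]: "f \<in> borel_measurable P"
  shows "(\<integral>\<^sup>+X. (\<Prod>i<n. f (X i)) \<partial>(\<Pi>\<^sub>M i\<in>(UNIV :: nat set). P)) = (\<integral>\<^sup>+x. f x \<partial>P) ^ n"
proof -
  interpret P: prob_space P by fact
  interpret PP: product_prob_space "\<lambda>_ :: nat. P" UNIV ..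
  have "(\<integral>\<^sup>+X. (\<Prod>i<n. f (X i)) \<partial>(\<Pi>\<^sub>M i\<in>UNIV. P)) =
      (\<integral>\<^sup>+X. (\<Prod>i<n. f (restrict X {..<n} i)) \<partial>(\<Pi>\<^sub>M i\<in>UNIV. P))"
    by (intro nn_integral_cong prod.cong) auto
  also have "\<dots> = (\<integral>\<^sup>+X. (\<Prod>i<n. f (X i)) \<partial>(distr (\<Pi>\<^sub>M i\<in>UNIV. P) (\<Pi>\<^sub>M i\<in>{..<n}. P) (\<lambda>X. restrict X {..<n})))"
    by (subst nn_integral_distr) (auto intro!: measurable_restrict_subset)
  also have "\<dots> = (\<integral>\<^sup>+X. (\<Prod>i<n. f (X i)) \<partial>(\<Pi>\<^sub>M i\<in>{..<n}. P))"
    by (subst PP.distr_PiM_restrict_finite) auto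
  also have "\<dots> = (\<Prod>i<n. \<integral>\<^sup>+x. f x \<partial>P)"
    by (rule PP.product_nn_integral_prod) auto
  finally show ?thesis by simp
qed

lemma prod_exp_mean_deviation:
  fixes \<psi> :: "'a \<Rightarrow> real" and n :: nat
  shows "(\<Prod>i<n. ennreal (exp (d * (\<psi> (X i) - c)))) = ennreal (exp (d * (\<Sum>i<n. \<psi> (X i) - c)))"
proof -
  have "exp (d * (\<Sum>i<n. \<psi> (X i) - c)) = (\<Prod>i<n. exp (d * (\<psi> (X i) - c)))"
    unfolding sum_distrib_left by (rule exp_sum) simp
  then show ?thesis by (simp add: prod_ennreal)
qed

text \<open>Chernoff's bound: the indicator of a positive sum is dominated by the exponential of the
  tilted sum. It serves as the error bound of a test under the true law.\<close>

lemma emeasure_mean_deviation_le: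
  assumes P: "prob_space P" and [measurable]: "\<psi> \<in> borel_measurable P" and \<psi>: "\<And>x. \<bar>\<psi> x\<bar> \<le> 1"
    and d: "0 < d" and mean: "(\<integral>x. \<psi> x \<partial>P) \<le> c - d"
  shows "emeasure (\<Pi>\<^sub>M i\<in>(UNIV :: nat set). P)
      {X \<in> space (\<Pi>\<^sub>M i\<in>(UNIV :: nat set). P). 0 < (\<Sum>i<n. \<psi> (X i) - c)} \<le> ennreal (exp (- (n * d\<^sup>2 / 2)))"
proof -
  interpret P: prob_space P by fact
  let ?M = "\<Pi>\<^sub>M i\<in>(UNIV :: nat set). P"
  have "emeasure ?M {X \<in> space ?M. 0 < (\<Sum>i<n. \<psi> (X i) - c)} =
      (\<integral>\<^sup>+X. indicator {X \<in> space ?M. 0 < (\<Sum>i<n. \<psi> (X i) - c)} X \<partial>?M)"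
    by (rule nn_integral_indicator[symmetric]) measurable
  also have "\<dots> \<le> (\<integral>\<^sup>+X. (\<Prod>i<n. ennreal (exp (d * (\<psi> (X i) - c)))) \<partial>?M)"
    using d by (intro nn_integral_mono)
      (auto simp: prod_exp_mean_deviation indicator_def simp flip: ennreal_1 intro!: ennreal_leI)
  also have "\<dots> = (\<integral>\<^sup>+x. ennreal (exp (d * (\<psi> x - c))) \<partial>P) ^ n"
    by (rule nn_integral_PiM_prod_power[OF P]) measurable
  also have "\<dots> \<le> ennreal (exp (- (d\<^sup>2 / 2))) ^ n"
    using \<psi> d mean by (intro power_mono P.exponential_moment_le) auto
  also have "\<dots> = ennreal (exp (- (n * d\<^sup>2 / 2)))"
    by (subst ennreal_power) (auto simp flip: exp_of_nat_mult)
  finally show ?thesis .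
qed

lemma measurable_likelihood_ratio_test:
  fixes p :: "'a \<Rightarrow> real \<Rightarrow> real" and p\<^sub>0 :: "real \<Rightarrow> real"
  assumes p: "(\<lambda>(\<theta>, x). p \<theta> x) \<in> borel_measurable (S \<Otimes>\<^sub>M borel)"
    and p\<^sub>0 [measurable]: "p\<^sub>0 \<in> borel_measurable borel"
    and \<psi> [measurable]: "\<psi> \<in> borel_measurable borel"
    and P: "sets P = sets borel" and A [measurable]: "A \<in> sets S"
  shows "(\<lambda>(\<theta>, X). (\<Prod>i<n. ennreal (p \<theta> (X i) / p\<^sub>0 (X i)) * ennreal (exp (d * (c - \<psi> (X i))))) * indicator A \<theta>)
    \<in> borel_measurable (S \<Otimes>\<^sub>M (\<Pi>\<^sub>M i\<in>(UNIV :: nat set). P))"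
  unfolding case_prod_beta
proof (rule borel_measurable_times_ennreal[OF borel_measurable_prod_ennreal])
  let ?N = "S \<Otimes>\<^sub>M (\<Pi>\<^sub>M i\<in>(UNIV :: nat set). P)"
  fix i
  have "(\<lambda>X. X i) \<in> (\<Pi>\<^sub>M i\<in>(UNIV :: nat set). P) \<rightarrow>\<^sub>M P" by (rule measurable_component_singleton) simp
  then have [measurable]: "(\<lambda>X. X i) \<in> borel_measurable (\<Pi>\<^sub>M i\<in>(UNIV :: nat set). P)"
    using P by (simp cong: measurable_cong_sets)
  have "(\<lambda>w. case (fst w, snd w i) of (\<theta>, x) \<Rightarrow> p \<theta> x) \<in> borel_measurable ?N"
    by (rule measurable_compose[OF _ p]) measurable
  then have [measurable]: "(\<lambda>w. p (fst w) (snd w i)) \<in> borel_measurable ?N" by simp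
  show "(\<lambda>w. ennreal (p (fst w) (snd w i) / p\<^sub>0 (snd w i)) * ennreal (exp (d * (c - \<psi> (snd w i)))))
      \<in> borel_measurable ?N" by measurable
next
  show "(\<lambda>w. indicator A (fst w) :: ennreal) \<in> borel_measurable (S \<Otimes>\<^sub>M (\<Pi>\<^sub>M i\<in>(UNIV :: nat set). P))"
    by measurable
qed

text \<open>
  The likelihood ratio turns the outer expectation into one under the law with density \<open>p \<theta>\<close>,
  where the exponential moment bound applies to \<open>- \<psi>\<close>.
\<close>

lemma nn_integral_likelihood_ratio_test_le:
  fixes p :: "'a \<Rightarrow> real \<Rightarrow> real" and p\<^sub>0 :: "real \<Rightarrow> real"
  assumes S: "sigma_finite_measure S"
    and p: "(\<lambda>(\<theta>, x). p \<theta> x) \<in> borel_measurable (S \<Otimes>\<^sub>M borel)" "\<And>\<theta> x. \<theta> \<in> space S \<Longrightarrow> 0 \<le> p \<theta> x"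
    and p_prob: "\<And>\<theta>. \<theta> \<in> A \<Longrightarrow> prob_space (density lborel (\<lambda>x. ennreal (p \<theta> x)))"
    and p\<^sub>0 [measurable]: "p\<^sub>0 \<in> borel_measurable borel" and p\<^sub>0_pos: "\<And>x. 0 < p\<^sub>0 x"
    and P: "prob_space (density lborel (\<lambda>x. ennreal (p\<^sub>0 x)))"
    and \<psi>[measurable]: "\<psi> \<in> borel_measurable borel" and \<psi>_le: "\<And>x. \<bar>\<psi> x\<bar> \<le> 1"
    and d: "0 < d" and A: "A \<in> sets S"
    and mean: "\<And>\<theta>. \<theta> \<in> A \<Longrightarrow> c + d \<le> (\<integral>x. \<psi> x \<partial>density lborel (\<lambda>x. ennreal (p \<theta> x)))"
    and mass: "emeasure S A \<le> 1"
  shows "(\<integral>\<^sup>+X. (\<integral>\<^sup>+\<theta>\<in>A. (\<Prod>i<n. ennreal (p \<theta> (X i) / p\<^sub>0 (X i)) * ennreal (exp (d * (c - \<psi> (X i))))) \<partial>S)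
      \<partial>(\<Pi>\<^sub>M i\<in>(UNIV :: nat set). density lborel (\<lambda>x. ennreal (p\<^sub>0 x)))) \<le> ennreal (exp (- (n * d\<^sup>2 / 2)))"
proof -
  let ?P = "density lborel (\<lambda>x. ennreal (p\<^sub>0 x))"
  let ?M = "\<Pi>\<^sub>M i\<in>(UNIV :: nat set). ?P"
  interpret P: prob_space ?P by fact
  interpret S: sigma_finite_measure S by fact
  interpret PP: product_prob_space "\<lambda>_ :: nat. ?P" UNIV ..
  interpret M: prob_space ?M by (rule PP.prob_space_axioms)
  interpret pair_sigma_finite S ?M ..
  let ?r = "\<lambda>\<theta> x. ennreal (p \<theta> x / p\<^sub>0 x) * ennreal (exp (d * (c - \<psi> x)))"
  have meas: "(\<lambda>(\<theta>, X). (\<Prod>i<n. ?r \<theta> (X i)) * indicator A \<theta>) \<in> borel_measurable (S \<Otimes>\<^sub>M ?M)"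
    using p(1) p\<^sub>0 \<psi> A by (intro measurable_likelihood_ratio_test) auto
  have inner: "(\<integral>\<^sup>+X. (\<Prod>i<n. ?r \<theta> (X i)) * indicator A \<theta> \<partial>?M) \<le> ennreal (exp (- (n * d\<^sup>2 / 2))) * indicator A \<theta>" for \<theta>
  proof (cases "\<theta> \<in> A")
    case True
    then have \<theta>: "\<theta> \<in> space S" using A sets.sets_into_space by auto
    have [measurable]: "p \<theta> \<in> borel_measurable borel"
    proof -
      have "(\<lambda>x. case (\<theta>, x) of (\<theta>, x) \<Rightarrow> p \<theta> x) \<in> borel_measurable borel"
        using \<theta> by (intro measurable_compose[OF _ p(1)]) measurable
      then show ?thesis by simp
    qed
    interpret Q: prob_space "density lborel (\<lambda>x. ennreal (p \<theta> x))" by (rule p_prob[OF True])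
    have "(\<integral>\<^sup>+x. ?r \<theta> x \<partial>?P) = (\<integral>\<^sup>+x. ennreal (p\<^sub>0 x) * ?r \<theta> x \<partial>lborel)"
      by (rule nn_integral_density) auto
    also have "\<dots> = (\<integral>\<^sup>+x. ennreal (p \<theta> x) * ennreal (exp (d * (c - \<psi> x))) \<partial>lborel)"
    proof (rule nn_integral_cong)
      fix x
      have "p\<^sub>0 x * (p \<theta> x / p\<^sub>0 x) = p \<theta> x" using p\<^sub>0_pos[of x] by simp
      then show "ennreal (p\<^sub>0 x) * ?r \<theta> x = ennreal (p \<theta> x) * ennreal (exp (d * (c - \<psi> x)))"
        using p\<^sub>0_pos[of x] p(2)[OF \<theta>, of x] by (simp add: mult.assoc[symmetric] ennreal_mult[symmetric])
    qed
    also have "\<dots> = (\<integral>\<^sup>+x. ennreal (exp (d * (- \<psi> x - (- c)))) \<partial>density lborel (\<lambda>x. ennreal (p \<theta> x)))"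
      by (subst nn_integral_density) auto
    also have "\<dots> \<le> ennreal (exp (- (d\<^sup>2 / 2)))"
      using \<psi>_le d mean[OF True] by (intro Q.exponential_moment_le) auto
    finally have "(\<integral>\<^sup>+x. ?r \<theta> x \<partial>?P) \<le> ennreal (exp (- (d\<^sup>2 / 2)))" .
    moreover have "(\<integral>\<^sup>+X. (\<Prod>i<n. ?r \<theta> (X i)) \<partial>?M) = (\<integral>\<^sup>+x. ?r \<theta> x \<partial>?P) ^ n"
      by (rule nn_integral_PiM_prod_power[OF P]) auto
    ultimately have "(\<integral>\<^sup>+X. (\<Prod>i<n. ?r \<theta> (X i)) \<partial>?M) \<le> ennreal (exp (- (d\<^sup>2 / 2))) ^ n"
      by (simp add: power_mono)
    also have "\<dots> = ennreal (exp (- (n * d\<^sup>2 / 2)))"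
      by (subst ennreal_power) (auto simp flip: exp_of_nat_mult)
    finally show ?thesis using True by simp
  qed simp
  have "(\<integral>\<^sup>+X. (\<integral>\<^sup>+\<theta>\<in>A. (\<Prod>i<n. ?r \<theta> (X i)) \<partial>S) \<partial>?M) =
      (\<integral>\<^sup>+\<theta>. (\<integral>\<^sup>+X. (\<Prod>i<n. ?r \<theta> (X i)) * indicator A \<theta> \<partial>?M) \<partial>S)"
    using Fubini'[OF meas] by simp
  also have "\<dots> \<le> (\<integral>\<^sup>+\<theta>. ennreal (exp (- (n * d\<^sup>2 / 2))) * indicator A \<theta> \<partial>S)"
    by (intro nn_integral_mono inner)
  also have "\<dots> \<le> ennreal (exp (- (n * d\<^sup>2 / 2)))"
    using A mass mult_left_mono[OF mass, of "ennreal (exp (- (n * d\<^sup>2 / 2)))"]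
    by (simp add: nn_integral_cmult_indicator)
  finally show ?thesis .
qed

section \<open>Image laws and the posterior quotient\<close>

lemma measurable_law_on: "f \<in> space S \<rightarrow> P \<Longrightarrow> f \<in> S \<rightarrow>\<^sub>M law_on S P f"
  unfolding law_on_def by (auto intro!: measurable_measure_of)

lemma space_law_on [simp]: "space (law_on S P f) = P"
  by (simp add: law_on_def space_measure_of_conv)

text \<open>Every subset of \<open>P\<close> with measurable preimage generates the sigma-algebra,
  so measurability can be decided after composition with \<open>f\<close>.\<close>

lemma borel_measurable_law_on:
  assumes f: "f \<in> space S \<rightarrow> P" and g: "(\<lambda>\<theta>. g (f \<theta>)) \<in> borel_measurable S"
  shows "g \<in> borel_measurable (law_on S P f)"
proof (rule measurableI)
  fix B :: "'c set" assume "B \<in> sets borel"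
  then have "(\<lambda>\<theta>. g (f \<theta>)) -` B \<inter> space S \<in> sets S" by (rule measurable_sets[OF g])
  also have "(\<lambda>\<theta>. g (f \<theta>)) -` B \<inter> space S = f -` (g -` B \<inter> P) \<inter> space S" using f by auto
  finally have "g -` B \<inter> P \<in> {A. A \<subseteq> P \<and> f -` A \<inter> space S \<in> sets S}" by auto
  then show "g -` B \<inter> space (law_on S P f) \<in> sets (law_on S P f)"
    by (simp add: law_on_def sets_measure_of_conv) (auto intro: sigma_sets.Basic)
qed auto

lemma law_on_eq_distr: "f \<in> space S \<rightarrow> P \<Longrightarrow> law_on S P f = distr S (law_on S P f) f"
  unfolding law_on_def by (intro distr_cong) auto

lemma integral_law_on:
  fixes g :: "'b \<Rightarrow> real"
  assumes "f \<in> space S \<rightarrow> P" "g \<in> borel_measurable (law_on S P f)"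
  shows "(\<integral>p. g p \<partial>law_on S P f) = (\<integral>\<theta>. g (f \<theta>) \<partial>S)"
  by (subst law_on_eq_distr[OF assms(1)]) (rule integral_distr[OF measurable_law_on[OF assms(1)] assms(2)])

text \<open>
  \<open>A\<close> need not be measurable: if an integrand is not integrable, then its Bochner integral is 0, and
  both a vanishing numerator and a vanishing denominator make the posterior 0.
\<close>

lemma posterior_le:
  fixes p :: "'a \<Rightarrow> real \<Rightarrow> real"
  assumes p: "p \<in> space S \<rightarrow> P" "\<And>\<theta> x. \<theta> \<in> space S \<Longrightarrow> 0 \<le> p \<theta> x"
    and meas: "(\<lambda>\<theta>. \<Prod>i<n. p \<theta> (X i)) \<in> borel_measurable S"
    and B: "AE \<theta> in S. p \<theta> \<in> A \<longrightarrow> \<theta> \<in> B"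
    and num: "(\<integral>\<^sup>+\<theta>\<in>B. ennreal (\<Prod>i<n. p \<theta> (X i)) \<partial>S) \<le> ennreal \<nu>" "0 \<le> \<nu>"
    and E: "E \<in> sets S" "ennreal \<mu> \<le> emeasure S E" "0 < \<mu>"
    and den: "\<And>\<theta>. \<theta> \<in> E \<Longrightarrow> \<kappa> \<le> (\<Prod>i<n. p \<theta> (X i))" "0 < \<kappa>"
  shows "\<bar>posterior (law_on S P p) n X A\<bar> \<le> \<nu> / (\<kappa> * \<mu>)"
proof -
  let ?Q = "law_on S P p"
  let ?g = "\<lambda>p. \<Prod>i<n. p (X i)"
  have nonneg: "0 \<le> ?g (p \<theta>)" if "\<theta> \<in> space S" for \<theta>
    using p(2)[OF that] by (intro prod_nonneg) auto
  have g: "?g \<in> borel_measurable ?Q" by (rule borel_measurable_law_on[where g="?g", OF p(1) meas])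
  have \<kappa>\<mu>: "0 < \<kappa> * \<mu>" using E den by simp
  have N: "0 \<le> (LINT p:A|?Q. ?g p) \<and> (LINT p:A|?Q. ?g p) \<le> \<nu>"
  proof (cases "integrable ?Q (\<lambda>p. indicator A p *\<^sub>R ?g p)")
    case True
    let ?h = "\<lambda>\<theta>. indicator A (p \<theta>) *\<^sub>R ?g (p \<theta>)"
    have h: "?h \<in> borel_measurable S"
      using measurable_compose[OF measurable_law_on[OF p(1)] borel_measurable_integrable[OF True]] .
    have "(LINT p:A|?Q. ?g p) = (\<integral>\<theta>. ?h \<theta> \<partial>S)"
      unfolding set_lebesgue_integral_def
      using borel_measurable_integrable[OF True] by (rule integral_law_on[OF p(1)])
    also have "\<dots> = enn2real (\<integral>\<^sup>+\<theta>. ennreal (?h \<theta>) \<partial>S)"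
      using nonneg h by (intro integral_eq_nn_integral) auto
    finally have eq: "(LINT p:A|?Q. ?g p) = enn2real (\<integral>\<^sup>+\<theta>. ennreal (?h \<theta>) \<partial>S)" .
    have "(\<integral>\<^sup>+\<theta>. ennreal (?h \<theta>) \<partial>S) \<le> (\<integral>\<^sup>+\<theta>\<in>B. ennreal (?g (p \<theta>)) \<partial>S)"
      using B by (intro nn_integral_mono_AE) (auto simp: indicator_def)
    also have "\<dots> \<le> ennreal \<nu>" by (rule num)
    finally show ?thesis using num(2) eq enn2real_leI by simp
  next
    case False
    then show ?thesis using num(2) by (simp add: set_lebesgue_integral_def not_integrable_integral_eq)
  qed
  show ?thesis
  proof (cases "integrable ?Q ?g")
    case True
    have "integrable S (\<lambda>\<theta>. ?g (p \<theta>))"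
      using True by (subst (asm) law_on_eq_distr[OF p(1)]) (simp add: integrable_distr_eq[OF measurable_law_on[OF p(1)] g])
    then have eq: "ennreal (\<integral>\<theta>. ?g (p \<theta>) \<partial>S) = (\<integral>\<^sup>+\<theta>. ennreal (?g (p \<theta>)) \<partial>S)"
      using nonneg by (intro nn_integral_eq_integral[symmetric]) auto
    have "ennreal (\<kappa> * \<mu>) \<le> ennreal \<kappa> * emeasure S E"
      using E den by (simp add: ennreal_mult mult_left_mono)
    also have "\<dots> = (\<integral>\<^sup>+\<theta>. ennreal \<kappa> * indicator E \<theta> \<partial>S)"
      using E(1) by (rule nn_integral_cmult_indicator[symmetric])
    also have "\<dots> \<le> (\<integral>\<^sup>+\<theta>. ennreal (?g (p \<theta>)) \<partial>S)"
      using den(1) by (intro nn_integral_mono) (auto simp: indicator_def intro!: ennreal_leI)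
    also note eq[symmetric]
    finally have "\<kappa> * \<mu> \<le> (\<integral>\<theta>. ?g (p \<theta>) \<partial>S)"
      using nonneg by (subst (asm) ennreal_le_iff) (auto intro!: Bochner_Integration.integral_nonneg)
    then have "\<kappa> * \<mu> \<le> (\<integral>p. ?g p \<partial>?Q)" by (simp add: integral_law_on[OF p(1) g])
    then show ?thesis
      unfolding posterior_def using N \<kappa>\<mu> by (simp add: frac_le)
  next
    case False
    then show ?thesis
      unfolding posterior_def using num(2) \<kappa>\<mu> by (simp add: not_integrable_integral_eq)
  qed
qed

text \<open>Where no test rejects, the product over the sample of the factors
  \<open>exp (d * (c i - \<psi> i (X j)))\<close> is at least 1. It may therefore be inserted into
  the numerator, and with it the likelihood ratio integral over \<open>A i\<close> has a small
  expectation, to which Markov's inequality applies. The denominator is bounded below by restricting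
  it to \<open>E\<close>, where the pointwise ratio multiplies to \<open>exp (- r)\<close> over the
  sample.\<close>

lemma measure_posterior_exceeds_le:
  fixes p :: "'a \<Rightarrow> real \<Rightarrow> real" and p\<^sub>0 :: "real \<Rightarrow> real" and \<psi> :: "'i \<Rightarrow> real \<Rightarrow> real"
  defines "P\<^sub>0 \<equiv> density lborel (\<lambda>x. ennreal (p\<^sub>0 x))"
  defines "M \<equiv> \<Pi>\<^sub>M i\<in>(UNIV :: nat set). P\<^sub>0"
  assumes S: "prob_space S" and p: "(\<lambda>(\<theta>, x). p \<theta> x) \<in> borel_measurable (S \<Otimes>\<^sub>M borel)"
    and p_dens: "p \<in> space S \<rightarrow> prob_densities"
    and p\<^sub>0: "p\<^sub>0 \<in> borel_measurable borel" "\<And>x. 0 < p\<^sub>0 x" and P: "prob_space P\<^sub>0"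
    and I: "finite I" and \<psi>: "\<And>i. i \<in> I \<Longrightarrow> \<psi> i \<in> borel_measurable borel" "\<And>i x. i \<in> I \<Longrightarrow> \<bar>\<psi> i x\<bar> \<le> 1"
    and d: "0 < d" and A: "\<And>i. i \<in> I \<Longrightarrow> A i \<in> sets S"
    and mean\<^sub>0: "\<And>i. i \<in> I \<Longrightarrow> (\<integral>x. \<psi> i x \<partial>P\<^sub>0) \<le> c i - d"
    and mean: "\<And>i \<theta>. i \<in> I \<Longrightarrow> \<theta> \<in> A i \<Longrightarrow> c i + d \<le> (\<integral>x. \<psi> i x \<partial>density lborel (\<lambda>x. ennreal (p \<theta> x)))"
    and far: "AE \<theta> in S. p \<theta> \<in> far \<longrightarrow> (\<exists>i\<in>I. \<theta> \<in> A i)"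
    and E: "E \<in> sets S" "ennreal \<mu> \<le> emeasure S E" "0 < \<mu>"
    and ratio: "\<And>\<theta> x. \<theta> \<in> E \<Longrightarrow> \<bar>x\<bar> \<le> R \<Longrightarrow> exp (- r / n) * p\<^sub>0 x \<le> p \<theta> x"
    and tail: "emeasure P\<^sub>0 {x. R < \<bar>x\<bar>} \<le> ennreal \<tau>" "0 \<le> \<tau>"
    and n: "0 < n" and \<epsilon>: "0 < \<epsilon>"
  shows "measure M {X \<in> space M. \<epsilon> < \<bar>posterior (law_on S prob_densities p) n X far\<bar>} \<le>
    n * \<tau> + card I * exp (- (n * d\<^sup>2 / 2)) + card I * exp (- (n * d\<^sup>2 / 2)) / (\<epsilon> * exp (- r) * \<mu>)"
proof -
  interpret S: prob_space S by fact
  interpret P: prob_space P\<^sub>0 by fact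
  interpret PP: product_prob_space "\<lambda>_ :: nat. P\<^sub>0" UNIV ..
  interpret M: prob_space M unfolding M_def by (rule PP.prob_space_axioms)
  have setsP: "sets P\<^sub>0 = sets borel" by (simp add: P\<^sub>0_def)
  have [measurable]: "(\<lambda>X. X j) \<in> borel_measurable M" for j
  proof -
    have "(\<lambda>X. X j) \<in> M \<rightarrow>\<^sub>M P\<^sub>0" unfolding M_def by (rule measurable_component_singleton) simp
    then show ?thesis using setsP by (simp cong: measurable_cong_sets)
  qed
  note \<psi>(1) [measurable] and p\<^sub>0(1) [measurable]
  let ?e = "exp (- (n * d\<^sup>2 / 2))"
  let ?q = "\<lambda>i \<theta> X. \<Prod>j<n. ennreal (p \<theta> (X j) / p\<^sub>0 (X j)) * ennreal (exp (d * (c i - \<psi> i (X j))))"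
  \<comment> \<open>Where no test rejects, \<open>Z\<close> dominates the numerator of the posterior
    divided by the likelihood of \<open>p\<^sub>0\<close>.\<close>
  define Z where "Z X = (\<Sum>i\<in>I. \<integral>\<^sup>+\<theta>\<in>A i. ?q i \<theta> X \<partial>S)" for X
  have q_meas: "(\<lambda>(\<theta>, X). ?q i \<theta> X * indicator (A i) \<theta>) \<in> borel_measurable (S \<Otimes>\<^sub>M M)" if "i \<in> I" for i
    unfolding M_def using p p\<^sub>0 \<psi> A setsP that by (intro measurable_likelihood_ratio_test) auto
  have Zi: "(\<lambda>X. \<integral>\<^sup>+\<theta>\<in>A i. ?q i \<theta> X \<partial>S) \<in> borel_measurable M" if "i \<in> I" for i
  proof (rule S.borel_measurable_nn_integral)
    show "(\<lambda>(X, \<theta>). ?q i \<theta> X * indicator (A i) \<theta>) \<in> borel_measurable (M \<Otimes>\<^sub>M S)"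
      using measurable_pair_swap[OF q_meas[OF that]] by (simp add: case_prod_beta)
  qed
  then have Z [measurable]: "Z \<in> borel_measurable M" unfolding Z_def by measurable
  have p_nonneg: "0 \<le> p \<theta> x" if "\<theta> \<in> space S" for \<theta> x
    using p_dens that by (auto simp: prob_densities_def Pi_iff)
  have EZ: "(\<integral>\<^sup>+X. Z X \<partial>M) \<le> ennreal (card I * ?e)"
  proof -
    have "(\<integral>\<^sup>+X. Z X \<partial>M) = (\<Sum>i\<in>I. \<integral>\<^sup>+X. (\<integral>\<^sup>+\<theta>\<in>A i. ?q i \<theta> X \<partial>S) \<partial>M)"
      unfolding Z_def by (rule nn_integral_sum) (rule Zi)
    also have "\<dots> \<le> (\<Sum>i\<in>I. ennreal ?e)"
    proof (rule sum_mono)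
      fix i assume i: "i \<in> I"
      show "(\<integral>\<^sup>+X. (\<integral>\<^sup>+\<theta>\<in>A i. ?q i \<theta> X \<partial>S) \<partial>M) \<le> ennreal ?e"
        unfolding M_def P\<^sub>0_def
      proof (rule nn_integral_likelihood_ratio_test_le)
        show "prob_space (density lborel (\<lambda>x. ennreal (p \<theta> x)))" if "\<theta> \<in> A i" for \<theta>
        proof -
          have "p \<theta> \<in> prob_densities" using p_dens A[OF i] that sets.sets_into_space by blast
          then show ?thesis by (intro prob_spaceI) (auto simp: prob_densities_def emeasure_density)
        qed
        show "emeasure S (A i) \<le> 1" by (rule S.emeasure_le_1)
      qed (use i p p\<^sub>0 p_nonneg \<psi> d A mean P in \<open>auto simp: P\<^sub>0_def S.sigma_finite_measure_axioms\<close>)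
    qed
    also have "\<dots> = ennreal (card I * ?e)" by (simp add: ennreal_mult ennreal_of_nat_eq_real_of_nat)
    finally show ?thesis .
  qed
  \<comment> \<open>Relative to the likelihood of \<open>p\<^sub>0\<close> the denominator is at
    least \<open>exp (- r) * \<mu>\<close>, so this threshold for \<open>Z\<close> makes the
    quotient at most \<open>\<epsilon>\<close>.\<close>
  let ?\<nu> = "\<epsilon> * exp (- r) * \<mu>"
  have \<nu>: "0 < ?\<nu>" using \<epsilon> E by simp
  \<comment> \<open>The three bad events: an observation leaves the window, a test rejects under the
    true law, the tilted numerator is large.\<close>
  define B1 where "B1 = (\<Union>j<n. {X \<in> space M. R < \<bar>X j\<bar>})"
  define B2 where "B2 = (\<Union>i\<in>I. {X \<in> space M. 0 < (\<Sum>j<n. \<psi> i (X j) - c i)})"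
  define B3 where "B3 = {X \<in> space M. 1 \<le> ennreal (1 / ?\<nu>) * Z X}"
  have B_sets: "B1 \<in> sets M" "B2 \<in> sets M" "B3 \<in> sets M"
  proof -
    show "B1 \<in> sets M" unfolding B1_def by measurable
    show "B2 \<in> sets M"
      unfolding B2_def
    proof (intro sets.finite_UN I)
      fix i assume "i \<in> I"
      note \<psi>(1)[OF this, measurable]
      show "{X \<in> space M. 0 < (\<Sum>j<n. \<psi> i (X j) - c i)} \<in> sets M" by measurable
    qed
    have [measurable]: "(\<lambda>X. ennreal (1 / ?\<nu>) * Z X) \<in> borel_measurable M"
      by (intro borel_measurable_times_ennreal borel_measurable_const Z)
    show "B3 \<in> sets M" unfolding B3_def by measurable
  qed
  have B1: "measure M B1 \<le> n * \<tau>"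
  proof -
    have "measure M {X \<in> space M. R < \<bar>X j\<bar>} \<le> \<tau>" for j
    proof -
      have "emeasure M {X \<in> space M. R < \<bar>X j\<bar>} = emeasure (distr M P\<^sub>0 (\<lambda>X. X j)) {x. R < \<bar>x\<bar>}"
      proof (subst emeasure_distr)
        show "(\<lambda>X. X j) \<in> M \<rightarrow>\<^sub>M P\<^sub>0" unfolding M_def by (rule measurable_component_singleton) simp
        show "{x. R < \<bar>x\<bar>} \<in> sets P\<^sub>0" unfolding setsP by measurable
      qed (auto intro!: arg_cong[where f="emeasure M"])
      also have "distr M P\<^sub>0 (\<lambda>X. X j) = P\<^sub>0"
        unfolding M_def by (rule PP.PiM_component) simp
      finally have "ennreal (measure M {X \<in> space M. R < \<bar>X j\<bar>}) \<le> ennreal \<tau>"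
        using tail(1) by (simp add: M.emeasure_eq_measure)
      then show ?thesis using tail(2) by (simp only: ennreal_le_iff)
    qed
    then have "(\<Sum>j<n. measure M {X \<in> space M. R < \<bar>X j\<bar>}) \<le> (\<Sum>j<n. \<tau>)" by (rule sum_mono)
    moreover have "measure M B1 \<le> (\<Sum>j<n. measure M {X \<in> space M. R < \<bar>X j\<bar>})"
      unfolding B1_def by (intro M.finite_measure_subadditive_finite) auto
    ultimately show ?thesis by simp
  qed
  have B2: "measure M B2 \<le> card I * ?e"
  proof -
    have "measure M {X \<in> space M. 0 < (\<Sum>j<n. \<psi> i (X j) - c i)} \<le> ?e" if i: "i \<in> I" for i
    proof -
      have "emeasure M {X \<in> space M. 0 < (\<Sum>j<n. \<psi> i (X j) - c i)} \<le> ennreal ?e"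
        unfolding M_def using i \<psi> d mean\<^sub>0 P
        by (intro emeasure_mean_deviation_le) (auto simp: P\<^sub>0_def)
      then show ?thesis by (simp add: M.emeasure_eq_measure)
    qed
    then have "(\<Sum>i\<in>I. measure M {X \<in> space M. 0 < (\<Sum>j<n. \<psi> i (X j) - c i)}) \<le> (\<Sum>i\<in>I. ?e)"
      by (rule sum_mono)
    moreover have "measure M B2 \<le> (\<Sum>i\<in>I. measure M {X \<in> space M. 0 < (\<Sum>j<n. \<psi> i (X j) - c i)})"
      unfolding B2_def using I by (intro M.finite_measure_subadditive_finite) auto
    ultimately show ?thesis by simp
  qed
  have B3: "measure M B3 \<le> card I * ?e / ?\<nu>"
  proof -
    have "emeasure M B3 \<le> ennreal (1 / ?\<nu>) * (\<integral>\<^sup>+X. Z X * indicator (space M) X \<partial>M)"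
      unfolding B3_def by (rule nn_integral_Markov_inequality) (use Z in measurable)
    also have "(\<integral>\<^sup>+X. Z X * indicator (space M) X \<partial>M) = (\<integral>\<^sup>+X. Z X \<partial>M)"
      by (intro nn_integral_cong) auto
    also have "ennreal (1 / ?\<nu>) * \<dots> \<le> ennreal (1 / ?\<nu>) * ennreal (card I * ?e)"
      by (intro mult_left_mono EZ) auto
    also have "\<dots> = ennreal (card I * ?e / ?\<nu>)"
      using \<nu> by (simp add: ennreal_mult[symmetric])
    finally show ?thesis using \<nu> by (simp add: M.emeasure_eq_measure)
  qed
  have "{X \<in> space M. \<epsilon> < \<bar>posterior (law_on S prob_densities p) n X far\<bar>} \<subseteq> B1 \<union> B2 \<union> B3"
  proof (rule subsetI, rule ccontr)
    fix X assume X: "X \<in> {X \<in> space M. \<epsilon> < \<bar>posterior (law_on S prob_densities p) n X far\<bar>}"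
      and "X \<notin> B1 \<union> B2 \<union> B3"
    then have X1: "\<And>j. j < n \<Longrightarrow> \<bar>X j\<bar> \<le> R" and X2: "\<And>i. i \<in> I \<Longrightarrow> (\<Sum>j<n. \<psi> i (X j) - c i) \<le> 0"
      and X3: "ennreal (1 / ?\<nu>) * Z X < 1"
      by (auto simp: B1_def B2_def B3_def not_less not_le)
    define w where "w = (\<Prod>j<n. p\<^sub>0 (X j))"
    have w: "0 < w" unfolding w_def using p\<^sub>0 by (intro prod_pos) auto
    have pX [measurable]: "(\<lambda>\<theta>. p \<theta> (X j)) \<in> borel_measurable S" for j
    proof -
      have "(\<lambda>\<theta>. case (\<theta>, X j) of (\<theta>, x) \<Rightarrow> p \<theta> x) \<in> borel_measurable S"
        by (rule measurable_compose[OF _ p]) measurable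
      then show ?thesis by simp
    qed
    have qX: "(\<lambda>\<theta>. ?q i \<theta> X * indicator (A i) \<theta>) \<in> borel_measurable S" if "i \<in> I" for i
      using pX A[OF that]
      by (intro borel_measurable_times_ennreal borel_measurable_prod_ennreal borel_measurable_divide
          measurable_compose[OF _ measurable_ennreal] borel_measurable_const borel_measurable_indicator)
    have ZX: "Z X \<le> ennreal ?\<nu>"
    proof -
      have "Z X = ennreal ?\<nu> * (ennreal (1 / ?\<nu>) * Z X)"
        using \<nu> \<epsilon> E(3) by (simp add: mult.assoc[symmetric] ennreal_mult[symmetric])
      also have "\<dots> \<le> ennreal ?\<nu> * 1" using X3 by (intro mult_left_mono) auto
      finally show ?thesis by simp
    qed
    have q_ge: "ennreal (\<Prod>j<n. p \<theta> (X j)) \<le> ennreal w * ?q i \<theta> X" if i: "i \<in> I" and \<theta>: "\<theta> \<in> space S" for i \<theta>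
    proof -
      have "(\<Prod>j<n. p \<theta> (X j)) = w * (\<Prod>j<n. p \<theta> (X j) / p\<^sub>0 (X j))"
        using w by (simp add: w_def prod_dividef less_imp_neq[OF p\<^sub>0(2), symmetric])
      moreover have "0 \<le> (\<Prod>j<n. p \<theta> (X j) / p\<^sub>0 (X j))"
        using p_nonneg[OF \<theta>] p\<^sub>0(2) by (intro prod_nonneg) (auto intro: divide_nonneg_pos)
      ultimately have "ennreal (\<Prod>j<n. p \<theta> (X j)) = ennreal w * ennreal (\<Prod>j<n. p \<theta> (X j) / p\<^sub>0 (X j))"
        using w by (simp add: ennreal_mult)
      also have "ennreal (\<Prod>j<n. p \<theta> (X j) / p\<^sub>0 (X j)) = (\<Prod>j<n. ennreal (p \<theta> (X j) / p\<^sub>0 (X j))) * 1"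
        using p_nonneg[OF \<theta>] p\<^sub>0(2) by (subst prod_ennreal) (auto intro: divide_nonneg_pos)
      also have "\<dots> \<le> (\<Prod>j<n. ennreal (p \<theta> (X j) / p\<^sub>0 (X j))) * (\<Prod>j<n. ennreal (exp (d * (c i - \<psi> i (X j)))))"
      proof (rule mult_left_mono)
        have "(\<Prod>j<n. ennreal (exp (d * (c i - \<psi> i (X j))))) = ennreal (exp (d * (\<Sum>j<n. c i - \<psi> i (X j))))"
          using prod_exp_mean_deviation[of d "\<lambda>x. - \<psi> i x" X "- c i" n] by simp
        moreover have "0 \<le> (\<Sum>j<n. c i - \<psi> i (X j))"
          using X2[OF i] by (simp add: sum_subtractf)
        ultimately show "1 \<le> (\<Prod>j<n. ennreal (exp (d * (c i - \<psi> i (X j)))))"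
          using d by simp
      qed simp
      also have "\<dots> = ?q i \<theta> X" by (simp add: prod.distrib)
      finally show ?thesis by (simp add: mult_left_mono)
    qed
    have "\<bar>posterior (law_on S prob_densities p) n X far\<bar> \<le> w * ?\<nu> / (exp (- r) * w * \<mu>)"
    proof (rule posterior_le[where B="\<Union>i\<in>I. A i" and E=E])
      show "AE \<theta> in S. p \<theta> \<in> far \<longrightarrow> \<theta> \<in> (\<Union>i\<in>I. A i)" using far by auto
      have "(\<integral>\<^sup>+\<theta>\<in>(\<Union>i\<in>I. A i). ennreal (\<Prod>j<n. p \<theta> (X j)) \<partial>S) \<le>
          (\<integral>\<^sup>+\<theta>. (\<Sum>i\<in>I. ennreal w * (?q i \<theta> X * indicator (A i) \<theta>)) \<partial>S)"
      proof (rule nn_integral_mono)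
        fix \<theta> assume \<theta>: "\<theta> \<in> space S"
        show "ennreal (\<Prod>j<n. p \<theta> (X j)) * indicator (\<Union>i\<in>I. A i) \<theta> \<le>
            (\<Sum>i\<in>I. ennreal w * (?q i \<theta> X * indicator (A i) \<theta>))"
        proof (cases "\<theta> \<in> (\<Union>i\<in>I. A i)")
          case True
          then obtain i where i: "i \<in> I" "\<theta> \<in> A i" by auto
          have "ennreal (\<Prod>j<n. p \<theta> (X j)) * indicator (\<Union>i\<in>I. A i) \<theta> \<le> ennreal w * (?q i \<theta> X * indicator (A i) \<theta>)"
            using q_ge[OF i(1) \<theta>] True i by simp
          also have "\<dots> \<le> (\<Sum>i\<in>I. ennreal w * (?q i \<theta> X * indicator (A i) \<theta>))"
            using i I by (intro member_le_sum) auto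
          finally show ?thesis .
        qed simp
      qed
      also have "\<dots> = (\<Sum>i\<in>I. \<integral>\<^sup>+\<theta>. ennreal w * (?q i \<theta> X * indicator (A i) \<theta>) \<partial>S)"
        by (rule nn_integral_sum) (rule borel_measurable_times_ennreal[OF borel_measurable_const qX])
      also have "\<dots> = (\<Sum>i\<in>I. ennreal w * (\<integral>\<^sup>+\<theta>. ?q i \<theta> X * indicator (A i) \<theta> \<partial>S))"
        using qX by (intro sum.cong refl nn_integral_cmult)
      also have "\<dots> = ennreal w * Z X" by (simp add: Z_def sum_distrib_left)
      also have "\<dots> \<le> ennreal w * ennreal ?\<nu>" by (intro mult_left_mono ZX) simp
      also have "\<dots> = ennreal (w * ?\<nu>)" using w \<nu> by (simp add: ennreal_mult)
      finally show "(\<integral>\<^sup>+\<theta>\<in>(\<Union>i\<in>I. A i). ennreal (\<Prod>j<n. p \<theta> (X j)) \<partial>S) \<le> ennreal (w * ?\<nu>)" .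
      show "exp (- r) * w \<le> (\<Prod>j<n. p \<theta> (X j))" if "\<theta> \<in> E" for \<theta>
      proof -
        have "exp (- r) = exp (- r / n) ^ n" using n by (simp flip: exp_of_nat_mult)
        then have "exp (- r) * w = (\<Prod>j<n. exp (- r / n) * p\<^sub>0 (X j))"
          by (simp add: w_def prod.distrib)
        also have "\<dots> \<le> (\<Prod>j<n. p \<theta> (X j))"
          using ratio[OF that X1] p\<^sub>0(2) by (intro prod_mono) (auto intro: less_imp_le)
        finally show ?thesis .
      qed
    qed (use p_dens p_nonneg w \<nu> E in auto)
    also have "\<dots> = \<epsilon>" using w E by (simp add: field_simps)
    finally show False using X by simp
  qed
  \<comment> \<open>The event on the left may fail to be measurable; its \<open>measure\<close> is
    then 0 and the bound is trivial.\<close>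
  then have "measure M {X \<in> space M. \<epsilon> < \<bar>posterior (law_on S prob_densities p) n X far\<bar>} \<le> measure M (B1 \<union> B2 \<union> B3)"
    using B_sets by (cases "{X \<in> space M. \<epsilon> < \<bar>posterior (law_on S prob_densities p) n X far\<bar>} \<in> sets M")
      (auto intro: M.finite_measure_mono simp: measure_notin_sets)
  also have "\<dots> \<le> measure M (B1 \<union> B2) + measure M B3"
    using B_sets by (intro measure_Un_le) auto
  also have "\<dots> \<le> measure M B1 + measure M B2 + measure M B3"
    using B_sets by (intro add_right_mono measure_Un_le) auto
  also have "\<dots> \<le> n * \<tau> + card I * ?e + card I * ?e / ?\<nu>"
    by (intro add_mono B1 B2 B3)
  finally show ?thesis .
qed

section \<open>The contraction rate\<close>

lemma borel_measurable_trig_mean: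
  assumes D: "sets D = sets (prob_algebra borel)" and G: "(\<lambda>\<sigma>. \<sigma>) \<in> borel_measurable G"
  shows "(\<lambda>(F, \<sigma>). trig_mean F \<sigma> t c) \<in> borel_measurable (D \<Otimes>\<^sub>M G)"
proof -
  have "(\<lambda>F. \<integral>y. cos (t * y + c) \<partial>F) \<in> borel_measurable (prob_algebra borel)"
    unfolding prob_algebra_def
    by (intro measurable_restrict_space1 integral_measurable_subprob_algebra) measurable
  then have [measurable]: "(\<lambda>F. \<integral>y. cos (t * y + c) \<partial>F) \<in> borel_measurable D"
    using D by (simp cong: measurable_cong_sets)
  note G [measurable]
  show ?thesis unfolding trig_mean_def case_prod_beta by measurable
qed

lemma positive_compact_bounds:
  fixes K :: "real set"
  assumes "compact K" "K \<subseteq> {0<..}" "0 < s"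
  obtains a b where "0 < a" "a \<le> s" "s \<le> b" "K \<subseteq> {a..b}"
proof -
  have K: "compact (insert s K)" using assms by auto
  obtain a where a: "a \<in> insert s K" "\<forall>x\<in>insert s K. a \<le> x"
    using compact_attains_inf[OF K] by auto
  obtain b where b: "b \<in> insert s K" "\<forall>x\<in>insert s K. x \<le> b"
    using compact_attains_sup[OF K] by auto
  show thesis
  proof (rule that)
    show "0 < a" using a(1) assms by auto
    show "a \<le> s" "s \<le> b" "K \<subseteq> {a..b}" using a(2) b(2) by (simp_all add: subset_iff)
  qed
qed

lemma has_density_on_ge:
  assumes \<mu>: "has_density_on \<mu> S f" and A: "A \<in> sets borel" "A \<subseteq> S" and f: "\<And>x. x \<in> A \<Longrightarrow> c \<le> f x"
  shows "ennreal c * emeasure lborel A \<le> emeasure \<mu> A"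
proof -
  have "ennreal c * emeasure lborel A = (\<integral>\<^sup>+x. ennreal c * indicator A x \<partial>lborel)"
    using A by (simp add: nn_integral_cmult_indicator)
  also have "\<dots> \<le> (\<integral>\<^sup>+x\<in>A. ennreal (f x) \<partial>lborel)"
    using f by (intro nn_integral_mono) (auto simp: indicator_def intro!: ennreal_leI)
  also have "\<dots> = emeasure \<mu> A" using \<mu> A by (simp add: has_density_on_def)
  finally show ?thesis .
qed

lemma continuous_positive_lower_bound:
  fixes f :: "real \<Rightarrow> real"
  assumes "continuous_on {u..v} f" "\<And>x. x \<in> {u..v} \<Longrightarrow> 0 < f x"
  obtains c where "0 < c" "\<And>x. x \<in> {u..v} \<Longrightarrow> c \<le> f x"
proof (cases "u \<le> v")
  case True
  then obtain x where "x \<in> {u..v}" "\<forall>y\<in>{u..v}. f x \<le> f y"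
    using continuous_attains_inf[of "{u..v}" f] assms(1) by auto
  then show thesis using assms(2) by (intro that[of "f x"]) auto
next
  case False
  then show thesis by (intro that[of 1]) auto
qed

theorem proposition2:
  fixes \<alpha> G F\<^sub>0 P\<^sub>0 :: "real measure"
    and D :: "real measure measure"
    and \<sigma>\<^sub>0 k\<^sub>0 :: real
    and p\<^sub>0 :: "real \<Rightarrow> real"
  assumes \<alpha>: "finite_measure \<alpha>" "sets \<alpha> = sets borel" "0 < measure \<alpha> UNIV"
    and D: "is_dirichlet_process \<alpha> D"
    and G: "prob_space G" "sets G = sets borel"
    and G_support: "compact (msupport G)" "msupport G \<subseteq> {0<..}"
    and \<sigma>\<^sub>0: "0 < \<sigma>\<^sub>0"
    and k\<^sub>0: "0 < k\<^sub>0"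
    and F\<^sub>0: "prob_space F\<^sub>0" "sets F\<^sub>0 = sets borel" "msupport F\<^sub>0 \<subseteq> {- k\<^sub>0..k\<^sub>0}"
    and p\<^sub>0: "p\<^sub>0 = normal_mixture F\<^sub>0 \<sigma>\<^sub>0"
    and P\<^sub>0: "P\<^sub>0 = density lborel (\<lambda>x. ennreal (p\<^sub>0 x))"
    and G_density: "\<exists>U g. open U \<and> \<sigma>\<^sub>0 \<in> U \<and> continuous_on U g \<and> (\<forall>s\<in>U. 0 < g s) \<and>
                      has_density_on G U g"
    and \<alpha>_support: "compact (msupport \<alpha>)"
    and \<alpha>_density: "\<exists>I h. is_interval I \<and> {- k\<^sub>0..k\<^sub>0} \<subseteq> I \<and> continuous_on I h \<and>
                      (\<forall>y\<in>I. 0 < h y) \<and> has_density_on \<alpha> I h"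
  shows "\<exists>M \<eta> :: real. 0 < M \<and> 0 < \<eta> \<and>
    tendsto_in_prob (\<Pi>\<^sub>M i\<in>(UNIV :: nat set). P\<^sub>0)
      (\<lambda>n X. posterior (mixture_prior D G) n X
         {p \<in> prob_densities.
            ennreal (M * (ln (real n) powr \<eta> / sqrt (real n))) \<le> sup_norm (\<lambda>x. p x - p\<^sub>0 x)})
      0"
proof -
  let ?B = "\<lambda>k. {- k..k} :: real set"
  let ?G = "restrict_space G {0<..}"
  let ?S = "D \<Otimes>\<^sub>M ?G"
  let ?f = "\<lambda>(F, \<sigma>). normal_mixture F \<sigma>"
  interpret \<alpha>: finite_measure \<alpha> by (rule \<alpha>)
  interpret G: prob_space G by (rule G)
  interpret F\<^sub>0: prob_space F\<^sub>0 by (rule F\<^sub>0)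
  have setsD: "sets D = sets (prob_algebra borel)" and probD: "prob_space D"
    using D by (auto simp: is_dirichlet_process_def)
  interpret D: prob_space D by (rule probD)

  \<comment> \<open>One window for both mixing measures: \<open>k\<close> bounds the support of
    \<open>\<alpha>\<close>, hence that of almost every \<open>F\<close>, and also that of
    \<open>F\<^sub>0\<close>. The prior mass estimate works on the smaller
    \<open>[- k\<^sub>0, k\<^sub>0]\<close>, where a positive density of \<open>\<alpha>\<close> is
    available.\<close>
  obtain k where k: "k\<^sub>0 \<le> k" "msupport \<alpha> \<subseteq> ?B k"
  proof -
    have "bounded (msupport \<alpha>)" using \<alpha>_support by (rule compact_imp_bounded)
    then obtain k1 where "\<forall>x\<in>msupport \<alpha>. \<bar>x\<bar> \<le> k1" by (auto simp: bounded_iff)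
    then show thesis by (intro that[of "max k1 k\<^sub>0"]) (force simp: abs_le_iff)+
  qed
  have k_pos: "0 < k" using k k\<^sub>0 by simp
  have F\<^sub>0_AE0: "AE y in F\<^sub>0. \<bar>y\<bar> \<le> k\<^sub>0"
    using AE_msupport[OF F\<^sub>0(2)] by eventually_elim (use F\<^sub>0(3) in \<open>auto simp: abs_le_iff\<close>)
  then have F\<^sub>0_AE: "AE y in F\<^sub>0. \<bar>y\<bar> \<le> k" by eventually_elim (use k in auto)
  have "AE y in \<alpha>. y \<in> ?B k" using AE_msupport[OF \<alpha>(2)] by eventually_elim (use k in auto)
  then have "emeasure \<alpha> (- ?B k) = 0"
    using \<alpha>(2) by (subst (asm) AE_iff_measurable[OF _ refl]) (auto simp: sets_eq_imp_space_eq[OF \<alpha>(2)] Compl_eq)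
  then have "measure \<alpha> (- ?B k) = 0" by (simp add: measure_def)
  then have D_AE: "AE F in D. measure F (- ?B k) = 0"
    by (intro dirichlet_process_AE_null[OF D]) auto

  \<comment> \<open>The lower bound \<open>a\<close> on the scales gives all Fourier transforms a
    common Gaussian decay, the upper bound \<open>b\<close> a common Lipschitz constant.\<close>
  obtain a b where ab: "0 < a" "a \<le> \<sigma>\<^sub>0" "\<sigma>\<^sub>0 \<le> b" "msupport G \<subseteq> {a..b}"
    using positive_compact_bounds[OF G_support \<sigma>\<^sub>0] by metis
  have G_AE: "AE \<sigma> in G. \<sigma> \<in> {a..b}"
    using AE_msupport[OF G(2)] by eventually_elim (use ab in auto)
  have G_pos: "emeasure G {0<..} = 1"
  proof (rule G.emeasure_eq_1_AE)
    show "AE \<sigma> in G. \<sigma> \<in> {0<..}" using G_AE by eventually_elim (use ab in auto)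
  qed (simp add: G)
  have probG: "prob_space ?G" by (rule prob_space_restrict_space) (auto simp: G G_pos)
  interpret G': prob_space ?G by (rule probG)
  interpret DG: pair_prob_space D ?G ..
  have G_AE': "AE \<sigma> in ?G. \<sigma> \<in> {a..b}"
    using G_AE G(2) by (subst AE_restrict_space_iff) auto
  have G_id: "(\<lambda>\<sigma>. \<sigma>) \<in> borel_measurable ?G"
    by (rule measurable_restrict_space1) (simp cong: measurable_cong_sets add: G)
  have spaceG: "space ?G = {0<..}"
    using sets_eq_imp_space_eq[OF G(2)] by (simp add: space_restrict_space)
  have spaceD: "prob_space F \<and> sets F = sets borel" if "F \<in> space D" for F
    using that sets_eq_imp_space_eq[OF setsD] by (auto simp: space_prob_algebra)
  have fst: "fst \<in> ?S \<rightarrow>\<^sub>M prob_algebra borel"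
    using measurable_fst[of D ?G] measurable_cong_sets[OF refl setsD, of ?S] by blast
  have snd: "snd \<in> borel_measurable ?S"
    using measurable_compose[OF measurable_snd[of D ?G] G_id] by simp

  have f_dens: "?f \<in> space ?S \<rightarrow> prob_densities"
    using spaceD by (auto simp: space_pair_measure spaceG intro!: normal_mixture_in_prob_densities)
  have f_meas: "(\<lambda>(\<theta>, x). ?f \<theta> x) \<in> borel_measurable (?S \<Otimes>\<^sub>M borel)"
  proof -
    have "(\<lambda>w. normal_mixture (fst (fst w)) (snd (fst w)) (snd w)) \<in> borel_measurable (?S \<Otimes>\<^sub>M borel)"
    proof (rule measurable_normal_mixture)
      show "(\<lambda>w. fst (fst w)) \<in> ?S \<Otimes>\<^sub>M borel \<rightarrow>\<^sub>M prob_algebra borel"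
        by (rule measurable_compose[OF measurable_fst fst])
      show "(\<lambda>w. snd (fst w)) \<in> borel_measurable (?S \<Otimes>\<^sub>M borel)"
        by (rule measurable_compose[OF measurable_fst snd])
    qed (auto simp: space_pair_measure spaceG)
    then show ?thesis by (simp add: case_prod_beta)
  qed
  have good: "AE \<theta> in ?S. measure (fst \<theta>) (- ?B k) = 0 \<and> a \<le> snd \<theta> \<and> snd \<theta> \<le> b"
  proof (rule DG.AE_pair_measure)
    have [measurable]: "(\<lambda>\<theta>. measure (fst \<theta>) (- ?B k)) \<in> borel_measurable ?S"
      by (rule measurable_compose[OF measurable_fst measurable_measure_prob_algebra[OF setsD]]) auto
    note snd [measurable]
    show "{\<theta> \<in> space ?S. measure (fst \<theta>) (- ?B k) = 0 \<and> a \<le> snd \<theta> \<and> snd \<theta> \<le> b} \<in> sets ?S"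
      by measurable
    show "AE F in D. AE \<sigma> in ?G. measure (fst (F, \<sigma>)) (- ?B k) = 0 \<and> a \<le> snd (F, \<sigma>) \<and> snd (F, \<sigma>) \<le> b"
      using D_AE
    proof eventually_elim
      fix F assume "measure F (- ?B k) = 0"
      then show "AE \<sigma> in ?G. measure (fst (F, \<sigma>)) (- ?B k) = 0 \<and> a \<le> snd (F, \<sigma>) \<and> snd (F, \<sigma>) \<le> b"
        using G_AE' by simp
    qed
  qed
  have F_AE: "AE y in F. \<bar>y\<bar> \<le> k" if F: "F \<in> space D" "measure F (- ?B k) = 0" for F
  proof -
    interpret F: prob_space F using spaceD[OF F(1)] by simp
    have "emeasure F (- ?B k) = 0" using F(2) by (simp add: F.emeasure_eq_measure)
    then have "- ?B k \<in> null_sets F" using spaceD[OF F(1)] by auto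
    then show ?thesis by (rule AE_I') (auto simp: abs_le_iff)
  qed

  obtain c where c: "0 < c" and dens: "\<And>u v. - k\<^sub>0 \<le> u \<Longrightarrow> u \<le> v \<Longrightarrow> v \<le> k\<^sub>0 \<Longrightarrow> c * (v - u) \<le> measure \<alpha> {u<..<v}"
  proof -
    obtain I h where I: "{- k\<^sub>0..k\<^sub>0} \<subseteq> I" "continuous_on I h" "\<forall>y\<in>I. 0 < h y" "has_density_on \<alpha> I h"
      using \<alpha>_density by auto
    obtain c where c: "0 < c" "\<And>y. y \<in> {- k\<^sub>0..k\<^sub>0} \<Longrightarrow> c \<le> h y"
      using continuous_positive_lower_bound[of "- k\<^sub>0" k\<^sub>0 h] continuous_on_subset[OF I(2,1)] I(1,3)
      by (metis subsetD)
    have "c * (v - u) \<le> measure \<alpha> {u<..<v}" if uv: "- k\<^sub>0 \<le> u" "u \<le> v" "v \<le> k\<^sub>0" for u v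
    proof -
      have "ennreal c * emeasure lborel {u<..<v} \<le> emeasure \<alpha> {u<..<v}"
        using I(1) c(2) uv by (intro has_density_on_ge[OF I(4)]) auto
      then show ?thesis
        using c uv by (simp add: \<alpha>.emeasure_eq_measure ennreal_mult[symmetric])
    qed
    then show thesis using c(1) that by blast
  qed

  \<comment> \<open>Only the right half of a neighbourhood of \<open>\<sigma>\<^sub>0\<close> is
    measured, since the mixtures that nearly dominate \<open>p\<^sub>0\<close> are taken with larger
    scales.\<close>
  obtain e g\<^sub>0 where e: "0 < e" "0 < g\<^sub>0"
    and G_ge: "\<And>d. 0 \<le> d \<Longrightarrow> d \<le> e \<Longrightarrow> ennreal (g\<^sub>0 * d) \<le> emeasure G {\<sigma>\<^sub>0..\<sigma>\<^sub>0 + d}"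
  proof -
    obtain U g where U: "open U" "\<sigma>\<^sub>0 \<in> U" "continuous_on U g" "\<forall>s\<in>U. 0 < g s" "has_density_on G U g"
      using G_density by auto
    obtain e where e: "0 < e" "cball \<sigma>\<^sub>0 e \<subseteq> U" using U(1,2) open_contains_cball by blast
    have sub: "{\<sigma>\<^sub>0..\<sigma>\<^sub>0 + e} \<subseteq> U" using e by (auto simp: cball_def dist_real_def subset_iff)
    obtain g\<^sub>0 where g\<^sub>0: "0 < g\<^sub>0" "\<And>y. y \<in> {\<sigma>\<^sub>0..\<sigma>\<^sub>0 + e} \<Longrightarrow> g\<^sub>0 \<le> g y"
      using continuous_positive_lower_bound[of "\<sigma>\<^sub>0" "\<sigma>\<^sub>0 + e" g] continuous_on_subset[OF U(3) sub] U(4) sub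
      by (metis subsetD)
    have "ennreal (g\<^sub>0 * d) \<le> emeasure G {\<sigma>\<^sub>0..\<sigma>\<^sub>0 + d}" if d: "0 \<le> d" "d \<le> e" for d
    proof -
      have "ennreal g\<^sub>0 * emeasure lborel {\<sigma>\<^sub>0..\<sigma>\<^sub>0 + d} \<le> emeasure G {\<sigma>\<^sub>0..\<sigma>\<^sub>0 + d}"
        using sub g\<^sub>0(2) d by (intro has_density_on_ge[OF U(5)]) auto
      then show ?thesis using d g\<^sub>0(1) by (simp add: ennreal_mult)
    qed
    then show thesis using e(1) g\<^sub>0(1) that by blast
  qed

  have p\<^sub>0_meas: "p\<^sub>0 \<in> borel_measurable borel" unfolding p\<^sub>0 by (rule borel_measurable_normal_mixture[OF F\<^sub>0(1,2) \<sigma>\<^sub>0])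
  have p\<^sub>0_pos: "0 < p\<^sub>0 x" for x unfolding p\<^sub>0 by (rule normal_mixture_pos[OF F\<^sub>0(1,2) \<sigma>\<^sub>0])
  have prob_P\<^sub>0: "prob_space P\<^sub>0" unfolding P\<^sub>0 p\<^sub>0 by (rule prob_space_normal_mixture[OF F\<^sub>0(1,2) \<sigma>\<^sub>0])
  define C where "C = 2 * exp (k\<^sup>2 / (2 * \<sigma>\<^sub>0\<^sup>2) + 2 * \<sigma>\<^sub>0\<^sup>2)"
  have tail: "emeasure P\<^sub>0 {x. R < \<bar>x\<bar>} \<le> ennreal (C * exp (- R))" for R
    unfolding P\<^sub>0 p\<^sub>0 C_def by (rule normal_mixture_tail[OF F\<^sub>0(1,2) \<sigma>\<^sub>0 F\<^sub>0_AE])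
  have C: "0 < C" by (simp add: C_def)

  let ?M = "\<Pi>\<^sub>M i\<in>(UNIV :: nat set). P\<^sub>0"
  let ?\<epsilon> = "\<lambda>n. ln (real n) powr 6 / sqrt (real n)"
  let ?far = "\<lambda>n. {p \<in> prob_densities. ennreal (1 * ?\<epsilon> n) \<le> sup_norm (\<lambda>x. p x - p\<^sub>0 x)}"
  let ?I = "\<lambda>n::nat. {- (int n)\<^sup>2..(int n)\<^sup>2} \<times> {..<4::nat}"
  let ?\<delta> = "\<lambda>n. ln (real n) ^ 4 / sqrt (real n)"
  let ?\<mu> = "\<lambda>n. exp (- (ln (real n) ^ 6 / 2)) * (g\<^sub>0 * (\<sigma>\<^sub>0 / real n))"
  \<comment> \<open>The bound of \<open>normal_mixture_diff_le_grid\<close> with cutoff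
    \<open>T = ln n\<close>. Its leading term is \<open>2 * L^5 / sqrt n\<close>; rounding
    contributes order \<open>L / n\<close>, and the truncated frequencies less than any power of
    \<open>n\<close>.\<close>
  let ?bd = "\<lambda>n. ln (real n) * (2 * ?\<delta> n + 2 * (b + k) / real n) + 2 / a * exp (- (a * ln (real n))\<^sup>2 / 4)"

  have b_pos: "0 < b" using ab by simp
  have ev_mass: "\<forall>\<^sub>F n in sequentially. \<exists>E\<in>sets D. ennreal (exp (- (ln (real n) ^ 6 / 2))) \<le> emeasure D E \<and>
    (\<forall>F\<in>E. \<forall>\<sigma> x. \<sigma>\<^sub>0 \<le> \<sigma> \<longrightarrow> \<sigma> \<le> \<sigma>\<^sub>0 + \<sigma>\<^sub>0 / real n \<longrightarrow> \<bar>x\<bar> \<le> 2 * ln (real n) \<longrightarrow>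
      exp (- 4 / real n) * normal_mixture F\<^sub>0 \<sigma>\<^sub>0 x \<le> normal_mixture F \<sigma> x)"
    by (rule eventually_dirichlet_mixture_prior_mass[OF D \<alpha>(1,2) F\<^sub>0(1,2) F\<^sub>0_AE0 k\<^sub>0 c \<sigma>\<^sub>0]) (rule dens)
  have ev_bd: "\<forall>\<^sub>F n in sequentially. ?bd n < ?\<epsilon> n"
    using ab(1) b_pos k_pos by real_asymp
  have ev_e: "\<forall>\<^sub>F n in sequentially. \<sigma>\<^sub>0 / real n \<le> e"
    using \<sigma>\<^sub>0 e by real_asymp
  have ev_T: "\<forall>\<^sub>F n in sequentially. ln (real n) \<le> real n" by real_asymp

  have bound: "\<forall>\<^sub>F n in sequentially.
      measure ?M {X \<in> space ?M. \<epsilon> < \<bar>posterior (mixture_prior D G) n X (?far n)\<bar>} \<le>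
      real n * (C * exp (- (2 * ln (real n)))) + 4 * (2 * (real n)\<^sup>2 + 1) * exp (- (ln (real n) ^ 8 / 8)) +
      4 * (2 * (real n)\<^sup>2 + 1) * exp (- (ln (real n) ^ 8 / 8)) / (\<epsilon> * exp (- 4) * ?\<mu> n)"
    if \<epsilon>: "0 < \<epsilon>" for \<epsilon>
    using ev_mass ev_bd ev_e ev_T eventually_gt_at_top[of 1]
  proof eventually_elim
    case (elim n)
    let ?L = "ln (real n)"
    have n: "1 < real n" "0 < ?L" "0 < n" using elim(5) by auto
    define \<delta> where "\<delta> = ?\<delta> n"
    have \<delta>: "0 < \<delta>" using n by (simp add: \<delta>_def)
    obtain E where E: "E \<in> sets D" "ennreal (exp (- (?L ^ 6 / 2))) \<le> emeasure D E"
      and ratio: "\<And>F \<sigma> x. F \<in> E \<Longrightarrow> \<sigma>\<^sub>0 \<le> \<sigma> \<Longrightarrow> \<sigma> \<le> \<sigma>\<^sub>0 + \<sigma>\<^sub>0 / n \<Longrightarrow> \<bar>x\<bar> \<le> 2 * ?L \<Longrightarrow>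
        exp (- 4 / n) * normal_mixture F\<^sub>0 \<sigma>\<^sub>0 x \<le> normal_mixture F \<sigma> x"
      using elim(1) by blast
    let ?s = "{\<sigma>\<^sub>0..\<sigma>\<^sub>0 + \<sigma>\<^sub>0 / n}"
    have s: "?s \<in> sets ?G" using \<sigma>\<^sub>0 by (auto simp: sets_restrict_space_iff G)
    define t where "t = (\<lambda>(j::int, q::nat). of_int j / real n)"
    define ph where "ph = (\<lambda>(j::int, q::nat). real q * (pi / 2))"
    define \<psi> where "\<psi> = (\<lambda>i x. cos (t i * x + ph i))"
    define m\<^sub>0 where "m\<^sub>0 = (\<lambda>i. trig_mean F\<^sub>0 \<sigma>\<^sub>0 (t i) (ph i))"
    define A where "A = (\<lambda>i. {\<theta> \<in> space ?S. m\<^sub>0 i + \<delta> \<le> (\<lambda>(F, \<sigma>). trig_mean F \<sigma> (t i) (ph i)) \<theta>})"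
    have A: "A i \<in> sets ?S" for i
    proof -
      note borel_measurable_trig_mean[OF setsD G_id, of "t i" "ph i", measurable]
      show ?thesis unfolding A_def by measurable
    qed
    \<comment> \<open>The thresholds lie halfway between the mean \<open>m\<^sub>0 i\<close> under
      \<open>p\<^sub>0\<close> and the lower bound \<open>m\<^sub>0 i + \<delta>\<close> on
      \<open>A i\<close>, so both kinds of error are estimated with the same gap
      \<open>\<delta> / 2\<close>. The total loss \<open>r = 4\<close> comes from the factor
      \<open>exp (- 4 / n)\<close> per observation.\<close>
    have "measure ?M {X \<in> space ?M. \<epsilon> < \<bar>posterior (law_on ?S prob_densities ?f) n X (?far n)\<bar>} \<le>
      real n * (C * exp (- (2 * ?L))) + card (?I n) * exp (- (n * (\<delta> / 2)\<^sup>2 / 2)) +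
      card (?I n) * exp (- (n * (\<delta> / 2)\<^sup>2 / 2)) / (\<epsilon> * exp (- 4) * ?\<mu> n)"
      unfolding P\<^sub>0
    proof (rule measure_posterior_exceeds_le[where \<psi>=\<psi> and c="\<lambda>i. m\<^sub>0 i + \<delta> / 2" and A=A
          and E="E \<times> ?s" and R="2 * ?L"])
      show "prob_space ?S" by (rule DG.P.prob_space_axioms)
      show "\<psi> i \<in> borel_measurable borel" "\<bar>\<psi> i x\<bar> \<le> 1" for i x by (auto simp: \<psi>_def)
      show "A i \<in> sets ?S" for i by (rule A)
      show "(\<integral>x. \<psi> i x \<partial>density lborel (\<lambda>x. ennreal (p\<^sub>0 x))) \<le> m\<^sub>0 i + \<delta> / 2 - \<delta> / 2" for i
        unfolding \<psi>_def m\<^sub>0_def p\<^sub>0 expectation_cos_normal_mixture[OF F\<^sub>0(1,2) \<sigma>\<^sub>0] by simp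
      show "m\<^sub>0 i + \<delta> / 2 + \<delta> / 2 \<le> (\<integral>x. \<psi> i x \<partial>density lborel (\<lambda>x. ennreal (?f \<theta> x)))"
        if "\<theta> \<in> A i" for i \<theta>
      proof -
        obtain F \<sigma> where \<theta>: "\<theta> = (F, \<sigma>)" by (cases \<theta>)
        have F: "prob_space F" "sets F = sets borel" "0 < \<sigma>"
          using that spaceD by (auto simp: A_def \<theta> space_pair_measure spaceG)
        show ?thesis
          using that expectation_cos_normal_mixture[OF F, of "t i" "ph i"]
          by (simp add: A_def \<theta> \<psi>_def)
      qed
      show "AE \<theta> in ?S. ?f \<theta> \<in> ?far n \<longrightarrow> (\<exists>i\<in>?I n. \<theta> \<in> A i)"
        using good AE_space
      proof eventually_elim
        fix \<theta> assume good: "measure (fst \<theta>) (- ?B k) = 0 \<and> a \<le> snd \<theta> \<and> snd \<theta> \<le> b" and sp: "\<theta> \<in> space ?S"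
        obtain F \<sigma> where \<theta>: "\<theta> = (F, \<sigma>)" by (cases \<theta>)
        have F: "F \<in> space D" "prob_space F" "sets F = sets borel"
          using sp spaceD by (auto simp: \<theta> space_pair_measure)
        have \<sigma>: "a \<le> \<sigma>" "\<sigma> \<le> b" using good by (auto simp: \<theta>)
        have FA: "AE y in F. \<bar>y\<bar> \<le> k" using F_AE[OF F(1)] good by (simp add: \<theta>)
        \<comment> \<open>By contraposition: if the parameter lies in none of the sets
          \<open>A i\<close>, all grid means satisfy the one-sided bound, and the supremum distance
          is then strictly below the radius.\<close>
        show "?f \<theta> \<in> ?far n \<longrightarrow> (\<exists>i\<in>?I n. \<theta> \<in> A i)"
        proof (rule impI, rule ccontr)
          assume far: "?f \<theta> \<in> ?far n" and "\<not> (\<exists>i\<in>?I n. \<theta> \<in> A i)"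
          then have "\<theta> \<notin> A (j, q)" if "j \<in> {- (int n)\<^sup>2..(int n)\<^sup>2}" "q < 4" for j q
            using that by blast
          then have grid: "trig_mean F \<sigma> (of_int j / n) (q * (pi / 2)) \<le> trig_mean F\<^sub>0 \<sigma>\<^sub>0 (of_int j / n) (q * (pi / 2)) + \<delta>"
            if "j \<in> {- (int n)\<^sup>2..(int n)\<^sup>2}" "q < (4::nat)" for j q
            using that sp by (force simp: A_def \<theta> m\<^sub>0_def t_def ph_def)
          have "\<bar>normal_mixture F \<sigma> x - p\<^sub>0 x\<bar> \<le> ?bd n" for x
            unfolding p\<^sub>0 \<delta>_def[symmetric] using n elim(4) \<delta> k_pos
            by (intro normal_mixture_diff_le_grid[OF F(2,3) F\<^sub>0(1,2) ab(1) \<sigma>(1) ab(2) \<sigma>(2) ab(3) FA F\<^sub>0_AE] grid) auto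
          then have "sup_norm (\<lambda>x. normal_mixture F \<sigma> x - p\<^sub>0 x) \<le> ennreal (?bd n)"
            unfolding sup_norm_def by (intro SUP_least ennreal_leI) auto
          moreover have "ennreal (?bd n) < ennreal (?\<epsilon> n)"
            using elim(2) n ab(1) b_pos k_pos by (intro ennreal_lessI) auto
          ultimately show False using far by (auto simp: \<theta>)
        qed
      qed
      show "E \<times> ?s \<in> sets ?S" using E s by auto
      show "ennreal (?\<mu> n) \<le> emeasure ?S (E \<times> ?s)"
      proof -
        have "emeasure ?G ?s = emeasure G ?s"
          using \<sigma>\<^sub>0 by (intro emeasure_restrict_space) (auto simp: G)
        moreover have "ennreal (g\<^sub>0 * (\<sigma>\<^sub>0 / n)) \<le> emeasure G ?s"
          using \<sigma>\<^sub>0 elim(3) by (intro G_ge) auto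
        ultimately have "ennreal (exp (- (?L ^ 6 / 2))) * ennreal (g\<^sub>0 * (\<sigma>\<^sub>0 / n)) \<le> emeasure D E * emeasure ?G ?s"
          using E(2) by (intro mult_mono) auto
        also have "\<dots> = emeasure ?S (E \<times> ?s)"
          by (rule G'.emeasure_pair_measure_Times[OF E(1) s, symmetric])
        finally show ?thesis
          using e \<sigma>\<^sub>0 by (subst ennreal_mult) auto
      qed
      show "exp (- 4 / n) * p\<^sub>0 x \<le> ?f \<theta> x" if "\<theta> \<in> E \<times> ?s" "\<bar>x\<bar> \<le> 2 * ?L" for \<theta> x
        using that ratio by (auto simp: p\<^sub>0)
      show "emeasure (density lborel (\<lambda>x. ennreal (p\<^sub>0 x))) {x. 2 * ?L < \<bar>x\<bar>} \<le> ennreal (C * exp (- (2 * ?L)))"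
        using tail[of "2 * ?L"] unfolding P\<^sub>0 .
    qed (use f_meas f_dens p\<^sub>0_meas p\<^sub>0_pos prob_P\<^sub>0 P\<^sub>0 \<delta> C \<epsilon> e \<sigma>\<^sub>0 n in auto)
    moreover have "real n * (\<delta> / 2)\<^sup>2 / 2 = ?L ^ 8 / 8"
      using n by (simp add: \<delta>_def power_divide flip: power_mult)
    moreover have "real (card (?I n)) = 4 * (2 * (real n)\<^sup>2 + 1)"
    proof -
      have "card {- (int n)\<^sup>2..(int n)\<^sup>2} = 2 * n\<^sup>2 + 1"
        by (simp add: nat_add_distrib nat_mult_distrib nat_power_eq)
      then show ?thesis by (simp add: card_cartesian_product)
    qed
    ultimately show ?case unfolding mixture_prior_def by simp
  qed

  have "tendsto_in_prob ?M (\<lambda>n X. posterior (mixture_prior D G) n X (?far n)) 0"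
    unfolding tendsto_in_prob_def
  proof (intro allI impI)
    fix \<epsilon> :: real assume \<epsilon>: "0 < \<epsilon>"
    define c' where "c' = \<epsilon> * exp (- 4) * g\<^sub>0 * \<sigma>\<^sub>0"
    have c': "0 < c'" using \<epsilon> e \<sigma>\<^sub>0 by (simp add: c'_def)
    \<comment> \<open>The first summand is \<open>C / n\<close>. In the last one the exponentials
      combine to \<open>exp (L^6 / 2 - L^8 / 8)\<close>, which beats the powers of
      \<open>n\<close>.\<close>
    have "(\<lambda>n. real n * (C * exp (- (2 * ln (real n)))) + 4 * (2 * (real n)\<^sup>2 + 1) * exp (- (ln (real n) ^ 8 / 8)) +
        4 * (2 * (real n)\<^sup>2 + 1) * exp (- (ln (real n) ^ 8 / 8)) / (c' * exp (- (ln (real n) ^ 6 / 2)) / real n)) \<longlonglongrightarrow> 0"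
      using C c' by real_asymp
    also have "(\<lambda>n. c' * exp (- (ln (real n) ^ 6 / 2)) / real n) = (\<lambda>n. \<epsilon> * exp (- 4) * ?\<mu> n)"
      by (simp add: c'_def mult_ac)
    note lim = calculation[unfolded fun_cong[OF this]]
    show "(\<lambda>n. measure ?M {X \<in> space ?M. \<epsilon> < \<bar>posterior (mixture_prior D G) n X (?far n) - 0\<bar>}) \<longlonglongrightarrow> 0"
      using bound[OF \<epsilon>] by (intro tendsto_sandwich[OF _ _ tendsto_const lim]) auto
  qed
  then show ?thesis
    by (intro exI[of _ 1] exI[of _ 6] conjI) auto
qed

end
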